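(* Let $0<T\le\infty$. Assume $u_0\in L^1_{\mathrm{loc}}(\mathbb{R}^3;\mathbb{R}^3)$ is divergence-free and $u\in L^2_{\mathrm{loc}}(\mathbb{R}^3\times[0,T])$ satisfy $$\lim_{R\to\infty}\frac1{R^3}\int_{B_R(0)}|u_0|\,dx=0\qquad\text{and}\qquad \lim_{R\to\infty}\frac1{R^3}\int_0^T\!\!\int_{B_R(0)}|u|^2\,dx\,dt=0 .$$ If additionally the pair $(u,p)$ is a weak solution on $\mathbb{R}^3\times(0,T)$ for $u_0$ (in the sense defined in the context), then $p$ satisfies the distributional local pressure expansion (for $u$).
   Context: Repeated indices $i,j$ are summed over $\{1,2,3\}$. The Navier-Stokes equations (NSE) on $\mathbb{R}^3\times(0,T)$ are $\partial_t u-\Delta u+u\cdot\nabla u+\nabla p=0$, $\nabla\cdot u=0$, understood in the sense of distributions, with $u\cdot\nabla u=\nabla\cdot(u\otimes u)$. $L^2_{\mathrm{uloc}}$ has norm $\|f\|_{L^2_{\mathrm{uloc}}}=\sup_{x_0\in\mathbb{R}^3}\|f\|_{L^2(B_1(x_0))}$. $L^2_{\mathrm{uloc}}(0,T)$ denotes the class of vector fields $u:\mathbb{R}^3\times(0,T)\to\mathbb{R}^3$ with $\operatorname{ess\,sup}_{0<t<T}\|u(t)\|_{L^2_{\mathrm{uloc}}}<\infty$. Weak solution: for divergence-free $u_0\in L^1_{\mathrm{loc}}$, a pair $(u,p)$ is a weak solution for $u_0$ if (1) $u,p\in\mathcal D'(\mathbb{R}^3\times(0,T))$ and $u\in L^2_{\mathrm{uloc}}(0,T)$;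 (2) $(u,p)$ solves NSE in $\mathcal D'(\mathbb{R}^3\times(0,T))$; (3) for every scalar $\psi\in C_0^\infty(\mathbb{R}^3\times[0,T))$ and $k=1,2,3$ the limit $\int_{0+}^T\langle p,\partial_k\psi\rangle\,dt:=\lim_{\epsilon\to0^+}\int_\epsilon^T\langle p,\partial_k\psi\rangle\,dt$ exists; (4) for every $\psi\in C_0^\infty(\mathbb{R}^3\times[0,T))^3$ and each $k=1,2,3$ (no sum over $k$), $$\int_0^T\!\!\int u_k(\partial_t\psi_k+\Delta\psi_k+u_j\partial_j\psi_k)\,dx\,dt+\int_{0+}^T\langle p,\partial_k\psi_k\rangle\,dt=-\int u_{0k}\,\psi_k(\cdot,0)\,dx .$$ Kernels: $K_{ij}(y)=\partial_i\partial_j\frac1{4\pi|y|}=\frac{-\delta_{ij}|y|^2+3y_iy_j}{4\pi|y|^5}$ and $R_iR_jf=-\frac13\delta_{ij}f+\mathrm{p.v.}\int K_{ij}(\cdot-y)f(y)\,dy$. Fix $\Theta\in C_c^\infty(\mathbb{R}^3)$ with $\Theta=1$ on $B_2(0)$, $\operatorname{supp}\Theta\subset B_4(0)$, and set $\theta_R(x)=\Theta(x/R)$. Distributional local pressure expansion: let $u\in L^2_{\mathrm{uloc}}(0,T)$ be a distributional solution of NSE with associated pressure $p\in\mathcal D'(\mathbb{R}^3\times(0,T))$. Then $p$ satisfies the distributional local pressure expansion (for $u$) if for every $R>0$ and $x_0\in\mathbb{R}^3$ there is a spatially constant function of time $c_{x_0,R}\in L^1(0,T)$ such that for every vector-valued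 $\psi\in\mathcal D(B_R(x_0)\times(0,T))^3$, $$\int_0^T\langle p-c_{x_0,R}(t),\nabla\cdot\psi\rangle\,dt=\int_0^T\!\!\int u_iu_j\,\theta_R(x_0-x)\,R_iR_j(\nabla\cdot\psi)\,dx\,dt$$ $$\qquad+\int_0^T\!\!\int\!\!\int\big(K_{ij}(x-y)-K_{ij}(x_0-y)\big)(1-\theta_R(x_0-y))\,(u_iu_j)(y,t)\,dy\,(\nabla\cdot\psi)(x,t)\,dx\,dt .$$ *)

theory Defs
  imports "HOL-Analysis.Analysis" "HOL-Probability.Essential_Supremum"
begin

section \<open>Smooth functions, test functions and distributions\<close>

definition dir_deriv :: "'a \<Rightarrow> ('a::real_normed_vector \<Rightarrow> 'b::real_normed_vector) \<Rightarrow> 'a \<Rightarrow> 'b" where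
  "dir_deriv v f = (\<lambda>x. frechet_derivative f (at x) v)"

definition iter_deriv :: "'a list \<Rightarrow> ('a::real_normed_vector \<Rightarrow> 'b::real_normed_vector) \<Rightarrow> 'a \<Rightarrow> 'b" where
  "iter_deriv vs f = foldr dir_deriv vs f"

text \<open>The list may be empty; differentiability of every iterated derivative includes the
  continuity of all of them, so this is \<open>C\<^sup>\<infinity>\<close> on the whole space.\<close>

definition smooth :: "('a::real_normed_vector \<Rightarrow> 'b::real_normed_vector) \<Rightarrow> bool" where
  "smooth f \<longleftrightarrow> (\<forall>vs x. iter_deriv vs f differentiable (at x))"

definition tsupp :: "('a::topological_space \<Rightarrow> 'b::zero) \<Rightarrow> 'a set" where
  "tsupp f = closure {x. f x \<noteq> 0}"

definition test_fun :: "'a set \<Rightarrow> ('a::euclidean_space \<Rightarrow> real) set" where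
  "test_fun \<Omega> = {\<phi>. smooth \<phi> \<and> compact (tsupp \<phi>) \<and> tsupp \<phi> \<subseteq> \<Omega>}"

text \<open>A distribution is a functional whose values off the test functions are irrelevant.
  Continuity is the usual seminorm estimate on each compact set, with \<open>M\<close> standing for
  a bound on the \<open>C\<^sup>N\<close> norm of the test function.\<close>

definition distribution_on ::
    "'a set \<Rightarrow> (('a::euclidean_space \<Rightarrow> real) \<Rightarrow> real) \<Rightarrow> bool" where
  "distribution_on \<Omega> F \<longleftrightarrow>
     (\<forall>\<phi>\<in>test_fun \<Omega>. \<forall>\<psi>\<in>test_fun \<Omega>. \<forall>a b. F (\<lambda>z. a * \<phi> z + b * \<psi> z) = a * F \<phi> + b * F \<psi>) \<and>
     (\<forall>K. compact K \<and> K \<subseteq> \<Omega> \<longrightarrow>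
       (\<exists>C N. \<forall>\<phi>\<in>test_fun \<Omega>. \<forall>M. tsupp \<phi> \<subseteq> K \<and>
          (\<forall>vs z. set vs \<subseteq> Basis \<and> length vs \<le> N \<longrightarrow> \<bar>iter_deriv vs \<phi> z\<bar> \<le> M)
          \<longrightarrow> \<bar>F \<phi>\<bar> \<le> C * M))"

definition distr_deriv ::
    "'a \<Rightarrow> (('a::euclidean_space \<Rightarrow> real) \<Rightarrow> real) \<Rightarrow> ('a \<Rightarrow> real) \<Rightarrow> real" where
  "distr_deriv v F = (\<lambda>\<phi>. - F (dir_deriv v \<phi>))"

definition fun_distr ::
    "'a set \<Rightarrow> ('a::euclidean_space \<Rightarrow> real) \<Rightarrow> ('a \<Rightarrow> real) \<Rightarrow> real" where
  "fun_distr \<Omega> f = (\<lambda>\<phi>. LINT z:\<Omega>|lborel. f z * \<phi> z)"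


section \<open>Space-time\<close>

type_synonym space = "real^3"
type_synonym spacetime = "(real^3) \<times> real"

definition slab :: "ereal \<Rightarrow> spacetime set" where
  "slab T = UNIV \<times> einterval 0 T"

definition e_x :: "3 \<Rightarrow> spacetime" where
  "e_x k = (axis k 1, 0)"

definition e_t :: spacetime where
  "e_t = (0, 1)"

text \<open>Test functions on \<open>\<real>\<^sup>3 \<times> [0,T)\<close> need not vanish at \<open>t = 0\<close>.  They are the restrictions
  to \<open>t \<ge> 0\<close> of smooth functions on space-time with compact support in \<open>t < T\<close>; below only
  the values for \<open>t \<ge> 0\<close> are used.\<close>

definition test_fun_initial :: "ereal \<Rightarrow> (spacetime \<Rightarrow> real) set" where
  "test_fun_initial T = test_fun (UNIV \<times> {t. ereal t < T})"

definition spatial_div :: "(spacetime \<Rightarrow> real^3) \<Rightarrow> spacetime \<Rightarrow> real" where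
  "spatial_div \<psi> = (\<lambda>z. \<Sum>i\<in>UNIV. dir_deriv (e_x i) (\<lambda>w. \<psi> w $ i) z)"


section \<open>Function classes\<close>

definition L1_loc :: "(space \<Rightarrow> real^3) \<Rightarrow> bool" where
  "L1_loc f \<longleftrightarrow> (\<forall>K. compact K \<longrightarrow> set_integrable lborel K f)"

definition distr_div_free :: "(space \<Rightarrow> real^3) \<Rightarrow> bool" where
  "distr_div_free f \<longleftrightarrow>
     (\<forall>\<phi>\<in>test_fun UNIV. (\<Sum>i\<in>UNIV. distr_deriv (axis i 1) (fun_distr UNIV (\<lambda>x. f x $ i)) \<phi>) = 0)"

text \<open>\<open>L\<^sup>2\<^sub>l\<^sub>o\<^sub>c(\<real>\<^sup>3 \<times> [0,T])\<close>: integrability holds up to \<open>t = 0\<close>, and up to \<open>t = T\<close> if \<open>T < \<infinity>\<close>.\<close>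

definition L2_loc_closed :: "ereal \<Rightarrow> (spacetime \<Rightarrow> real^3) \<Rightarrow> bool" where
  "L2_loc_closed T u \<longleftrightarrow> set_borel_measurable lborel (slab T) u \<and>
     (\<forall>K. compact K \<and> K \<subseteq> UNIV \<times> {t. 0 \<le> t \<and> ereal t \<le> T} \<longrightarrow>
        set_integrable lborel (K \<inter> slab T) (\<lambda>z. (norm (u z))\<^sup>2))"

definition ennreal_sqrt :: "ennreal \<Rightarrow> ennreal" where
  "ennreal_sqrt a = (if a = \<infinity> then \<infinity> else ennreal (sqrt (enn2real a)))"

definition L2uloc_norm :: "(space \<Rightarrow> real^3) \<Rightarrow> ennreal" where
  "L2uloc_norm f =
     (SUP x0. ennreal_sqrt (\<integral>\<^sup>+x\<in>ball x0 1. ennreal ((norm (f x))\<^sup>2) \<partial>lborel))"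

definition L2uloc :: "ereal \<Rightarrow> (spacetime \<Rightarrow> real^3) \<Rightarrow> bool" where
  "L2uloc T u \<longleftrightarrow> set_borel_measurable lborel (slab T) u \<and>
     esssup (restrict_space lborel (einterval 0 T)) (\<lambda>t. L2uloc_norm (\<lambda>x. u (x, t))) < \<infinity>"


section \<open>Weak solutions\<close>

definition solves_NSE ::
    "ereal \<Rightarrow> (spacetime \<Rightarrow> real^3) \<Rightarrow> ((spacetime \<Rightarrow> real) \<Rightarrow> real) \<Rightarrow> bool" where
  "solves_NSE T u p \<longleftrightarrow>
     (\<forall>\<phi>\<in>test_fun (slab T).
        (\<forall>k. distr_deriv e_t (fun_distr (slab T) (\<lambda>z. u z $ k)) \<phi>
             - (\<Sum>j\<in>UNIV. distr_deriv (e_x j) (distr_deriv (e_x j) (fun_distr (slab T) (\<lambda>z. u z $ k))) \<phi>)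
             + (\<Sum>j\<in>UNIV. distr_deriv (e_x j) (fun_distr (slab T) (\<lambda>z. u z $ j * u z $ k)) \<phi>)
             + distr_deriv (e_x k) p \<phi> = 0) \<and>
        (\<Sum>j\<in>UNIV. distr_deriv (e_x j) (fun_distr (slab T) (\<lambda>z. u z $ j)) \<phi>) = 0)"

definition smooth_step :: "(real \<Rightarrow> real) \<Rightarrow> bool" where
  "smooth_step \<eta> \<longleftrightarrow> smooth \<eta> \<and> (\<forall>s\<le>0. \<eta> s = 0) \<and> (\<forall>s\<ge>1. \<eta> s = 1)"

text \<open>\<open>has_integral_from p \<phi> \<epsilon> J\<close> says \<open>\<integral>\<^sub>\<epsilon>\<^sup>T \<langle>p, \<phi>\<rangle> dt = J\<close> for \<open>\<phi>\<close> in \<open>test_fun_initial T\<close>.  Since the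
  space-time distribution \<open>p\<close> cannot be applied to \<open>\<phi>\<close> cut off sharply at \<open>t = \<epsilon>\<close>, the pairing
  with the sharp cutoff is the limit of the pairings with smooth cutoffs, the same for all
  cutoff profiles.  If \<open>t \<mapsto> \<langle>p(t), \<phi>(t)\<rangle>\<close> is a locally integrable function on \<open>(0,T)\<close>, it is
  the ordinary integral.\<close>

definition has_integral_from ::
    "((spacetime \<Rightarrow> real) \<Rightarrow> real) \<Rightarrow> (spacetime \<Rightarrow> real) \<Rightarrow> real \<Rightarrow> real \<Rightarrow> bool" where
  "has_integral_from p \<phi> \<epsilon> J \<longleftrightarrow>
     (\<forall>\<eta>. smooth_step \<eta> \<longrightarrow>
        ((\<lambda>\<delta>. p (\<lambda>(x, t). \<eta> ((t - \<epsilon>) / \<delta>) * \<phi> (x, t))) \<longlongrightarrow> J) (at_right 0))"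

text \<open>\<open>\<integral>\<^sub>0\<^sub>+\<^sup>T \<langle>p, \<phi>\<rangle> dt = L\<close>.  For \<open>u\<close> merely measurable in time, the integral from \<open>\<epsilon>\<close> of a
  pressure gradient makes sense only at almost every \<open>\<epsilon>\<close> (a Lebesgue point in time), so an
  exceptional null set \<open>N\<close>, possibly empty, is left out of the limit.\<close>

definition has_integral_0plus ::
    "ereal \<Rightarrow> ((spacetime \<Rightarrow> real) \<Rightarrow> real) \<Rightarrow> (spacetime \<Rightarrow> real) \<Rightarrow> real \<Rightarrow> bool" where
  "has_integral_0plus T p \<phi> L \<longleftrightarrow>
     (\<exists>J. \<exists>N\<in>null_sets lborel.
        (\<forall>\<epsilon>\<in>einterval 0 T - N. has_integral_from p \<phi> \<epsilon> (J \<epsilon>)) \<and>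
        (J \<longlongrightarrow> L) (at 0 within einterval 0 T - N))"

text \<open>That \<open>u\<close> is a distribution follows from \<open>L2uloc T u\<close>.\<close>

definition weak_solution ::
    "ereal \<Rightarrow> (space \<Rightarrow> real^3) \<Rightarrow> (spacetime \<Rightarrow> real^3) \<Rightarrow> ((spacetime \<Rightarrow> real) \<Rightarrow> real) \<Rightarrow> bool" where
  "weak_solution T u0 u p \<longleftrightarrow>
     distribution_on (slab T) p \<and> L2uloc T u \<and>
     solves_NSE T u p \<and>
     (\<forall>\<psi>\<in>test_fun_initial T. \<forall>k. \<exists>L. has_integral_0plus T p (dir_deriv (e_x k) \<psi>) L) \<and>
     (\<forall>\<psi> :: spacetime \<Rightarrow> real^3. (\<forall>i. (\<lambda>z. \<psi> z $ i) \<in> test_fun_initial T) \<longrightarrow>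
       (\<forall>k. \<exists>L. has_integral_0plus T p (dir_deriv (e_x k) (\<lambda>z. \<psi> z $ k)) L \<and>
          (LINT z:slab T|lborel. u z $ k *
              (dir_deriv e_t (\<lambda>w. \<psi> w $ k) z
               + (\<Sum>j\<in>UNIV. dir_deriv (e_x j) (dir_deriv (e_x j) (\<lambda>w. \<psi> w $ k)) z)
               + (\<Sum>j\<in>UNIV. u z $ j * dir_deriv (e_x j) (\<lambda>w. \<psi> w $ k) z)))
          + L = - (LINT x|lborel. u0 x $ k * \<psi> (x, 0) $ k)))"


section \<open>Local pressure expansion\<close>

definition Kern :: "3 \<Rightarrow> 3 \<Rightarrow> space \<Rightarrow> real" where
  "Kern i j y = ((if i = j then - (norm y)\<^sup>2 else 0) + 3 * y $ i * y $ j) / (4 * pi * norm y ^ 5)"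

definition RR :: "3 \<Rightarrow> 3 \<Rightarrow> (space \<Rightarrow> real) \<Rightarrow> space \<Rightarrow> real" where
  "RR i j f x = (if i = j then - f x / 3 else 0)
     + Lim (at_right 0) (\<lambda>\<epsilon>. LINT y:{y. dist x y > \<epsilon>}|lborel. Kern i j (x - y) * f y)"

definition cutoff_profile :: "(space \<Rightarrow> real) \<Rightarrow> bool" where
  "cutoff_profile \<Theta> \<longleftrightarrow> \<Theta> \<in> test_fun (ball 0 4) \<and> (\<forall>x\<in>ball 0 2. \<Theta> x = 1)"

definition local_pressure_expansion ::
    "(space \<Rightarrow> real) \<Rightarrow> ereal \<Rightarrow> (spacetime \<Rightarrow> real^3) \<Rightarrow> ((spacetime \<Rightarrow> real) \<Rightarrow> real) \<Rightarrow> bool" where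
  "local_pressure_expansion \<Theta> T u p \<longleftrightarrow>
     (\<forall>R>0. \<forall>x0. \<exists>c. set_integrable lborel (einterval 0 T) c \<and>
       (\<forall>\<psi> :: spacetime \<Rightarrow> real^3.
          (\<forall>i. (\<lambda>z. \<psi> z $ i) \<in> test_fun (ball x0 R \<times> einterval 0 T)) \<longrightarrow>
          p (spatial_div \<psi>) - fun_distr (slab T) (\<lambda>(x, t). c t) (spatial_div \<psi>) =
            (LINT (x, t):slab T|lborel. (\<Sum>i\<in>UNIV. \<Sum>j\<in>UNIV.
               u (x, t) $ i * u (x, t) $ j * \<Theta> ((x0 - x) /\<^sub>R R)
               * RR i j (\<lambda>y. spatial_div \<psi> (y, t)) x))
          + (LINT (x, t):slab T|lborel.
               (LINT y|lborel. (\<Sum>i\<in>UNIV. \<Sum>j\<in>UNIV.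
                  (Kern i j (x - y) - Kern i j (x0 - y)) * (1 - \<Theta> ((x0 - y) /\<^sub>R R))
                  * (u (y, t) $ i * u (y, t) $ j)))
               * spatial_div \<psi> (x, t))))"

end

theory Submission
  imports Defs
begin

text \<open>
  The constant \<open>c\<close> plays no role: it is annihilated by divergences, so \<open>c = 0\<close> works and the claim
  is \<open>\<langle>p, f\<rangle> = \<integral>\<integral> u\<^sub>i u\<^sub>j R\<^sub>i R\<^sub>j f\<close> for \<open>f = \<nabla>\<cdot>\<psi>\<close>; the two terms of the expansion are the splitting
  of the right-hand side by the cutoff, the far part after Fubini (the kernel is even and \<open>f\<close> has
  mean zero).

  A harmonic function has the mean value property, so a possible harmonic part of the pressure
  can be averaged over large balls.  Concretely, let \<open>N\<close> be the Newtonian potential, \<open>N\<^sub>\<rho>\<close> the potential of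
  the uniform measure on the ball of radius \<open>\<rho>\<close> and \<open>a\<^sub>\<rho>\<close> the density of that measure.  As \<open>N - N\<^sub>\<rho>\<close> has
  compact support, \<open>\<Phi> = (N - N\<^sub>\<rho>) * f\<close> (convolution in space) is a test function with
  \<open>\<Delta>\<Phi> = a\<^sub>\<rho> * f - f\<close>.  Testing the momentum equation with \<open>\<nabla>\<Phi>\<close>
  removes the linear terms and gives
  \<open>\<langle>p, f\<rangle> = \<langle>p, a\<^sub>\<rho> * f\<rangle> + \<integral>\<integral> u\<^sub>i u\<^sub>j (R\<^sub>i R\<^sub>j f - \<partial>\<^sub>i \<partial>\<^sub>j N\<^sub>\<rho> * f)\<close>.
  As \<open>a\<^sub>\<rho> * f\<close> is a divergence, its pairing with \<open>p\<close> is computed from the momentum equation, and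
  all terms containing \<open>\<rho>\<close> tend to 0 by the decay of \<open>R\<^sup>-\<^sup>3 \<integral>\<integral> |u|\<^sup>2\<close> over the balls of radius \<open>R\<close>.
\<close>

section \<open>Test functions\<close>

text \<open>The obstacle is that nothing is known about the growth of \<open>p\<close>: it can be
  paired with compactly supported functions only, and the Newtonian potential of \<open>f\<close> is
  not one. Balls are chosen as the regularising measures because everything about them is explicit:
  the potential is a quadratic polynomial inside and \<open>1 / (4 * pi * norm x)\<close> outside,
  and both it and its gradient are Lipschitz. Two integrations by parts against Lipschitz kernels
  then replace the calculus of singular integrals. The same family of potentials is used at both
  ends of the scale. Radius \<open>s\<close> tending to 0 produces the principal value together with
  the term \<open>- f x / 3\<close> of \<open>RR\<close>, because the Hessian inside the ball is
  minus one third of the density on the diagonal. Large radii \<rho> give the averages. The averaged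
  linear terms are the delicate ones, since the hypothesis controls \<open>v\<close> quadratically
  while the support has volume of order \<open>\<rho> ^ 3\<close>, exactly the
  normalisation.\<close>

lemma iter_deriv_snoc: "iter_deriv (vs @ [v]) f = iter_deriv vs (dir_deriv v f)"
  by (simp add: iter_deriv_def)

lemma iter_deriv_Nil [simp]: "iter_deriv [] f = f"
  by (simp add: iter_deriv_def)

lemma iter_deriv_Cons: "iter_deriv (v # vs) f = dir_deriv v (iter_deriv vs f)"
  by (simp add: iter_deriv_def)

lemma smooth_dir_deriv: "smooth f \<Longrightarrow> smooth (dir_deriv v f)"
  by (simp add: smooth_def iter_deriv_snoc[symmetric])

lemma smooth_has_derivative:
  assumes "smooth f"
  shows "(f has_derivative (\<lambda>v. dir_deriv v f z)) (at z)"
proof -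
  have "f differentiable (at z)"
    using assms[unfolded smooth_def, rule_format, of "[]"] by simp
  then show ?thesis
    by (simp add: dir_deriv_def frechet_derivative_works)
qed

lemma dir_deriv_eq:
  "(f has_derivative D) (at z) \<Longrightarrow> dir_deriv v f z = D v"
  by (simp add: dir_deriv_def frechet_derivative_at[symmetric])

lemma smooth_continuous: "smooth f \<Longrightarrow> continuous_on UNIV f"
  by (intro continuous_at_imp_continuous_on ballI has_derivative_continuous[OF smooth_has_derivative])

lemma smooth_linear_dir_deriv: "smooth f \<Longrightarrow> linear (\<lambda>v. dir_deriv v f z)"
  by (rule has_derivative_linear[OF smooth_has_derivative])

lemma smooth_dir_deriv_sum_Basis:
  fixes f :: "'a::euclidean_space \<Rightarrow> real"
  assumes "smooth f"
  shows "dir_deriv v f z = (\<Sum>b\<in>Basis. (v \<bullet> b) * dir_deriv b f z)"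
proof -
  have "dir_deriv (\<Sum>b\<in>Basis. (v \<bullet> b) *\<^sub>R b) f z = (\<Sum>b\<in>Basis. (v \<bullet> b) * dir_deriv b f z)"
    by (simp add: linear_sum[OF smooth_linear_dir_deriv[OF assms]]
        linear_scale[OF smooth_linear_dir_deriv[OF assms]])
  then show ?thesis by (simp add: euclidean_representation)
qed

lemma nonzero_in_tsupp: "f z \<noteq> 0 \<Longrightarrow> z \<in> tsupp f"
  unfolding tsupp_def using closure_subset[of "{x. f x \<noteq> 0}"] by blast

lemma compact_tsupp_subset: "compact K \<Longrightarrow> tsupp f \<subseteq> K \<Longrightarrow> compact (tsupp f)"
  using compact_Int_closed[of K "tsupp f"] by (simp add: tsupp_def Int_absorb1)

lemma dir_deriv_eq_0_outside_tsupp: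
  assumes "z \<notin> tsupp f"
  shows "dir_deriv v f z = 0"
proof -
  have "open (- tsupp f)" by (simp add: tsupp_def open_Compl)
  moreover have "\<And>w. w \<in> - tsupp f \<Longrightarrow> 0 = f w"
    using nonzero_in_tsupp[of f] by auto
  ultimately have "(f has_derivative (\<lambda>_. 0)) (at z)"
    by (intro has_derivative_transform_within_open[OF has_derivative_const, of "- tsupp f" z 0 f UNIV])
      (use assms in simp_all)
  then show ?thesis by (rule dir_deriv_eq)
qed

lemma tsupp_dir_deriv: "tsupp (dir_deriv v f) \<subseteq> tsupp f"
proof -
  have "{z. dir_deriv v f z \<noteq> 0} \<subseteq> tsupp f"
    using dir_deriv_eq_0_outside_tsupp by blast
  then show ?thesis
    unfolding tsupp_def by (simp add: closure_minimal)
qed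

lemma test_fun_smooth: "\<phi> \<in> test_fun \<Omega> \<Longrightarrow> smooth \<phi>"
  by (simp add: test_fun_def)

lemma test_fun_mono: "\<phi> \<in> test_fun \<Omega> \<Longrightarrow> \<Omega> \<subseteq> \<Omega>' \<Longrightarrow> \<phi> \<in> test_fun \<Omega>'"
  by (auto simp: test_fun_def)

lemma test_fun_dir_deriv:
  assumes "\<phi> \<in> test_fun \<Omega>"
  shows "dir_deriv v \<phi> \<in> test_fun \<Omega>"
proof -
  have "compact (tsupp (dir_deriv v \<phi>))"
    using assms tsupp_dir_deriv[of v \<phi>] compact_tsupp_subset by (auto simp: test_fun_def)
  then show ?thesis
    using assms tsupp_dir_deriv[of v \<phi>] by (auto simp: test_fun_def smooth_dir_deriv)
qed

lemma test_fun_eq_0: "\<phi> \<in> test_fun \<Omega> \<Longrightarrow> z \<notin> \<Omega> \<Longrightarrow> \<phi> z = 0"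
  using nonzero_in_tsupp[of \<phi> z] by (auto simp: test_fun_def)

lemma test_fun_continuous: "\<phi> \<in> test_fun \<Omega> \<Longrightarrow> continuous_on UNIV \<phi>"
  by (rule smooth_continuous[OF test_fun_smooth])

lemma test_fun_measurable [measurable_dest]: "\<phi> \<in> test_fun \<Omega> \<Longrightarrow> \<phi> \<in> borel_measurable borel"
  by (simp add: borel_measurable_continuous_onI test_fun_continuous)

lemma test_fun_bounded:
  assumes "\<phi> \<in> test_fun \<Omega>"
  shows "\<exists>M>0. \<forall>z. \<bar>\<phi> z\<bar> \<le> M"
proof -
  have "compact (\<phi> ` tsupp \<phi>)"
    using assms test_fun_continuous[OF assms]
    by (auto simp: test_fun_def intro!: compact_continuous_image intro: continuous_on_subset)
  then obtain M where M: "\<And>y. y \<in> \<phi> ` tsupp \<phi> \<Longrightarrow> norm y \<le> M"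
    using compact_imp_bounded bounded_iff by metis
  have "\<bar>\<phi> z\<bar> \<le> max M 1" for z
  proof (cases "\<phi> z = 0")
    case False
    then have "z \<in> tsupp \<phi>" by (rule nonzero_in_tsupp)
    then show ?thesis using M[of "\<phi> z"] by simp
  qed auto
  then show ?thesis by (intro exI[of _ "max M 1"]) simp
qed

lemma test_fun_support_bounded:
  assumes "\<phi> \<in> test_fun \<Omega>"
  shows "\<exists>r>0. \<forall>z. \<phi> z \<noteq> 0 \<longrightarrow> norm z \<le> r"
proof -
  obtain a where a: "\<And>z. z \<in> tsupp \<phi> \<Longrightarrow> norm z \<le> a"
    using assms compact_imp_bounded[of "tsupp \<phi>"] by (auto simp: test_fun_def bounded_iff)
  have "norm z \<le> max a 1" if "\<phi> z \<noteq> 0" for z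
  proof -
    have "z \<in> tsupp \<phi>" using that by (rule nonzero_in_tsupp)
    then show ?thesis using a[of z] by linarith
  qed
  then show ?thesis by (intro exI[of _ "max a 1"]) simp
qed

lemma test_fun_Lipschitz:
  fixes \<phi> :: "'a::euclidean_space \<Rightarrow> real"
  assumes "\<phi> \<in> test_fun \<Omega>"
  shows "\<exists>L>0. \<forall>z w. \<bar>\<phi> z - \<phi> w\<bar> \<le> L * norm (z - w)"
proof -
  have "\<forall>b. \<exists>M>0. \<forall>z. \<bar>dir_deriv b \<phi> z\<bar> \<le> M"
    by (intro allI test_fun_bounded[OF test_fun_dir_deriv[OF assms]])
  from choice[OF this] obtain M where "\<forall>b. M b > 0 \<and> (\<forall>z. \<bar>dir_deriv b \<phi> z\<bar> \<le> M b)"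
    by (rule exE)
  then have M: "\<And>b. M b > 0" "\<And>b z. \<bar>dir_deriv b \<phi> z\<bar> \<le> M b"
    by simp_all
  have on: "onorm (\<lambda>v. dir_deriv v \<phi> z) \<le> (\<Sum>b\<in>Basis. M b)" for z
  proof (rule onorm_le)
    fix v :: 'a
    have "norm (dir_deriv v \<phi> z) \<le> (\<Sum>b\<in>Basis. \<bar>(v \<bullet> b) * dir_deriv b \<phi> z\<bar>)"
      by (subst smooth_dir_deriv_sum_Basis[OF test_fun_smooth[OF assms]]) (simp only: real_norm_def sum_abs)
    also have "\<dots> \<le> (\<Sum>b\<in>Basis. norm v * M b)"
      unfolding abs_mult
      by (intro sum_mono mult_mono Basis_le_norm M) auto
    also have "\<dots> = (\<Sum>b\<in>Basis. M b) * norm v"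
      unfolding sum_distrib_right by (rule sum.cong) (simp_all only: mult.commute)
    finally show "norm (dir_deriv v \<phi> z) \<le> (\<Sum>b\<in>Basis. M b) * norm v" .
  qed
  have "norm (\<phi> z - \<phi> w) \<le> (\<Sum>b\<in>Basis. M b) * norm (z - w)" for z w
    by (rule differentiable_bound[of UNIV \<phi> "\<lambda>z v. dir_deriv v \<phi> z"])
      (use on smooth_has_derivative[OF test_fun_smooth[OF assms]] in simp_all)
  moreover have "(\<Sum>b\<in>(Basis::'a set). M b) > 0"
    by (intro sum_pos M) auto
  ultimately show ?thesis
    by (intro exI[of _ "\<Sum>b\<in>(Basis::'a set). M b"]) simp
qed

text \<open>The gradient is Lipschitz, so the derivative varies by at most
  \<open>?C * norm h\<close> along the segment from \<open>z\<close> to \<open>z + h\<close>, and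
  linearising there leaves a quadratic remainder. The constant is uniform in \<open>z\<close>, which
  is what allows the remainder to be integrated against a kernel.\<close>

lemma test_fun_Taylor:
  fixes \<phi> :: "'a::euclidean_space \<Rightarrow> real"
  assumes "\<phi> \<in> test_fun \<Omega>"
  shows "\<exists>C>0. \<forall>z h. \<bar>\<phi> (z + h) - \<phi> z - dir_deriv h \<phi> z\<bar> \<le> C * (norm h)\<^sup>2"
proof -
  have "\<forall>b. \<exists>L>0. \<forall>z w. \<bar>dir_deriv b \<phi> z - dir_deriv b \<phi> w\<bar> \<le> L * norm (z - w)"
    by (intro allI test_fun_Lipschitz[OF test_fun_dir_deriv[OF assms]])
  from choice[OF this] obtain L
    where "\<forall>b. L b > 0 \<and> (\<forall>z w. \<bar>dir_deriv b \<phi> z - dir_deriv b \<phi> w\<bar> \<le> L b * norm (z - w))"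
    by (rule exE)
  then have L: "\<And>b. L b > 0" "\<And>b z w. \<bar>dir_deriv b \<phi> z - dir_deriv b \<phi> w\<bar> \<le> L b * norm (z - w)"
    by simp_all
  let ?C = "\<Sum>b\<in>(Basis::'a set). L b"
  have pos: "?C > 0" by (intro sum_pos L) auto
  have on: "onorm ((\<lambda>v. dir_deriv v \<phi> w) - (\<lambda>v. dir_deriv v \<phi> z)) \<le> ?C * norm (w - z)" for w z
  proof (rule onorm_le)
    fix v :: 'a
    have "norm (((\<lambda>v. dir_deriv v \<phi> w) - (\<lambda>v. dir_deriv v \<phi> z)) v)
        = \<bar>\<Sum>b\<in>Basis. (v \<bullet> b) * (dir_deriv b \<phi> w - dir_deriv b \<phi> z)\<bar>"
      unfolding fun_diff_def
      by (simp only: smooth_dir_deriv_sum_Basis[OF test_fun_smooth[OF assms], of v z]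
          smooth_dir_deriv_sum_Basis[OF test_fun_smooth[OF assms], of v w]
          sum_subtractf[symmetric] right_diff_distrib[symmetric] real_norm_def)
    also have "\<dots> \<le> (\<Sum>b\<in>Basis. \<bar>(v \<bullet> b) * (dir_deriv b \<phi> w - dir_deriv b \<phi> z)\<bar>)"
      by (rule sum_abs)
    also have "\<dots> \<le> (\<Sum>b\<in>Basis. norm v * (L b * norm (w - z)))"
      unfolding abs_mult
      by (intro sum_mono mult_mono Basis_le_norm L) auto
    also have "\<dots> = ?C * norm (w - z) * norm v"
      unfolding sum_distrib_right by (rule sum.cong) (simp_all only: mult_ac)
    finally show "norm (((\<lambda>v. dir_deriv v \<phi> w) - (\<lambda>v. dir_deriv v \<phi> z)) v) \<le> ?C * norm (w - z) * norm v" .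
  qed
  have "norm (\<phi> (z + h) - \<phi> z - dir_deriv (z + h - z) \<phi> z) \<le> norm (z + h - z) * (?C * norm h)" for z h
  proof (rule differentiable_bound_linearization[where S = "(\<lambda>t. z + t *\<^sub>R h) ` {0..1}" and f' = "\<lambda>w v. dir_deriv v \<phi> w"])
    show "\<And>t. t \<in> {0..1} \<Longrightarrow> z + t *\<^sub>R (z + h - z) \<in> (\<lambda>t. z + t *\<^sub>R h) ` {0..1}" by auto
    show "\<And>x. x \<in> (\<lambda>t. z + t *\<^sub>R h) ` {0..1} \<Longrightarrow>
        (\<phi> has_derivative (\<lambda>v. dir_deriv v \<phi> x)) (at x within (\<lambda>t. z + t *\<^sub>R h) ` {0..1})"
      by (rule has_derivative_at_withinI[OF smooth_has_derivative[OF test_fun_smooth[OF assms]]])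
    show "z \<in> (\<lambda>t. z + t *\<^sub>R h) ` {0..1}"
      by (rule image_eqI[of _ _ 0]) simp_all
    fix x assume "x \<in> (\<lambda>t. z + t *\<^sub>R h) ` {0..1}"
    then obtain t where t: "0 \<le> t" "t \<le> 1" "x = z + t *\<^sub>R h" by auto
    then have "norm (x - z) \<le> norm h"
      by (simp add: mult_left_le_one_le)
    then have "?C * norm (x - z) \<le> ?C * norm h"
      using pos by (intro mult_left_mono) simp_all
    then show "onorm ((\<lambda>v. dir_deriv v \<phi> x) - (\<lambda>v. dir_deriv v \<phi> z)) \<le> ?C * norm h"
      using on[of x z] by linarith
  qed
  then show ?thesis using pos by (intro exI[of _ ?C]) (simp add: power2_eq_square mult_ac)
qed

lemma dir_deriv_lincomb:
  assumes "smooth f" "smooth g"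
  shows "dir_deriv v (\<lambda>z. a * f z + b * g z :: real) = (\<lambda>z. a * dir_deriv v f z + b * dir_deriv v g z)"
proof (rule ext)
  fix z
  have "((\<lambda>z. a * f z + b * g z) has_derivative (\<lambda>v. a * dir_deriv v f z + b * dir_deriv v g z)) (at z)"
    by (intro has_derivative_add has_derivative_mult_right smooth_has_derivative assms)
  then show "dir_deriv v (\<lambda>z. a * f z + b * g z) z = a * dir_deriv v f z + b * dir_deriv v g z"
    by (rule dir_deriv_eq)
qed

lemma smooth_lincomb:
  assumes "smooth f" "smooth g"
  shows "smooth (\<lambda>z. a * f z + b * g z :: real)"
proof -
  have sm: "smooth (iter_deriv vs f)" if "smooth f" for vs and f :: "'a \<Rightarrow> real"
    by (induction vs) (auto simp: iter_deriv_Cons smooth_dir_deriv that)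
  have eq: "iter_deriv vs (\<lambda>z. a * f z + b * g z) = (\<lambda>z. a * iter_deriv vs f z + b * iter_deriv vs g z)" for vs
    by (induction vs) (auto simp: iter_deriv_Cons dir_deriv_lincomb sm assms)
  show ?thesis
    unfolding smooth_def eq using assms by (auto simp: smooth_def)
qed

lemma test_fun_lincomb:
  assumes "f \<in> test_fun \<Omega>" "g \<in> test_fun \<Omega>"
  shows "(\<lambda>z. a * f z + b * g z) \<in> test_fun \<Omega>"
proof -
  let ?h = "\<lambda>z. a * f z + b * g z"
  have "z \<in> tsupp f \<union> tsupp g" if "?h z \<noteq> 0" for z
    using nonzero_in_tsupp[of f z] nonzero_in_tsupp[of g z] that by (cases "f z = 0") auto
  then have "{z. ?h z \<noteq> 0} \<subseteq> tsupp f \<union> tsupp g" by blast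
  then have sub: "tsupp ?h \<subseteq> tsupp f \<union> tsupp g"
    by (metis closed_Un closed_closure closure_minimal tsupp_def)
  have "compact (tsupp f \<union> tsupp g)"
    using assms by (auto simp: test_fun_def)
  then have "compact (tsupp ?h)"
    using sub by (rule compact_tsupp_subset)
  moreover have "smooth ?h"
    using assms by (intro smooth_lincomb test_fun_smooth)
  moreover have "tsupp ?h \<subseteq> \<Omega>"
    using assms sub by (auto simp: test_fun_def)
  ultimately show ?thesis
    by (simp add: test_fun_def)
qed

lemma test_fun_sum:
  assumes "finite I" "I \<noteq> {}" "\<And>i. i \<in> I \<Longrightarrow> f i \<in> test_fun \<Omega>"
  shows "(\<lambda>z. \<Sum>i\<in>I. f i z) \<in> test_fun \<Omega>"
  using assms
proof (induction rule: finite_ne_induct)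
  case (insert i I)
  have "(\<lambda>z. \<Sum>i\<in>I. f i z) \<in> test_fun \<Omega>" "f i \<in> test_fun \<Omega>"
    using insert.IH insert.prems by simp_all
  then show ?case
    using test_fun_lincomb[of "f i" \<Omega> "\<lambda>z. \<Sum>i\<in>I. f i z" 1 1] insert.hyps by simp
qed simp

lemma has_real_derivative_along_line:
  assumes "smooth f"
  shows "((\<lambda>s. f (z + s *\<^sub>R v)) has_real_derivative dir_deriv v f (z + s *\<^sub>R v)) (at s)"
proof -
  have "((\<lambda>s. f (z + s *\<^sub>R v)) has_derivative (\<lambda>h. dir_deriv (h *\<^sub>R v) f (z + s *\<^sub>R v))) (at s)"
    by (rule has_derivative_compose[of "\<lambda>s. z + s *\<^sub>R v" "\<lambda>h. h *\<^sub>R v", OF _ smooth_has_derivative[OF assms]])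
      (auto intro!: derivative_eq_intros)
  then show ?thesis
    by (simp add: has_field_derivative_def linear_scale[OF smooth_linear_dir_deriv[OF assms]]
        mult_commute_abs)
qed

text \<open>The difference quotients in direction \<open>v\<close> converge uniformly by Taylor's formula, so the
  derivative in direction \<open>w\<close> passes to the limit.\<close>

lemma test_fun_dir_deriv_commute:
  fixes \<phi> :: "'a::euclidean_space \<Rightarrow> real"
  assumes \<phi>: "\<phi> \<in> test_fun \<Omega>"
  shows "dir_deriv v (dir_deriv w \<phi>) z = dir_deriv w (dir_deriv v \<phi>) z"
proof -
  let ?A = "dir_deriv v (dir_deriv w \<phi>)"
  obtain C where C: "C > 0" "\<And>z h. \<bar>dir_deriv w \<phi> (z + h) - dir_deriv w \<phi> z - dir_deriv h (dir_deriv w \<phi>) z\<bar> \<le> C * (norm h)\<^sup>2"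
    using test_fun_Taylor[OF test_fun_dir_deriv[OF \<phi>]] by blast
  obtain L where L: "L > 0" "\<And>z w'. \<bar>?A z - ?A w'\<bar> \<le> L * norm (z - w')"
    using test_fun_Lipschitz[OF test_fun_dir_deriv[OF test_fun_dir_deriv[OF \<phi>]]] by blast
  note sm = test_fun_smooth[OF \<phi>] test_fun_smooth[OF test_fun_dir_deriv[OF \<phi>]]
  define q where "q h y = (\<phi> (y + h *\<^sub>R v) - \<phi> y) / h" for h y
  have qlim: "((\<lambda>h. q h y) \<longlongrightarrow> dir_deriv v \<phi> y) (at 0)" for y
    using has_real_derivative_along_line[OF sm(1), of y v 0]
    by (simp add: has_field_derivative_iff q_def)
  \<comment> \<open>The mean value theorem is applied in direction \<open>w\<close> to the whole
    difference quotient in direction \<open>v\<close>. The bound has separate terms in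
    \<open>h\<close> and \<open>k\<close>, so \<open>h\<close> can go to 0 with \<open>k\<close>
    fixed, and \<open>k\<close> afterwards.\<close>
  have bound: "\<bar>(q h (z + k *\<^sub>R w) - q h z) / k - ?A z\<bar> \<le> C * (norm v)\<^sup>2 * \<bar>h\<bar> + L * \<bar>k\<bar> * norm w"
    if "h \<noteq> 0" "k > 0" for h k
  proof -
    have der: "((\<lambda>s. q h (z + s *\<^sub>R w)) has_real_derivative
        (dir_deriv w \<phi> (z + s *\<^sub>R w + h *\<^sub>R v) - dir_deriv w \<phi> (z + s *\<^sub>R w)) / h) (at s)" for s
      unfolding q_def
      using DERIV_cdivide[OF DERIV_diff[OF
            has_real_derivative_along_line[OF sm(1), of "z + h *\<^sub>R v" w s]
            has_real_derivative_along_line[OF sm(1), of z w s]], of h]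
      by (simp add: add_ac)
    from MVT2[OF \<open>k > 0\<close>, of "\<lambda>s. q h (z + s *\<^sub>R w)", OF der]
    obtain s where s: "0 < s" "s < k" "q h (z + k *\<^sub>R w) - q h (z + 0 *\<^sub>R w) = (k - 0) *
        ((dir_deriv w \<phi> (z + s *\<^sub>R w + h *\<^sub>R v) - dir_deriv w \<phi> (z + s *\<^sub>R w)) / h)"
      by blast
    then have e: "(q h (z + k *\<^sub>R w) - q h z) / k
        = (dir_deriv w \<phi> (z + s *\<^sub>R w + h *\<^sub>R v) - dir_deriv w \<phi> (z + s *\<^sub>R w)) / h"
      using \<open>k > 0\<close> by simp
    have "dir_deriv (h *\<^sub>R v) (dir_deriv w \<phi>) (z + s *\<^sub>R w) = h * ?A (z + s *\<^sub>R w)"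
      using linear_scale[OF smooth_linear_dir_deriv[OF sm(2)[of w]]] by simp
    then have "\<bar>dir_deriv w \<phi> (z + s *\<^sub>R w + h *\<^sub>R v) - dir_deriv w \<phi> (z + s *\<^sub>R w) - h * ?A (z + s *\<^sub>R w)\<bar>
        \<le> C * (norm (h *\<^sub>R v))\<^sup>2"
      using C(2)[of "z + s *\<^sub>R w" "h *\<^sub>R v"] by simp
    then have "\<bar>(dir_deriv w \<phi> (z + s *\<^sub>R w + h *\<^sub>R v) - dir_deriv w \<phi> (z + s *\<^sub>R w)) - h * ?A (z + s *\<^sub>R w)\<bar> / \<bar>h\<bar>
        \<le> C * (norm (h *\<^sub>R v))\<^sup>2 / \<bar>h\<bar>"
      by (rule divide_right_mono) simp
    also have "\<dots> = C * (norm v)\<^sup>2 * \<bar>h\<bar>"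
      using \<open>h \<noteq> 0\<close> by (simp add: power2_eq_square field_simps)
    finally have "\<bar>((dir_deriv w \<phi> (z + s *\<^sub>R w + h *\<^sub>R v) - dir_deriv w \<phi> (z + s *\<^sub>R w)) - h * ?A (z + s *\<^sub>R w)) / h\<bar>
        \<le> C * (norm v)\<^sup>2 * \<bar>h\<bar>"
      by (simp add: abs_divide)
    then have 1: "\<bar>(q h (z + k *\<^sub>R w) - q h z) / k - ?A (z + s *\<^sub>R w)\<bar> \<le> C * (norm v)\<^sup>2 * \<bar>h\<bar>"
      unfolding e using \<open>h \<noteq> 0\<close> by (simp add: diff_divide_distrib)
    have "\<bar>?A (z + s *\<^sub>R w) - ?A z\<bar> \<le> L * (s * norm w)"
      using L(2)[of "z + s *\<^sub>R w" z] s by simp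
    also have "\<dots> \<le> L * \<bar>k\<bar> * norm w"
      using s L by (auto simp: mult_right_mono)
    finally show ?thesis using 1 by linarith
  qed
  have "\<bar>(dir_deriv v \<phi> (z + k *\<^sub>R w) - dir_deriv v \<phi> z) / k - ?A z\<bar> \<le> L * \<bar>k\<bar> * norm w" if "k > 0" for k
  proof (rule tendsto_le[OF _ _ _ ])
    show "((\<lambda>h. \<bar>(q h (z + k *\<^sub>R w) - q h z) / k - ?A z\<bar>) \<longlongrightarrow>
        \<bar>(dir_deriv v \<phi> (z + k *\<^sub>R w) - dir_deriv v \<phi> z) / k - ?A z\<bar>) (at 0)"
      using that by (intro tendsto_intros qlim) auto
    have "((\<lambda>h. C * (norm v)\<^sup>2 * \<bar>h\<bar> + L * \<bar>k\<bar> * norm w) \<longlongrightarrow> C * (norm v)\<^sup>2 * \<bar>0\<bar> + L * \<bar>k\<bar> * norm w) (at (0::real))"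
      by (intro tendsto_intros)
    then show "((\<lambda>h. C * (norm v)\<^sup>2 * \<bar>h\<bar> + L * \<bar>k\<bar> * norm w) \<longlongrightarrow> L * \<bar>k\<bar> * norm w) (at (0::real))" by simp
    show "\<forall>\<^sub>F h in at 0. \<bar>(q h (z + k *\<^sub>R w) - q h z) / k - ?A z\<bar> \<le> C * (norm v)\<^sup>2 * \<bar>h\<bar> + L * \<bar>k\<bar> * norm w"
      using bound[OF _ that] by (auto simp: eventually_at_filter)
  qed auto
  then have ev: "\<forall>\<^sub>F k in at_right 0. norm ((dir_deriv v \<phi> (z + k *\<^sub>R w) - dir_deriv v \<phi> z) / k - ?A z) \<le> L * \<bar>k\<bar> * norm w"
    by (auto simp: eventually_at_filter)
  have "((\<lambda>k. L * \<bar>k\<bar> * norm w) \<longlongrightarrow> L * \<bar>0\<bar> * norm w) (at_right (0::real))"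
    by (intro tendsto_intros)
  then have "((\<lambda>k. (dir_deriv v \<phi> (z + k *\<^sub>R w) - dir_deriv v \<phi> z) / k - ?A z) \<longlongrightarrow> 0) (at_right 0)"
    by (intro Lim_null_comparison[OF ev]) simp
  then have 1: "((\<lambda>k. (dir_deriv v \<phi> (z + k *\<^sub>R w) - dir_deriv v \<phi> z) / k) \<longlongrightarrow> ?A z) (at_right 0)"
    by (simp add: LIM_zero_iff)
  have "((\<lambda>k. (dir_deriv v \<phi> (z + k *\<^sub>R w) - dir_deriv v \<phi> z) / k) \<longlongrightarrow> dir_deriv w (dir_deriv v \<phi>) z) (at_right 0)"
    using has_real_derivative_along_line[OF sm(2)[of v], of z w 0]
    by (auto simp: has_field_derivative_iff intro: tendsto_mono[OF at_le])
  with 1 show ?thesis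
    using tendsto_unique trivial_limit_at_right_real by blast
qed

section \<open>Convolution in the first variable\<close>

text \<open>The kernel lives on the first factor, so the second variable is a mere parameter. The
  shift is put on \<open>f\<close>: derivatives in every direction, time included, then fall on
  \<open>f\<close>, and \<open>k\<close> may be rough.\<close>

definition conv :: "('a::euclidean_space \<Rightarrow> real) \<Rightarrow> ('a \<times> 'b::euclidean_space \<Rightarrow> real) \<Rightarrow> 'a \<times> 'b \<Rightarrow> real"
  where "conv k f z = (LINT y|lborel. k y * f (z - (y, 0)))"

lemma measurable_shift [measurable]:
  fixes f :: "'a::euclidean_space \<times> 'b::euclidean_space \<Rightarrow> real"
  assumes [measurable]: "f \<in> borel_measurable borel"
  shows "(\<lambda>y. f (z - (y, 0))) \<in> borel_measurable borel"
proof -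
  have [measurable]: "(\<lambda>y::'a. z - (y, 0)) \<in> borel_measurable borel"
    by (intro borel_measurable_continuous_onI continuous_intros)
  show ?thesis by measurable
qed

lemma integrable_conv:
  fixes f :: "'a::euclidean_space \<times> 'b::euclidean_space \<Rightarrow> real"
  assumes "integrable lborel k" "f \<in> borel_measurable borel" "\<And>z. \<bar>f z\<bar> \<le> M"
  shows "integrable lborel (\<lambda>y. k y * f (z - (y, 0)))"
proof (rule Bochner_Integration.integrable_bound)
  show "integrable lborel (\<lambda>y. M * k y)" using assms(1) by simp
  show "(\<lambda>y. k y * f (z - (y, 0))) \<in> borel_measurable lborel"
    using assms(1,2) by measurable
  have "0 \<le> M" using assms(3)[of 0] by linarith
  then show "AE y in lborel. norm (k y * f (z - (y, 0))) \<le> norm (M * k y)"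
    using assms(3) by (intro AE_I2) (simp add: abs_mult mult.commute[of M] mult_left_mono)
qed

lemma integrable_bounded_support:
  fixes f :: "'a::euclidean_space \<Rightarrow> real"
  assumes "f \<in> borel_measurable borel" "\<And>y. \<bar>f y\<bar> \<le> M" "\<And>y. f y \<noteq> 0 \<Longrightarrow> norm y \<le> r"
  shows "integrable lborel f"
proof (rule Bochner_Integration.integrable_bound)
  show "integrable lborel (\<lambda>y::'a. M * indicator (cball 0 r) y)"
    using emeasure_lborel_cball_finite[of "0::'a" r] by simp
  show "AE y in lborel. norm (f y) \<le> norm (M * indicator (cball 0 r) y)"
  proof (rule AE_I2)
    fix y
    have "0 \<le> M" using assms(2)[of 0] by linarith
    then show "norm (f y) \<le> norm (M * indicator (cball 0 r) y)"
      using assms(2,3)[of y] by (cases "f y = 0") (auto simp: dist_norm)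
  qed
qed (use assms in simp)

lemma abs_integral_le:
  fixes f :: "'a \<Rightarrow> real"
  assumes "integrable M g" "f \<in> borel_measurable M" "\<And>x. \<bar>f x\<bar> \<le> g x"
  shows "\<bar>integral\<^sup>L M f\<bar> \<le> integral\<^sup>L M g"
proof -
  have "integrable M f"
    using assms(1,2) by (rule Bochner_Integration.integrable_bound)
      (use assms(3) in \<open>auto intro: order_trans[OF _ abs_ge_self]\<close>)
  then have "(LINT x|M. \<bar>f x\<bar>) \<le> integral\<^sup>L M g"
    using assms by (intro integral_mono) auto
  then show ?thesis by (rule order_trans[OF integral_norm_bound[of M f, unfolded real_norm_def]])
qed

lemma support_shift:
  fixes f :: "'a::euclidean_space \<times> 'b::euclidean_space \<Rightarrow> real"
  assumes "\<And>z. f z \<noteq> 0 \<Longrightarrow> norm z \<le> r" "f (z - (y, 0)) \<noteq> 0"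
  shows "norm y \<le> norm z + r"
proof -
  have "norm (y, 0::'b) \<le> norm (z - (y, 0)) + norm z"
    using norm_triangle_ineq4[of z "z - (y, 0)"] by simp
  then show ?thesis using assms(1)[OF assms(2)] by (simp add: norm_Pair)
qed

text \<open>For kernels such as \<open>ball_pot\<close> that are bounded but not integrable over the
  whole space: here the compact support of \<open>f\<close> supplies the integrability.\<close>

lemma integrable_conv_test_fun:
  assumes "f \<in> test_fun \<Omega>" "k \<in> borel_measurable borel" "\<And>y. \<bar>k y\<bar> \<le> M"
  shows "integrable lborel (\<lambda>y. k y * f (z - (y, 0)))"
proof -
  obtain B where B: "B > 0" "\<And>z. \<bar>f z\<bar> \<le> B" using test_fun_bounded[OF assms(1)] by auto
  obtain r where r: "r > 0" "\<And>z. f z \<noteq> 0 \<Longrightarrow> norm z \<le> r" using test_fun_support_bounded[OF assms(1)] by auto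
  have [measurable]: "f \<in> borel_measurable borel" using assms(1) by measurable
  note assms(2)[measurable]
  have "0 \<le> M" using assms(3)[of 0] by linarith
  show ?thesis
  proof (rule integrable_bounded_support)
    show "\<bar>k y * f (z - (y, 0))\<bar> \<le> M * B" for y
      unfolding abs_mult using assms(3) B \<open>0 \<le> M\<close> by (intro mult_mono) auto
    show "norm y \<le> norm z + r" if "k y * f (z - (y, 0)) \<noteq> 0" for y
      by (rule support_shift[of f]) (use r that in auto)
  qed measurable
qed

lemma conv_eq_0:
  assumes "\<And>y. f (z - (y, 0)) \<noteq> 0 \<Longrightarrow> k y = 0"
  shows "conv k f z = 0"
proof -
  have "(\<lambda>y. k y * f (z - (y, 0))) = (\<lambda>_. 0)" using assms by fastforce
  then show ?thesis by (simp only: conv_def) simp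
qed

text \<open>The Taylor remainder of \<open>f\<close> is quadratic in \<open>w - z\<close> uniformly
  in the base point, so integrating it against the absolute value of \<open>k\<close> costs only the
  factor \<open>K\<close>. Integrability of \<open>k\<close> is enough, which admits the singularity
  of \<open>newton_diff\<close> at the origin.\<close>

lemma conv_has_derivative:
  assumes k: "integrable lborel k" and f: "f \<in> test_fun \<Omega>"
  shows "(conv k f has_derivative (\<lambda>v. conv k (dir_deriv v f) z)) (at z)"
proof -
  have int: "integrable lborel (\<lambda>y. k y * g (z - (y, 0)))" if g: "g \<in> test_fun \<Omega>" for g z
  proof -
    obtain B where "\<And>z. \<bar>g z\<bar> \<le> B" using test_fun_bounded[OF g] by blast
    moreover have "g \<in> borel_measurable borel" using g by measurable
    ultimately show ?thesis by (intro integrable_conv[OF k])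
  qed
  note df = test_fun_dir_deriv[OF f]
  note lin = smooth_linear_dir_deriv[OF test_fun_smooth[OF f]]
  have "linear (\<lambda>v. conv k (dir_deriv v f) z)"
  proof (rule linearI)
    show "conv k (dir_deriv (v + w) f) z = conv k (dir_deriv v f) z + conv k (dir_deriv w f) z" for v w
      unfolding conv_def
      by (subst Bochner_Integration.integral_add[symmetric])
        (auto intro!: int df simp: linear_add[OF lin] algebra_simps)
    show "conv k (dir_deriv (c *\<^sub>R v) f) z = c *\<^sub>R conv k (dir_deriv v f) z" for c v
      unfolding conv_def linear_scale[OF lin] by (simp add: mult.left_commute)
  qed
  then have bl: "bounded_linear (\<lambda>v. conv k (dir_deriv v f) z)"
    by (rule linear_conv_bounded_linear[THEN iffD1])
  obtain C where C: "C > 0" "\<And>z h. \<bar>f (z + h) - f z - dir_deriv h f z\<bar> \<le> C * (norm h)\<^sup>2"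
    using test_fun_Taylor[OF f] by blast
  define K where "K = (LINT y|lborel. \<bar>k y\<bar>)"
  have "K \<ge> 0" by (simp add: K_def)
  have bound: "norm (conv k f w - conv k f z - conv k (dir_deriv (w - z) f) z) \<le> C * K * (norm (w - z))\<^sup>2" for w
  proof -
    have "conv k f w - conv k f z - conv k (dir_deriv (w - z) f) z
        = (LINT y|lborel. k y * (f (w - (y, 0)) - f (z - (y, 0)) - dir_deriv (w - z) f (z - (y, 0))))"
      unfolding conv_def right_diff_distrib by (simp add: int f df)
    also have "norm \<dots> \<le> (LINT y|lborel. \<bar>k y\<bar> * (C * (norm (w - z))\<^sup>2))"
      unfolding real_norm_def
    proof (rule abs_integral_le)
      have "integrable lborel (\<lambda>y. k y * (f (w - (y, 0)) - f (z - (y, 0)) - dir_deriv (w - z) f (z - (y, 0))))"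
        unfolding right_diff_distrib by (simp add: int f df)
      then show "(\<lambda>y. k y * (f (w - (y, 0)) - f (z - (y, 0)) - dir_deriv (w - z) f (z - (y, 0)))) \<in> borel_measurable lborel"
        by (rule borel_measurable_integrable)
      show "integrable lborel (\<lambda>y. \<bar>k y\<bar> * (C * (norm (w - z))\<^sup>2))" using k by simp
      show "\<bar>k y * (f (w - (y, 0)) - f (z - (y, 0)) - dir_deriv (w - z) f (z - (y, 0)))\<bar>
          \<le> \<bar>k y\<bar> * (C * (norm (w - z))\<^sup>2)" for y
      proof -
        have "z - (y, 0) + (w - z) = w - (y, 0)" by simp
        then show ?thesis
          using C(2)[rule_format, of "z - (y, 0)" "w - z"] by (simp only: abs_mult mult_left_mono abs_ge_zero)
      qed
    qed
    also have "\<dots> = C * K * (norm (w - z))\<^sup>2" by (simp add: K_def)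
    finally show ?thesis .
  qed
  show ?thesis
    unfolding has_derivative_at_alt
  proof (intro conjI bl allI impI)
    fix e :: real assume "e > 0"
    \<comment> \<open>The \<open>+ 1\<close> keeps the radius positive when \<open>K\<close> is
      0.\<close>
    let ?d = "e / (C * K + 1)"
    have pos: "C * K + 1 > 0" using C \<open>K \<ge> 0\<close> by (simp add: add_nonneg_pos)
    have "norm (conv k f w - conv k f z - conv k (dir_deriv (w - z) f) z) \<le> e * norm (w - z)"
      if "norm (w - z) < ?d" for w
    proof -
      have "C * K * norm (w - z) \<le> (C * K + 1) * norm (w - z)" by (simp add: algebra_simps)
      also have "\<dots> \<le> e" using that pos by (simp add: field_simps)
      finally have "(C * K * norm (w - z)) * norm (w - z) \<le> e * norm (w - z)"
        by (rule mult_right_mono) simp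
      then show ?thesis using bound[of w] by (simp add: power2_eq_square mult.assoc)
    qed
    moreover have "?d > 0" using \<open>e > 0\<close> pos by simp
    ultimately show "\<exists>d>0. \<forall>w. norm (w - z) < d \<longrightarrow>
        norm (conv k f w - conv k f z - conv k (dir_deriv (w - z) f) z) \<le> e * norm (w - z)"
      by blast
  qed
qed

lemma dir_deriv_conv:
  assumes "integrable lborel k" "f \<in> test_fun \<Omega>"
  shows "dir_deriv v (conv k f) = conv k (dir_deriv v f)"
  by (rule ext) (rule dir_deriv_eq[OF conv_has_derivative[OF assms]])

text \<open>The support lies in the sum of \<open>tsupp f\<close> and a ball in the spatial
  directions, which is compact and leaves the range of times unchanged; hence the shape
  \<open>UNIV \<times> I\<close> of the domain. Smoothness comes from iterating
  \<open>dir_deriv_conv\<close>.\<close>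

lemma test_fun_conv:
  fixes f :: "'a::euclidean_space \<times> 'b::euclidean_space \<Rightarrow> real"
  assumes k: "integrable lborel k" "\<And>y. k y \<noteq> 0 \<Longrightarrow> norm y \<le> \<rho>"
    and f: "f \<in> test_fun (UNIV \<times> I)"
  shows "conv k f \<in> test_fun (UNIV \<times> I)"
proof -
  have "iter_deriv vs (conv k f) = conv k (iter_deriv vs f) \<and> iter_deriv vs f \<in> test_fun (UNIV \<times> I)" for vs
    by (induction vs) (auto simp: iter_deriv_Cons f dir_deriv_conv[OF k(1)] test_fun_dir_deriv)
  then have "smooth (conv k f)"
    unfolding smooth_def using conv_has_derivative[OF k(1)] by (metis differentiableI)
  moreover let ?S = "{x + y |x y. x \<in> tsupp f \<and> y \<in> cball 0 \<rho> \<times> {0::'b}}"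
  have cS: "compact ?S"
    using f by (intro compact_sums compact_Times) (auto simp: test_fun_def)
  have "{z. conv k f z \<noteq> 0} \<subseteq> ?S"
  proof
    fix z assume "z \<in> {z. conv k f z \<noteq> 0}"
    then obtain y where y: "k y \<noteq> 0" "f (z - (y, 0)) \<noteq> 0"
      using conv_eq_0[of f z k] by blast
    then have "z - (y, 0) \<in> tsupp f" "(y, 0) \<in> cball 0 \<rho> \<times> {0::'b}"
      using k(2) by (auto intro: nonzero_in_tsupp simp: dist_norm)
    moreover have "z = (z - (y, 0)) + (y, 0)" by simp
    ultimately show "z \<in> ?S" by blast
  qed
  then have sub: "tsupp (conv k f) \<subseteq> ?S"
    using closure_minimal[OF _ compact_imp_closed[OF cS]] by (simp only: tsupp_def)
  moreover have "?S \<subseteq> UNIV \<times> I"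
    using f by (force simp: test_fun_def)
  ultimately show ?thesis
    using compact_tsupp_subset[OF cS sub] by (auto simp: test_fun_def)
qed

lemma measurable_conv [measurable]:
  fixes f :: "'a::euclidean_space \<times> 'b::euclidean_space \<Rightarrow> real"
  assumes [measurable]: "k \<in> borel_measurable borel" "f \<in> borel_measurable borel"
  shows "conv k f \<in> borel_measurable borel"
proof -
  have [measurable]: "(\<lambda>(z, y). z - (y, 0)) \<in> borel_measurable (borel :: (('a \<times> 'b) \<times> 'a) measure)"
    unfolding case_prod_beta by (intro borel_measurable_continuous_onI continuous_intros)
  have "(\<lambda>(z, y). k y * f (z - (y, 0))) \<in> borel_measurable (borel \<Otimes>\<^sub>M lborel)"
    by measurable
  then show ?thesis
    unfolding conv_def[abs_def] by (rule lborel.borel_measurable_lebesgue_integral)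
qed

section \<open>Translation, reflection and integration by parts\<close>

lemma integral_lborel_shift:
  fixes g :: "'a::euclidean_space \<Rightarrow> real"
  assumes [measurable]: "g \<in> borel_measurable borel"
  shows "(LINT y|lborel. g (c + y)) = (LINT y|lborel. g y)"
proof -
  have "(LINT y|lborel. g y) = (LINT y|distr lborel borel ((+) c). g y)"
    by (simp add: lborel_distr_plus)
  also have "\<dots> = (LINT y|lborel. g (c + y))"
    by (rule integral_distr) measurable
  finally show ?thesis by simp
qed

lemma integral_lborel_reflect:
  fixes g :: "'a::euclidean_space \<Rightarrow> real"
  assumes [measurable]: "g \<in> borel_measurable borel"
  shows "(LINT y|lborel. g (c - y)) = (LINT y|lborel. g y)"
proof -
  have "(lborel :: 'a measure) = distr lborel borel (\<lambda>x. c - x)"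
    using lborel_affine[of "-1" c] by (simp add: density_1)
  then have "(LINT y|lborel. g y) = (LINT y|distr lborel borel (\<lambda>x. c - x). g y)" by simp
  also have "\<dots> = (LINT y|lborel. g (c - y))"
    by (rule integral_distr) measurable
  finally show ?thesis by simp
qed

lemma conv_reflect:
  fixes f :: "'a::euclidean_space \<times> 'b::euclidean_space \<Rightarrow> real"
  assumes [measurable]: "k \<in> borel_measurable borel" "f \<in> borel_measurable borel"
  shows "conv k f (x, t) = (LINT y|lborel. k (x - y) * f (y, t))"
proof -
  have "(\<lambda>y. k y * f ((x, t) - (y, 0))) \<in> borel_measurable borel" by measurable
  from integral_lborel_reflect[OF this, of x, symmetric]
  show ?thesis by (simp add: conv_def)
qed

text \<open>Both sides are limits of difference quotients, which are equal by translation invariance.\<close>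

lemma conv_by_parts:
  fixes f :: "'a::euclidean_space \<times> 'b::euclidean_space \<Rightarrow> real"
  assumes f: "f \<in> test_fun \<Omega>"
    and g: "L-lipschitz_on UNIV g"
    and g': "g' \<in> borel_measurable borel"
    and der: "AE y in lborel. ((\<lambda>s. g (y + s *\<^sub>R e)) has_real_derivative g' y) (at 0)"
  shows "conv g (dir_deriv (e, 0) f) z = conv g' f z"
proof -
  \<comment> \<open>Step lengths of at most 1 keep all shifted supports inside one ball, whose
    radius is the \<rho> below.\<close>
  let ?h = "\<lambda>n. 1 / real (Suc n)"
  have h0: "filterlim ?h (at 0) sequentially"
    unfolding filterlim_at using LIMSEQ_inverse_real_of_nat by (auto simp: inverse_eq_divide)
  have mf [measurable]: "f \<in> borel_measurable borel" using f by measurable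
  have mdf [measurable]: "dir_deriv (e, 0) f \<in> borel_measurable borel"
    using test_fun_dir_deriv[OF f] by (rule test_fun_measurable)
  have mg [measurable]: "g \<in> borel_measurable borel"
    using g by (intro borel_measurable_continuous_onI lipschitz_on_continuous_on)
  note g'[measurable]
  obtain B where B: "B > 0" "\<And>z. \<bar>f z\<bar> \<le> B" using test_fun_bounded[OF f] by blast
  obtain r where r: "r > 0" "\<And>z. f z \<noteq> 0 \<Longrightarrow> norm z \<le> r" using test_fun_support_bounded[OF f] by blast
  obtain Lf where Lf: "Lf > 0" "\<And>z w. \<bar>f z - f w\<bar> \<le> Lf * norm (z - w)" using test_fun_Lipschitz[OF f] by blast
  have "L \<ge> 0" using g by (rule lipschitz_on_nonneg)
  define \<rho> where "\<rho> = norm z + r + norm e"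
  \<comment> \<open>\<open>g\<close> is Lipschitz but may be unbounded; its bound on the ball that
    contains the supports is what enters the dominating functions.\<close>
  define G where "G = \<bar>g 0\<bar> + L * \<rho>"
  have gb: "\<bar>g y\<bar> \<le> G" if "norm y \<le> \<rho>" for y
  proof -
    have "\<bar>g y - g 0\<bar> \<le> L * norm (y - 0)" using lipschitz_on_normD[OF g, of y 0] by simp
    also have "\<dots> \<le> L * \<rho>" using that \<open>L \<ge> 0\<close> by (simp add: mult_left_mono)
    finally show ?thesis unfolding G_def by linarith
  qed
  define q where "q n y = (f (z - (y, 0) + ?h n *\<^sub>R (e, 0)) - f (z - (y, 0))) / ?h n" for n y
  define p where "p n y = (g (y + ?h n *\<^sub>R e) - g y) / ?h n" for n y
  have supp: "norm y \<le> \<rho>" if "f (z - (y, 0) + s *\<^sub>R (e, 0)) \<noteq> 0" "\<bar>s\<bar> \<le> 1" for y s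
  proof -
    have e1: "z - (y, 0) + s *\<^sub>R (e, 0::'b) = z - (y - s *\<^sub>R e, 0)"
      by (simp add: prod_eq_iff)
    have "f (z - (y - s *\<^sub>R e, 0)) \<noteq> 0" using that(1) unfolding e1 .
    from support_shift[of f r z "y - s *\<^sub>R e", OF r(2) this] have "norm (y - s *\<^sub>R e) \<le> norm z + r" .
    moreover have "norm (s *\<^sub>R e) \<le> norm e" using that by (simp add: mult_left_le_one_le)
    ultimately show ?thesis unfolding \<rho>_def
      using norm_triangle_ineq[of "y - s *\<^sub>R e" "s *\<^sub>R e"] by simp
  qed
  have supp0: "norm y \<le> \<rho>" if "f (z - (y, 0)) \<noteq> 0" for y
    by (rule supp[of y 0]) (use that in \<open>simp_all add: zero_prod_def[symmetric]\<close>)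
  have dq: "\<bar>A / h\<bar> \<le> K * N" if "\<bar>A\<bar> \<le> K * (h * N)" "h > 0" for A h K N :: real
    using that by (simp add: abs_divide pos_divide_le_eq mult_ac)
  have hb: "\<bar>?h n\<bar> \<le> 1" for n by simp
  have intgf: "integrable lborel (\<lambda>y. g (y + s *\<^sub>R e) * f (z - (y, 0)))" if "\<bar>s\<bar> \<le> 1" for s
  proof (rule integrable_bounded_support)
    show "\<bar>g (y + s *\<^sub>R e) * f (z - (y, 0))\<bar> \<le> (G + L * norm e) * B" for y
    proof (cases "f (z - (y, 0)) = 0")
      case False
      have "\<bar>g (y + s *\<^sub>R e) - g y\<bar> \<le> L * norm (s *\<^sub>R e)"
        using lipschitz_on_normD[OF g, of "y + s *\<^sub>R e" y] by simp
      also have "\<dots> \<le> L * norm e" using that \<open>L \<ge> 0\<close> by (intro mult_left_mono) (auto simp: mult_left_le_one_le)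
      finally have "\<bar>g (y + s *\<^sub>R e)\<bar> \<le> G + L * norm e"
        using gb[of y] supp0[of y] False by simp
      then show ?thesis unfolding abs_mult using B by (intro mult_mono) auto
    next
      case True
      have "0 \<le> G" unfolding G_def \<rho>_def using \<open>L \<ge> 0\<close> r by simp
      then show ?thesis using True B \<open>L \<ge> 0\<close> by simp
    qed
    show "norm y \<le> \<rho>" if "g (y + s *\<^sub>R e) * f (z - (y, 0)) \<noteq> 0" for y
      using supp0[of y] that by simp
  qed measurable
  have m1: "(\<lambda>y. g y * f (z - (y, 0) + s *\<^sub>R (e, 0))) \<in> borel_measurable borel" for s
  proof -
    have "(\<lambda>y. g y * f ((z + s *\<^sub>R (e, 0)) - (y, 0))) \<in> borel_measurable borel" by measurable
    then show ?thesis by (simp add: algebra_simps)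
  qed
  have sh: "(LINT y|lborel. g y * f (z - (y, 0) + s *\<^sub>R (e, 0)))
      = (LINT y|lborel. g (y + s *\<^sub>R e) * f (z - (y, 0)))" for s
  proof -
    have "z - (s *\<^sub>R e + y, 0) + s *\<^sub>R (e, 0) = z - (y, 0::'b)" for y
      by (simp add: prod_eq_iff)
    then show ?thesis
      using integral_lborel_shift[OF m1[of s], of "s *\<^sub>R e"]
      by (simp only: add.commute[of _ "s *\<^sub>R e"])
  qed
  have eq: "(LINT y|lborel. g y * q n y) = (LINT y|lborel. p n y * f (z - (y, 0)))" for n
  proof -
    have i1: "integrable lborel (\<lambda>y. g y * f (z - (y, 0) + ?h n *\<^sub>R (e, 0)))"
    proof (rule integrable_bounded_support[OF m1])
      show "norm y \<le> \<rho>" if "g y * f (z - (y, 0) + ?h n *\<^sub>R (e, 0)) \<noteq> 0" for y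
        by (rule supp[of y "?h n"]) (use that in auto)
      show "\<bar>g y * f (z - (y, 0) + ?h n *\<^sub>R (e, 0))\<bar> \<le> G * B" for y
      proof (cases "f (z - (y, 0) + ?h n *\<^sub>R (e, 0)) = 0")
        case False
        show ?thesis unfolding abs_mult
          using gb[OF supp[OF False hb]] B by (intro mult_mono) auto
      next
        case True
        have "0 \<le> G" unfolding G_def \<rho>_def using \<open>L \<ge> 0\<close> r by simp
        then show ?thesis using True B by simp
      qed
    qed
    have i2: "integrable lborel (\<lambda>y. g y * f (z - (y, 0)))" using intgf[of 0] by simp
    have "(LINT y|lborel. g y * q n y)
        = (LINT y|lborel. (g y * f (z - (y, 0) + ?h n *\<^sub>R (e, 0)) - g y * f (z - (y, 0))) / ?h n)"
      unfolding q_def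
      by (intro Bochner_Integration.integral_cong) (simp_all only: right_diff_distrib times_divide_eq_right)
    also have "\<dots> = ((LINT y|lborel. g y * f (z - (y, 0) + ?h n *\<^sub>R (e, 0)))
        - (LINT y|lborel. g y * f (z - (y, 0)))) / ?h n"
      by (simp only: integral_divide_zero Bochner_Integration.integral_diff[OF i1 i2])
    also have "\<dots> = (LINT y|lborel. (g (y + ?h n *\<^sub>R e) * f (z - (y, 0)) - g y * f (z - (y, 0))) / ?h n)"
      by (simp only: sh integral_divide_zero Bochner_Integration.integral_diff[OF intgf[OF hb] i2])
    also have "\<dots> = (LINT y|lborel. p n y * f (z - (y, 0)))"
      unfolding p_def
      by (intro Bochner_Integration.integral_cong) (simp_all only: left_diff_distrib times_divide_eq_left)
    finally show ?thesis .
  qed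
  have "(\<lambda>n. LINT y|lborel. g y * q n y) \<longlonglongrightarrow> (LINT y|lborel. g y * dir_deriv (e, 0) f (z - (y, 0)))"
  proof (rule integral_dominated_convergence[where w = "\<lambda>y. G * (Lf * norm e) * indicator (cball 0 \<rho>) y"])
    show "integrable lborel (\<lambda>y::'a. G * (Lf * norm e) * indicator (cball 0 \<rho>) y)"
      using emeasure_lborel_cball_finite[of "0::'a" \<rho>] by simp
    show "AE y in lborel. (\<lambda>n. g y * q n y) \<longlonglongrightarrow> g y * dir_deriv (e, 0) f (z - (y, 0))"
    proof (intro AE_I2 tendsto_mult tendsto_const)
      fix y
      have "((\<lambda>s. (f (z - (y, 0) + s *\<^sub>R (e, 0)) - f (z - (y, 0))) / s) \<longlongrightarrow> dir_deriv (e, 0) f (z - (y, 0))) (at 0)"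
        using has_real_derivative_along_line[OF test_fun_smooth[OF f], of "z - (y, 0)" "(e, 0)" 0]
        by (simp add: has_field_derivative_iff zero_prod_def[symmetric])
      from filterlim_compose[OF this h0]
      show "(\<lambda>n. q n y) \<longlonglongrightarrow> dir_deriv (e, 0) f (z - (y, 0))" by (simp add: q_def)
    qed
    show "AE y in lborel. norm (g y * q n y) \<le> G * (Lf * norm e) * indicator (cball 0 \<rho>) y" for n
    proof (intro AE_I2)
      fix y
      show "norm (g y * q n y) \<le> G * (Lf * norm e) * indicator (cball 0 \<rho>) y"
      proof (cases "norm y \<le> \<rho>")
        case True
        have "\<bar>q n y\<bar> \<le> Lf * norm e"
          unfolding q_def
        proof (rule dq)
          have "norm (z - (y, 0) + ?h n *\<^sub>R (e, 0) - (z - (y, 0))) = ?h n * norm e"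
            by (simp only: add_diff_cancel_left' norm_scaleR) (simp add: norm_Pair)
          then show "\<bar>f (z - (y, 0) + ?h n *\<^sub>R (e, 0)) - f (z - (y, 0))\<bar> \<le> Lf * (?h n * norm e)"
            using Lf(2)[rule_format, of "z - (y, 0) + ?h n *\<^sub>R (e, 0)" "z - (y, 0)"] by metis
        qed simp
        then show ?thesis using gb[OF True] True
          by (simp add: abs_mult dist_norm) (intro mult_mono, auto)
      next
        case False
        then have "f (z - (y, 0)) = 0" "f (z - (y, 0) + ?h n *\<^sub>R (e, 0)) = 0"
          using supp0[of y] supp[OF _ hb, of y n] by auto
        then have "q n y = 0" by (simp only: q_def diff_self div_0)
        then show ?thesis using False by (simp add: dist_norm)
      qed
    qed
    show "(\<lambda>y. g y * q n y) \<in> borel_measurable lborel" for n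
      unfolding q_def diff_add_eq by measurable
  qed measurable
  moreover have "(\<lambda>n. LINT y|lborel. p n y * f (z - (y, 0))) \<longlonglongrightarrow> (LINT y|lborel. g' y * f (z - (y, 0)))"
  proof (rule integral_dominated_convergence[where w = "\<lambda>y. L * norm e * B * indicator (cball 0 \<rho>) y"])
    show "integrable lborel (\<lambda>y::'a. L * norm e * B * indicator (cball 0 \<rho>) y)"
      using emeasure_lborel_cball_finite[of "0::'a" \<rho>] by simp
    show "AE y in lborel. (\<lambda>n. p n y * f (z - (y, 0))) \<longlonglongrightarrow> g' y * f (z - (y, 0))"
      using der
    proof (eventually_elim)
      case (elim y)
      have "((\<lambda>s. (g (y + s *\<^sub>R e) - g y) / s) \<longlongrightarrow> g' y) (at 0)"
        using elim by (simp add: has_field_derivative_iff)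
      from filterlim_compose[OF this h0]
      show ?case by (intro tendsto_mult tendsto_const) (simp add: p_def)
    qed
    show "AE y in lborel. norm (p n y * f (z - (y, 0))) \<le> L * norm e * B * indicator (cball 0 \<rho>) y" for n
    proof (intro AE_I2)
      fix y
      show "norm (p n y * f (z - (y, 0))) \<le> L * norm e * B * indicator (cball 0 \<rho>) y"
      proof (cases "f (z - (y, 0)) = 0")
        case False
        then have y: "norm y \<le> \<rho>" using supp0[of y] by simp
        have "\<bar>p n y\<bar> \<le> L * norm e"
          unfolding p_def
        proof (rule dq)
          have "norm (y + ?h n *\<^sub>R e - y) = ?h n * norm e" by simp
          then show "\<bar>g (y + ?h n *\<^sub>R e) - g y\<bar> \<le> L * (?h n * norm e)"
            using lipschitz_on_normD[OF g, of "y + ?h n *\<^sub>R e" y] by (metis UNIV_I real_norm_def)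
        qed simp
        then show ?thesis using y B(2)[of "z - (y, 0)"] \<open>L \<ge> 0\<close>
          by (simp add: abs_mult dist_norm) (intro mult_mono, auto)
      next
        case True
        then show ?thesis using \<open>L \<ge> 0\<close> B by simp
      qed
    qed
    show "(\<lambda>y. p n y * f (z - (y, 0))) \<in> borel_measurable lborel" for n
      unfolding p_def by measurable
  qed measurable
  ultimately show ?thesis
    unfolding eq conv_def by (rule LIMSEQ_unique)
qed

section \<open>The Newtonian potential and its regularisation by balls\<close>

text \<open>\<open>ball_pot s\<close> is the potential of the uniform probability measure on the ball of radius \<open>s\<close>;
  it is \<open>1 / (4 \<pi> |x|)\<close> outside the ball and has Lipschitz first derivatives.\<close>

definition ball_pot :: "real \<Rightarrow> space \<Rightarrow> real" where
  "ball_pot s x = (if norm x \<le> s then (3 * s\<^sup>2 - (norm x)\<^sup>2) / (8 * pi * s ^ 3) else 1 / (4 * pi * norm x))"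

text \<open>Both branches of the gradient of \<open>ball_pot\<close> in one formula:
  \<open>max\<close> freezes the denominator inside the ball. In this form the Lipschitz bound
  reduces to the 1-Lipschitz function \<open>max s (norm x)\<close>.\<close>

definition ball_pot_grad :: "real \<Rightarrow> 3 \<Rightarrow> space \<Rightarrow> real" where
  "ball_pot_grad s i x = - x $ i / (4 * pi * (max s (norm x)) ^ 3)"

text \<open>The second derivatives of \<open>ball_pot\<close> off the sphere of radius
  \<open>s\<close>, across which they jump. As the sphere is a null set and the gradient is
  Lipschitz, they represent the Hessian under integrals.\<close>

definition ball_pot_hess :: "real \<Rightarrow> 3 \<Rightarrow> 3 \<Rightarrow> space \<Rightarrow> real" where
  "ball_pot_hess s i j x =
     (if norm x \<le> s then (if i = j then - 1 / (4 * pi * s ^ 3) else 0) else Kern i j x)"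

text \<open>The constant is the reciprocal of the volume of the ball.\<close>

definition ball_avg :: "real \<Rightarrow> space \<Rightarrow> real" where
  "ball_avg s x = (if norm x \<le> s then 3 / (4 * pi * s ^ 3) else 0)"

text \<open>Newton's theorem: outside the ball the two potentials agree, so this is compactly supported.\<close>

definition newton_diff :: "real \<Rightarrow> space \<Rightarrow> real" where
  "newton_diff \<rho> x = (if norm x \<le> \<rho> then 1 / (4 * pi * norm x) - ball_pot \<rho> x else 0)"

lemma measurable_vec_nth [measurable]: "(\<lambda>x::space. x $ i) \<in> borel_measurable borel"
  by (intro borel_measurable_continuous_onI continuous_intros)

lemma measurable_Kern [measurable]: "Kern i j \<in> borel_measurable borel"
  unfolding Kern_def[abs_def] by measurable

lemma measurable_ball_pot [measurable]: "ball_pot s \<in> borel_measurable borel"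
  unfolding ball_pot_def[abs_def] by measurable

lemma measurable_ball_pot_hess [measurable]: "ball_pot_hess s i j \<in> borel_measurable borel"
  unfolding ball_pot_hess_def[abs_def] by measurable

lemma measurable_ball_avg [measurable]: "ball_avg s \<in> borel_measurable borel"
  unfolding ball_avg_def[abs_def] by measurable

lemma measurable_newton_diff [measurable]: "newton_diff s \<in> borel_measurable borel"
  unfolding newton_diff_def[abs_def] by measurable

section \<open>Lipschitz bounds for the ball potential and its gradient\<close>

lemma max_norm_diff: "\<bar>max s (norm x) - max s (norm y)\<bar> \<le> norm (x - y)"
  using norm_triangle_ineq3[of x y] by (auto simp: max_def abs_if split: if_splits)

lemma min_norm_diff: "\<bar>min s (norm x) - min s (norm y)\<bar> \<le> norm (x - y)"
  using norm_triangle_ineq3[of x y] by (auto simp: min_def abs_if split: if_splits)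

lemma abs_inverse_diff_le:
  fixes a b :: real
  assumes "s > 0" "a \<ge> s" "b \<ge> s"
  shows "\<bar>1 / a - 1 / b\<bar> \<le> \<bar>a - b\<bar> / s\<^sup>2"
proof -
  have "\<bar>1 / a - 1 / b\<bar> = \<bar>a - b\<bar> / (a * b)"
    using assms by (simp add: divide_simps abs_mult)
  also have "\<dots> \<le> \<bar>a - b\<bar> / s\<^sup>2"
    using assms by (intro divide_left_mono) (auto simp: power2_eq_square intro!: mult_mono)
  finally show ?thesis .
qed

lemma ball_pot_Lipschitz:
  assumes "s > 0"
  shows "\<exists>L. L-lipschitz_on UNIV (ball_pot s)"
proof -
  \<comment> \<open>The branches are merged: inside the ball the first summand is constant, outside
    it the second one vanishes. Each summand is Lipschitz as a function of a truncated norm, which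
    avoids a case split on the positions of two points.\<close>
  have eq: "ball_pot s x = 1 / max s (norm x) / (4 * pi) + (s\<^sup>2 - (min s (norm x))\<^sup>2) / (8 * pi * s ^ 3)" for x
    using assms by (simp add: ball_pot_def max_def min_def field_simps power2_eq_square power3_eq_cube)
  let ?L = "1 / s\<^sup>2 / (4 * pi) + 2 * s / (8 * pi * s ^ 3)"
  have "?L-lipschitz_on UNIV (ball_pot s)"
  proof (rule lipschitz_onI)
    show "0 \<le> ?L" using assms by simp
    fix x y :: space
    let ?m = "min s (norm x)" and ?n = "min s (norm y)"
    have 1: "\<bar>1 / max s (norm x) - 1 / max s (norm y)\<bar> \<le> norm (x - y) / s\<^sup>2"
      by (rule order_trans[OF abs_inverse_diff_le[OF assms]])
        (auto intro!: divide_right_mono max_norm_diff)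
    have "?n\<^sup>2 - ?m\<^sup>2 = (?n - ?m) * (?n + ?m)"
      by (simp add: power2_eq_square algebra_simps)
    then have "\<bar>?n\<^sup>2 - ?m\<^sup>2\<bar> = \<bar>?m - ?n\<bar> * \<bar>?n + ?m\<bar>"
      by (simp only: abs_mult abs_minus_commute)
    also have "\<dots> \<le> norm (x - y) * (2 * s)"
      using assms by (intro mult_mono min_norm_diff) auto
    finally have 2: "\<bar>?n\<^sup>2 - ?m\<^sup>2\<bar> \<le> norm (x - y) * (2 * s)" .
    have "ball_pot s x - ball_pot s y
        = (1 / max s (norm x) - 1 / max s (norm y)) / (4 * pi) + (?n\<^sup>2 - ?m\<^sup>2) / (8 * pi * s ^ 3)"
      unfolding eq by (simp add: diff_divide_distrib)
    also have "\<bar>\<dots>\<bar> \<le> norm (x - y) / s\<^sup>2 / (4 * pi) + norm (x - y) * (2 * s) / (8 * pi * s ^ 3)"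
    proof -
      have tri: "\<bar>u / c + v / d\<bar> \<le> a / c + b / d" if "\<bar>u\<bar> \<le> a" "\<bar>v\<bar> \<le> b" "c > 0" "d > 0" for u v a b c d :: real
      proof -
        have "\<bar>u / c\<bar> \<le> a / c" "\<bar>v / d\<bar> \<le> b / d"
          using that by (simp_all add: abs_divide divide_right_mono)
        then show ?thesis by linarith
      qed
      show ?thesis using assms by (intro tri 1 2) simp_all
    qed
    finally show "dist (ball_pot s x) (ball_pot s y) \<le> ?L * dist x y"
      by (simp add: dist_real_def dist_norm algebra_simps)
  qed
  then show ?thesis by blast
qed

text \<open>The quotient changes through its denominator and through its numerator. With the smaller
  denominator belonging to \<open>x\<close>, so that \<open>norm x \<le> a \<le> b\<close>, the two
  changes cost 3 and 1 times \<open>norm (x - y) / s ^ 3\<close>, whence the 4.\<close>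

lemma cube_diff_quotient_le:
  fixes x y :: space
  assumes s: "s > 0" and le: "max s (norm x) \<le> max s (norm y)"
  shows "\<bar>x $ i / (max s (norm x)) ^ 3 - y $ i / (max s (norm y)) ^ 3\<bar> \<le> 4 * norm (x - y) / s ^ 3"
proof -
  define a b where "a = max s (norm x)" and "b = max s (norm y)"
  have ab: "s \<le> a" "a \<le> b" "0 < a" "0 < b" "norm x \<le> a" using s le by (auto simp: a_def b_def)
  have d: "b - a \<le> norm (x - y)" using max_norm_diff[of s x y] by (simp add: a_def b_def)
  have cube: "b ^ 3 - a ^ 3 \<le> (b - a) * (3 * b\<^sup>2)"
  proof -
    have "b ^ 3 - a ^ 3 = (b - a) * (b\<^sup>2 + a * b + a\<^sup>2)"
      by (simp add: power2_eq_square power3_eq_cube algebra_simps)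
    also have "\<dots> \<le> (b - a) * (3 * b\<^sup>2)"
    proof (rule mult_left_mono)
      have "a * b \<le> b * b" "a * a \<le> b * b" using ab by (auto intro: mult_right_mono mult_mono)
      then show "b\<^sup>2 + a * b + a\<^sup>2 \<le> 3 * b\<^sup>2" by (simp add: power2_eq_square)
    qed (use ab in simp)
    finally show ?thesis .
  qed
  have "\<bar>x $ i / a ^ 3 - x $ i / b ^ 3\<bar> = \<bar>x $ i\<bar> * (b ^ 3 - a ^ 3) / (a ^ 3 * b ^ 3)"
    using ab power_mono[of a b 3]
    by (simp add: divide_simps abs_mult flip: right_diff_distrib)
  also have "\<dots> \<le> a * ((b - a) * (3 * b\<^sup>2)) / (a ^ 3 * b ^ 3)"
    using ab component_le_norm_cart[of x i] cube power_mono[of a b 3]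
    by (intro divide_right_mono mult_mono) auto
  also have "\<dots> = 3 * (b - a) / (a\<^sup>2 * b)"
    using ab by (simp add: field_simps power2_eq_square power3_eq_cube)
  also have "\<dots> \<le> 3 * norm (x - y) / s ^ 3"
  proof (rule frac_le)
    show "s ^ 3 \<le> a\<^sup>2 * b"
      unfolding power3_eq_cube power2_eq_square using ab s by (intro mult_mono) auto
  qed (use ab d s in auto)
  finally have 1: "\<bar>x $ i / a ^ 3 - x $ i / b ^ 3\<bar> \<le> 3 * norm (x - y) / s ^ 3" .
  have "\<bar>x $ i / b ^ 3 - y $ i / b ^ 3\<bar> = \<bar>(x - y) $ i\<bar> / b ^ 3"
    using ab by (simp add: diff_divide_distrib[symmetric])
  also have "\<dots> \<le> norm (x - y) / s ^ 3"
    using ab s component_le_norm_cart[of "x - y" i] by (intro frac_le power_mono) auto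
  finally have 2: "\<bar>x $ i / b ^ 3 - y $ i / b ^ 3\<bar> \<le> norm (x - y) / s ^ 3" .
  have "4 * norm (x - y) / s ^ 3 = 3 * norm (x - y) / s ^ 3 + norm (x - y) / s ^ 3"
    by (simp add: add_divide_distrib[symmetric])
  then show ?thesis
    using 1 2 unfolding a_def b_def by linarith
qed

lemma ball_pot_grad_Lipschitz:
  assumes "s > 0"
  shows "\<exists>L. L-lipschitz_on UNIV (ball_pot_grad s i)"
proof -
  have le: "\<bar>x $ i / (max s (norm x)) ^ 3 - y $ i / (max s (norm y)) ^ 3\<bar> \<le> 4 * norm (x - y) / s ^ 3"
    for x y :: space
  proof (cases "max s (norm x) \<le> max s (norm y)")
    case True
    then show ?thesis by (rule cube_diff_quotient_le[OF assms])
  next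
    case False
    then have "\<bar>y $ i / (max s (norm y)) ^ 3 - x $ i / (max s (norm x)) ^ 3\<bar> \<le> 4 * norm (y - x) / s ^ 3"
      by (intro cube_diff_quotient_le[OF assms]) linarith
    then show ?thesis by (metis abs_minus_commute norm_minus_commute)
  qed
  have "(4 / s ^ 3 / (4 * pi))-lipschitz_on UNIV (ball_pot_grad s i)"
  proof (rule lipschitz_onI)
    fix x y :: space
    have "\<bar>ball_pot_grad s i x - ball_pot_grad s i y\<bar>
        = \<bar>x $ i / (max s (norm x)) ^ 3 - y $ i / (max s (norm y)) ^ 3\<bar> / (4 * pi)"
    proof -
      have "ball_pot_grad s i x - ball_pot_grad s i y
        = - (x $ i / (max s (norm x)) ^ 3 - y $ i / (max s (norm y)) ^ 3) / (4 * pi)"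
        unfolding ball_pot_grad_def by (simp add: diff_divide_distrib mult.commute)
      then show ?thesis by (simp add: abs_divide)
    qed
    also have "\<dots> \<le> (4 * norm (x - y) / s ^ 3) / (4 * pi)"
      by (intro divide_right_mono le) simp
    finally show "dist (ball_pot_grad s i x) (ball_pot_grad s i y) \<le> 4 / s ^ 3 / (4 * pi) * dist x y"
      by (simp add: dist_real_def dist_norm)
  qed (use assms in simp)
  then show ?thesis by blast
qed

section \<open>Partial derivatives of the ball potential off the sphere\<close>

lemma norm_line_derivative:
  fixes y :: space
  assumes "y \<noteq> 0"
  shows "((\<lambda>h. norm (y + h *\<^sub>R axis i 1)) has_real_derivative y $ i / norm y) (at 0)"
proof -
  have eq: "norm (y + h *\<^sub>R axis i 1) = sqrt ((norm y)\<^sup>2 + 2 * h * y $ i + h\<^sup>2)" for h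
  proof -
    have "(norm (y + h *\<^sub>R axis i 1))\<^sup>2 = (norm y)\<^sup>2 + 2 * h * y $ i + h\<^sup>2"
      unfolding power2_norm_eq_inner
      by (simp add: inner_add_left inner_add_right inner_axis inner_axis' power2_eq_square algebra_simps)
    then show ?thesis by (metis norm_ge_zero real_sqrt_unique)
  qed
  show ?thesis
    unfolding eq using assms
    by (auto intro!: derivative_eq_intros simp: divide_simps)
qed

lemma eventually_norm_line_less:
  fixes y :: "'a::real_normed_vector"
  assumes "norm y < s"
  shows "\<forall>\<^sub>F h in nhds 0. norm (y + h *\<^sub>R e) < s"
proof -
  have "open {h. norm (y + h *\<^sub>R e) < s}"
    by (intro open_Collect_less continuous_intros)
  then show ?thesis
    using assms by (auto simp: eventually_nhds intro!: exI[of _ "{h. norm (y + h *\<^sub>R e) < s}"])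
qed

lemma eventually_norm_line_greater:
  fixes y :: "'a::real_normed_vector"
  assumes "norm y > s"
  shows "\<forall>\<^sub>F h in nhds 0. norm (y + h *\<^sub>R e) > s"
proof -
  have "open {h. norm (y + h *\<^sub>R e) > s}"
    by (intro open_Collect_less continuous_intros)
  then show ?thesis
    using assms by (auto simp: eventually_nhds intro!: exI[of _ "{h. norm (y + h *\<^sub>R e) > s}"])
qed

text \<open>Off the sphere a single branch of the definition is valid in a neighbourhood, so
  ordinary calculus applies. Almost every point is covered, as \<open>conv_by_parts\<close>
  requires.\<close>

lemma ball_pot_derivative:
  assumes s: "s > 0" and y: "norm y \<noteq> s"
  shows "((\<lambda>h. ball_pot s (y + h *\<^sub>R axis i 1)) has_real_derivative ball_pot_grad s i y) (at 0)"
proof (cases "norm y < s")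
  case True
  have ev: "\<forall>\<^sub>F h in nhds 0. ball_pot s (y + h *\<^sub>R axis i 1)
      = (3 * s\<^sup>2 - ((norm y)\<^sup>2 + 2 * h * y $ i + h\<^sup>2)) / (8 * pi * s ^ 3)"
    using eventually_norm_line_less[OF True, of "axis i 1"]
  proof eventually_elim
    case (elim h)
    have "(norm (y + h *\<^sub>R axis i 1))\<^sup>2 = (norm y)\<^sup>2 + 2 * h * y $ i + h\<^sup>2"
      unfolding power2_norm_eq_inner
      by (simp add: inner_add_left inner_add_right inner_axis inner_axis' power2_eq_square algebra_simps)
    then show ?case using elim by (simp add: ball_pot_def)
  qed
  have "((\<lambda>h. (3 * s\<^sup>2 - ((norm y)\<^sup>2 + 2 * h * y $ i + h\<^sup>2)) / (8 * pi * s ^ 3)) has_real_derivative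
      ball_pot_grad s i y) (at 0)"
    using True s by (auto intro!: derivative_eq_intros simp: ball_pot_grad_def max_def field_simps)
  then show ?thesis using DERIV_cong_ev[OF refl ev refl] by blast
next
  case False
  then have gt: "norm y > s" using y by simp
  have ev: "\<forall>\<^sub>F h in nhds 0. ball_pot s (y + h *\<^sub>R axis i 1) = 1 / (4 * pi * norm (y + h *\<^sub>R axis i 1))"
    using eventually_norm_line_greater[OF gt, of "axis i 1"]
    by eventually_elim (simp add: ball_pot_def)
  have "y \<noteq> 0" using gt s by auto
  have "((\<lambda>h. 1 / (4 * pi * norm (y + h *\<^sub>R axis i 1))) has_real_derivative ball_pot_grad s i y) (at 0)"
    using \<open>y \<noteq> 0\<close> gt
    by (auto intro!: derivative_eq_intros norm_line_derivative simp: ball_pot_grad_def max_def field_simps power3_eq_cube)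
  then show ?thesis using DERIV_cong_ev[OF refl ev refl] by blast
qed

lemma ball_pot_grad_derivative:
  assumes s: "s > 0" and y: "norm y \<noteq> s"
  shows "((\<lambda>h. ball_pot_grad s i (y + h *\<^sub>R axis j 1)) has_real_derivative ball_pot_hess s i j y) (at 0)"
proof (cases "norm y < s")
  case True
  have ev: "\<forall>\<^sub>F h in nhds 0. ball_pot_grad s i (y + h *\<^sub>R axis j 1)
      = - (y $ i + h * (if i = j then 1 else 0)) / (4 * pi * s ^ 3)"
    using eventually_norm_line_less[OF True, of "axis j 1"]
    by eventually_elim (simp add: ball_pot_grad_def max_def axis_def)
  have "((\<lambda>h. - (y $ i + h * (if i = j then 1 else 0)) / (4 * pi * s ^ 3)) has_real_derivative
      ball_pot_hess s i j y) (at 0)"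
    using True s by (auto intro!: derivative_eq_intros simp: ball_pot_hess_def)
  then show ?thesis using DERIV_cong_ev[OF refl ev refl] by blast
next
  case False
  then have gt: "norm y > s" using y by simp
  have ev: "\<forall>\<^sub>F h in nhds 0. ball_pot_grad s i (y + h *\<^sub>R axis j 1)
      = - (y $ i + h * (if i = j then 1 else 0)) / (4 * pi * norm (y + h *\<^sub>R axis j 1) ^ 3)"
    using eventually_norm_line_greater[OF gt, of "axis j 1"]
    by eventually_elim (simp add: ball_pot_grad_def max_def axis_def)
  have "y \<noteq> 0" using gt s by auto
  have "((\<lambda>h. - (y $ i + h * (if i = j then 1 else 0)) / (4 * pi * norm (y + h *\<^sub>R axis j 1) ^ 3)) has_real_derivative
     (- (if i = j then 1 else 0) * (4 * pi * norm y ^ 3) + y $ i * (4 * pi * (3 * norm y ^ 2 * (y $ j / norm y)))) / (4 * pi * norm y ^ 3) ^ 2) (at 0)"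
    using \<open>y \<noteq> 0\<close>
    by (auto intro!: derivative_eq_intros norm_line_derivative simp: power2_eq_square)
  moreover have "(- (if i = j then 1 else 0) * (4 * pi * norm y ^ 3) + y $ i * (4 * pi * (3 * norm y ^ 2 * (y $ j / norm y)))) / (4 * pi * norm y ^ 3) ^ 2
    = ball_pot_hess s i j y"
    using \<open>y \<noteq> 0\<close> gt
    by (simp add: ball_pot_hess_def Kern_def field_simps) (simp add: eval_nat_numeral field_simps)
  ultimately show ?thesis using DERIV_cong_ev[OF refl ev refl] by force
qed

lemma AE_norm_neq:
  shows "AE y in lborel. norm (y :: 'a::euclidean_space) \<noteq> s"
proof -
  have "sphere (0::'a) s \<in> null_sets lborel"
    using negligible_sphere[of "0::'a" s]
    by (auto simp: null_sets_completion_iff negligible_iff_null_sets)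
  then show ?thesis
    by (rule AE_I') (auto simp: dist_norm)
qed

text \<open>Two applications of \<open>conv_by_parts\<close>, each moving one derivative to the
  kernel. Each needs a Lipschitz kernel, which is why the point charge is smeared out over a ball:
  the Newtonian potential itself fails at the origin.\<close>

lemma conv_ball_pot:
  assumes f: "f \<in> test_fun \<Omega>" and s: "s > 0"
  shows "conv (ball_pot s) (dir_deriv (e_x i) (dir_deriv (e_x j) f)) z = conv (ball_pot_hess s i j) f z"
proof -
  obtain L L' where L: "L-lipschitz_on UNIV (ball_pot s)" "L'-lipschitz_on UNIV (ball_pot_grad s i)"
    using ball_pot_Lipschitz[OF s] ball_pot_grad_Lipschitz[OF s] by blast
  have m: "ball_pot_grad s i \<in> borel_measurable borel"
    using L(2) by (intro borel_measurable_continuous_onI lipschitz_on_continuous_on)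
  have ae: "AE y in lborel. norm (y::space) \<noteq> s" by (rule AE_norm_neq)
  have "conv (ball_pot s) (dir_deriv (e_x i) (dir_deriv (e_x j) f)) z = conv (ball_pot_grad s i) (dir_deriv (e_x j) f) z"
    unfolding e_x_def
    by (rule conv_by_parts[OF test_fun_dir_deriv[OF f] L(1) m])
      (use ae in eventually_elim, rule ball_pot_derivative[OF s])
  also have "\<dots> = conv (ball_pot_hess s i j) f z"
    unfolding e_x_def
    by (rule conv_by_parts[OF f L(2) measurable_ball_pot_hess])
      (use ae in eventually_elim, rule ball_pot_grad_derivative[OF s])
  finally show ?thesis .
qed

section \<open>Size, trace and differences of the kernels\<close>

lemma Kern_abs_le: "\<bar>Kern i j y\<bar> \<le> 1 / norm y ^ 3"
\<comment> \<open>At the origin both sides are 0 by the convention for division by zero.\<close>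
proof (cases "y = 0")
  case False
  have "\<bar>y $ i * y $ j\<bar> \<le> norm y * norm y"
    unfolding abs_mult by (intro mult_mono component_le_norm_cart) auto
  moreover have "\<bar>(if b then - N else 0) + 3 * P\<bar> \<le> 4 * N" if "\<bar>P\<bar> \<le> N" for N P :: real and b
    using that by (auto simp: abs_le_iff)
  ultimately have "\<bar>(if i = j then - (norm y)\<^sup>2 else 0) + 3 * y $ i * y $ j\<bar> \<le> 4 * (norm y)\<^sup>2"
    by (simp only: power2_eq_square mult.assoc[of 3])
  moreover have den: "0 \<le> 4 * pi * norm y ^ 5" by simp
  ultimately have "\<bar>Kern i j y\<bar> \<le> 4 * (norm y)\<^sup>2 / (4 * pi * norm y ^ 5)"
    unfolding Kern_def abs_divide abs_of_nonneg[OF den] by (rule divide_right_mono)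
  also have "\<dots> = 1 / (pi * norm y ^ 3)"
    using False by (simp add: field_simps eval_nat_numeral)
  also have "\<dots> \<le> 1 / norm y ^ 3"
    using False pi_gt3 by (intro divide_left_mono) auto
  finally show ?thesis .
qed (simp add: Kern_def)

lemma Kern_minus: "Kern i j (- y) = Kern i j y"
  by (simp add: Kern_def)

lemma ball_pot_hess_abs_le:
  assumes "s > 0"
  shows "\<bar>ball_pot_hess s i j y\<bar> \<le> 1 / s ^ 3"
proof (cases "norm y \<le> s")
  case True
  have "s ^ 3 \<le> 4 * pi * s ^ 3" using assms pi_gt3 by simp
  then have "1 / (4 * pi * s ^ 3) \<le> 1 / s ^ 3"
    using assms by (intro divide_left_mono) auto
  then show ?thesis using True assms by (simp add: ball_pot_hess_def)
next
  case False
  then have "0 < norm y" using assms by linarith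
  then have "1 / norm y ^ 3 \<le> 1 / s ^ 3"
    using assms False by (intro divide_left_mono power_mono mult_pos_pos zero_less_power) auto
  then show ?thesis using False Kern_abs_le[of i j y] by (simp add: ball_pot_hess_def)
qed

text \<open>The singular part of the Hessian shows up as minus one third of the density on the
  diagonal. As \<open>s\<close> tends to 0 the density becomes a point mass, which accounts for the
  term \<open>- f x / 3\<close> in \<open>RR\<close>; the second summand is the truncated kernel of
  the principal value.\<close>

lemma ball_pot_hess_eq:
  "ball_pot_hess s i j y = - (if i = j then ball_avg s y / 3 else 0) + (if norm y > s then Kern i j y else 0)"
  by (simp add: ball_pot_hess_def ball_avg_def)

text \<open>Harmonicity of \<open>1 / norm y\<close> away from the origin: the two terms of the
  kernel cancel because the dimension is 3.\<close>

lemma Kern_trace: "(\<Sum>i\<in>UNIV. Kern i i y) = 0"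
proof -
  have "(norm y)\<^sup>2 = (\<Sum>i\<in>UNIV. y $ i * y $ i)"
    unfolding power2_norm_eq_inner inner_vec_def by simp
  then show ?thesis
    by (simp add: Kern_def sum_3 add_divide_distrib[symmetric])
qed

text \<open>Poisson's equation for the uniform measure on the ball.\<close>

lemma ball_pot_hess_trace: "(\<Sum>i\<in>UNIV. ball_pot_hess s i i y) = - ball_avg s y"
  using Kern_trace[of y] by (simp add: ball_pot_hess_eq sum.distrib sum_3)

text \<open>A difference of the kernel gains one power of decay over the kernel itself. The
  assumption keeps the length of \<open>a - b\<close> between one half and three halves of that of
  \<open>a\<close>. The constant is 320 + 248: \<open>10 * 2 ^ 5\<close> from the change of the
  quadratic numerator, \<open>4 * 62\<close> from the change of the inverse fifth power; the
  division by \<open>4 * pi\<close> is given away.\<close>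

lemma Kern_diff_le:
  fixes a b :: space
  assumes a: "a \<noteq> 0" and ab: "2 * norm b \<le> norm a"
  shows "\<bar>Kern i j (a - b) - Kern i j a\<bar> \<le> 568 * norm b / norm a ^ 4"
proof -
  define c A D d p q where "c = a - b" and "A = norm a" and "D = norm c" and "d = norm b"
    and "p = 1 / D" and "q = 1 / A"
  have A: "A > 0" using a by (simp add: A_def)
  have AD: "\<bar>D - A\<bar> \<le> d"
    using norm_triangle_ineq3[of c a] by (simp add: c_def A_def D_def d_def)
  have d: "0 \<le> d" "2 * d \<le> A" using ab by (auto simp: d_def A_def)
  have D: "A / 2 \<le> D" "D \<le> 3 / 2 * A" "D > 0" using AD d A by linarith+
  have q: "0 < q" "A * q = 1" using A by (auto simp: q_def)
  have p: "0 < p" "p \<le> 2 * q" using A D by (auto simp: p_def q_def field_simps)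
  have pq: "\<bar>p - q\<bar> \<le> 2 * d * q\<^sup>2"
  proof -
    have "\<bar>p - q\<bar> = \<bar>D - A\<bar> * (p * q)"
      using A D by (simp add: p_def q_def divide_simps abs_mult abs_minus_commute)
    also have "\<dots> \<le> d * (2 * q * q)"
      using AD p q d by (intro mult_mono mult_right_mono) auto
    finally show ?thesis by (simp add: power2_eq_square)
  qed
  \<comment> \<open>Here 62 is 2 times 31, and 31 = 16 + 8 + 4 + 2 + 1 comes from the five terms of
    the factorisation under \<open>p \<le> 2 * q\<close>.\<close>
  have p5: "\<bar>p ^ 5 - q ^ 5\<bar> \<le> 62 * d * q ^ 6"
  proof -
    have "p ^ 5 - q ^ 5 = (p - q) * (p ^ 4 + p ^ 3 * q + p\<^sup>2 * q\<^sup>2 + p * q ^ 3 + q ^ 4)"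
      by (simp add: eval_nat_numeral algebra_simps)
    then have "\<bar>p ^ 5 - q ^ 5\<bar> = \<bar>p - q\<bar> * (p ^ 4 + p ^ 3 * q + p\<^sup>2 * q\<^sup>2 + p * q ^ 3 + q ^ 4)"
      using p q by (simp add: abs_mult)
    also have "\<dots> \<le> (2 * d * q\<^sup>2) * ((2 * q) ^ 4 + (2 * q) ^ 3 * q + (2 * q)\<^sup>2 * q\<^sup>2 + 2 * q * q ^ 3 + q ^ 4)"
      using p q d by (intro mult_mono pq add_mono power_mono) auto
    also have "\<dots> = 62 * d * q ^ 6" by (simp add: eval_nat_numeral algebra_simps)
    finally show ?thesis .
  qed
  define num where "num = (\<lambda>y::space. (if i = j then - (norm y)\<^sup>2 else 0) + 3 * y $ i * y $ j)"
  have prod: "\<bar>c $ i * c $ j - a $ i * a $ j\<bar> \<le> 5 / 2 * d * A"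
  proof -
    have "c $ i * c $ j - a $ i * a $ j = - (c $ i * b $ j) - b $ i * a $ j"
      by (simp add: c_def algebra_simps)
    also have "\<bar>\<dots>\<bar> \<le> \<bar>c $ i\<bar> * \<bar>b $ j\<bar> + \<bar>b $ i\<bar> * \<bar>a $ j\<bar>"
      unfolding abs_mult[symmetric] by linarith
    also have "\<dots> \<le> D * d + d * A"
      unfolding D_def d_def A_def by (intro add_mono mult_mono component_le_norm_cart) auto
    also have "\<dots> \<le> (3 / 2 * A) * d + d * A"
      using D d by (intro add_mono mult_right_mono) auto
    finally show ?thesis by (simp add: algebra_simps)
  qed
  have sq: "\<bar>D\<^sup>2 - A\<^sup>2\<bar> \<le> 5 / 2 * d * A"
  proof -
    have "\<bar>D\<^sup>2 - A\<^sup>2\<bar> = \<bar>D - A\<bar> * (D + A)"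
    proof -
      have "D\<^sup>2 - A\<^sup>2 = (D - A) * (D + A)" by (simp add: power2_eq_square algebra_simps)
      then show ?thesis using A D by (simp add: abs_mult)
    qed
    also have "\<dots> \<le> d * (5 / 2 * A)"
      using AD D A by (intro mult_mono) auto
    finally show ?thesis by simp
  qed
  have n1: "\<bar>num c - num a\<bar> \<le> 10 * d * A"
  proof -
    have "\<bar>((if b then - X else 0) + 3 * P) - ((if b then - Y else 0) + 3 * Q)\<bar> \<le> 10 * E"
      if "\<bar>P - Q\<bar> \<le> 5 / 2 * E" "\<bar>X - Y\<bar> \<le> 5 / 2 * E" for P Q X Y E :: real and b
    proof -
      have "P - Q \<le> 5 / 2 * E" "Q - P \<le> 5 / 2 * E" "X - Y \<le> 5 / 2 * E" "Y - X \<le> 5 / 2 * E" "0 \<le> E"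
        using that by linarith+
      then show ?thesis by (auto simp: abs_le_iff)
    qed
    from this[of "c $ i * c $ j" "a $ i * a $ j" "d * A" "D\<^sup>2" "A\<^sup>2" "i = j"] show ?thesis
      using prod sq by (simp only: num_def D_def A_def mult.assoc)
  qed
  have n2: "\<bar>num a\<bar> \<le> 4 * A\<^sup>2"
  proof -
    have "\<bar>a $ i * a $ j\<bar> \<le> A * A"
      unfolding abs_mult A_def by (intro mult_mono component_le_norm_cart) auto
    moreover have "\<bar>(if b then - N else 0) + 3 * P\<bar> \<le> 4 * N" if "\<bar>P\<bar> \<le> N" for N P :: real and b
      using that by (auto simp: abs_le_iff)
    ultimately show ?thesis
      by (simp only: num_def A_def power2_eq_square mult.assoc[of 3])
  qed
  have K: "Kern i j c = num c * p ^ 5 / (4 * pi)" "Kern i j a = num a * q ^ 5 / (4 * pi)"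
    by (simp_all add: Kern_def num_def p_def q_def D_def A_def power_one_over)
  have "\<bar>num c * p ^ 5 - num a * q ^ 5\<bar> \<le> \<bar>num c - num a\<bar> * p ^ 5 + \<bar>num a\<bar> * \<bar>p ^ 5 - q ^ 5\<bar>"
  proof -
    have "num c * p ^ 5 - num a * q ^ 5 = (num c - num a) * p ^ 5 + num a * (p ^ 5 - q ^ 5)"
      by (simp add: algebra_simps)
    then show ?thesis
      using p abs_triangle_ineq[of "(num c - num a) * p ^ 5" "num a * (p ^ 5 - q ^ 5)"]
      by (simp add: abs_mult)
  qed
  also have "\<dots> \<le> (10 * d * A) * (2 * q) ^ 5 + (4 * A\<^sup>2) * (62 * d * q ^ 6)"
    using p q d A by (intro add_mono mult_mono n1 n2 p5 power_mono) auto
  also have "\<dots> = 320 * d * q ^ 4 * (A * q) + 248 * d * q ^ 4 * (A * q)\<^sup>2"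
    by (simp add: eval_nat_numeral algebra_simps)
  also have "\<dots> = 568 * d * q ^ 4" using q by simp
  finally have main: "\<bar>num c * p ^ 5 - num a * q ^ 5\<bar> \<le> 568 * d * q ^ 4" .
  have "\<bar>Kern i j c - Kern i j a\<bar> = \<bar>num c * p ^ 5 - num a * q ^ 5\<bar> / (4 * pi)"
    unfolding K by (simp add: diff_divide_distrib[symmetric])
  also have "\<dots> \<le> \<bar>num c * p ^ 5 - num a * q ^ 5\<bar> / 1"
    using pi_gt3 by (intro divide_left_mono) auto
  finally show ?thesis
    using main by (simp add: c_def d_def q_def A_def power_one_over divide_inverse power_inverse)
qed

text \<open>\<open>ball_pot s\<close> is the average of the Newtonian potential over balls of radius
  \<open>s\<close>, and averaging a superharmonic function decreases it. Inside the ball this is the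
  sign of \<open>(s - norm x)\<^sup>2 * (2 * s + norm x)\<close>. The bounds give an integrable
  majorant that is uniform in \<open>s\<close>.\<close>

lemma ball_pot_bounds:
  assumes s: "s > 0" and x: "x \<noteq> 0"
  shows "0 \<le> ball_pot s x" "ball_pot s x \<le> 1 / (4 * pi * norm x)"
proof -
  let ?r = "norm x"
  have r: "?r > 0" using x by simp
  show "0 \<le> ball_pot s x"
  proof (cases "?r \<le> s")
    case True
    then have "?r\<^sup>2 \<le> s\<^sup>2" by (intro power_mono) auto
    moreover have "0 \<le> s\<^sup>2" by simp
    ultimately have "0 \<le> 3 * s\<^sup>2 - ?r\<^sup>2" by linarith
    then show ?thesis using True s by (simp add: ball_pot_def)
  qed (simp add: ball_pot_def)
  show "ball_pot s x \<le> 1 / (4 * pi * norm x)"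
  proof (cases "?r \<le> s")
    case True
    have "0 \<le> (s - ?r)\<^sup>2 * (2 * s + ?r)" using s by simp
    also have "\<dots> = 2 * s ^ 3 - (3 * s\<^sup>2 - ?r\<^sup>2) * ?r"
      by (simp add: power2_eq_square power3_eq_cube algebra_simps)
    finally have "(3 * s\<^sup>2 - ?r\<^sup>2) * ?r \<le> 2 * s ^ 3" by simp
    have "(3 * s\<^sup>2 - ?r\<^sup>2) * (4 * pi * ?r) = 4 * pi * ((3 * s\<^sup>2 - ?r\<^sup>2) * ?r)"
      by (simp only: mult_ac)
    also have "\<dots> \<le> 4 * pi * (2 * s ^ 3)"
      by (intro mult_left_mono) (use \<open>(3 * s\<^sup>2 - ?r\<^sup>2) * ?r \<le> 2 * s ^ 3\<close> in simp_all)
    also have "\<dots> = 1 * (8 * pi * s ^ 3)" by simp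
    finally have "(3 * s\<^sup>2 - ?r\<^sup>2) * (4 * pi * ?r) \<le> 1 * (8 * pi * s ^ 3)" .
    moreover have "a / b \<le> c / d" if "a * d \<le> c * b" "0 < b" "0 < d" for a b c d :: real
      using that by (simp add: pos_divide_le_eq pos_le_divide_eq)
    ultimately have "(3 * s\<^sup>2 - ?r\<^sup>2) / (8 * pi * s ^ 3) \<le> 1 / (4 * pi * ?r)"
      using s r by simp
    then show ?thesis using True by (simp add: ball_pot_def)
  qed (simp add: ball_pot_def)
qed

lemma ball_pot_outside: "norm x > s \<Longrightarrow> ball_pot s x = 1 / (4 * pi * norm x)"
  by (simp add: ball_pot_def)

section \<open>Local integrability of the Newtonian potential\<close>

lemma ex_dyadic_interval:
  fixes x :: real
  assumes "x \<ge> 1"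
  shows "\<exists>k. 2 ^ k \<le> x \<and> x < 2 ^ Suc k"
proof -
  obtain n where "x < 2 ^ n" using real_arch_pow[of 2 x] by auto
  define m where "m = (LEAST n. x < 2 ^ n)"
  have m: "x < 2 ^ m" unfolding m_def by (rule LeastI) fact
  then obtain k where k: "m = Suc k" using assms by (cases m) auto
  have "\<not> x < 2 ^ k" using not_less_Least[of k "\<lambda>n. x < 2 ^ n"] k by (simp add: m_def)
  then show ?thesis using m k by (intro exI[of _ k]) auto
qed

text \<open>On the outer shell of the ball of radius \<open>\<rho> / 2 ^ k\<close> the function is
  at most \<open>2 ^ Suc k / \<rho>\<close>, while the volume of that ball shrinks like the
  \<open>k\<close>-th power of 1/8. The products form a geometric series of ratio 1/4; its factor
  8/3 is 2 times the 4/3 of the volume.\<close>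

lemma integrable_newton_cball:
  assumes \<rho>: "\<rho> > 0"
  shows "integrable lborel (\<lambda>x::space. if norm x \<le> \<rho> then 1 / norm x else 0)"
proof (rule integrableI_bounded)
  show "(\<lambda>x::space. if norm x \<le> \<rho> then 1 / norm x else 0) \<in> borel_measurable lborel" by measurable
  define c where "c = (\<lambda>k::nat. 8 / 3 * pi * \<rho>\<^sup>2 * (1 / 4) ^ k)"
  let ?B = "\<lambda>k. cball (0::space) (\<rho> / 2 ^ k)"
  define F where "F = (\<lambda>x k. ennreal (2 ^ Suc k / \<rho>) * indicator (?B k) x)"
  have pt: "ennreal (norm (if norm x \<le> \<rho> then 1 / norm x else 0)) \<le>
      (\<Sum>k. ennreal (2 ^ Suc k / \<rho>) * indicator (?B k) x)" for x :: space
  proof (cases "x \<noteq> 0 \<and> norm x \<le> \<rho>")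
    case True
    then have "\<rho> / norm x \<ge> 1" by simp
    then obtain k where k: "2 ^ k \<le> \<rho> / norm x" "\<rho> / norm x < 2 ^ Suc k"
      using ex_dyadic_interval by blast
    have "norm x \<le> \<rho> / 2 ^ k" using k(1) True by (simp add: field_simps)
    then have ind: "x \<in> ?B k" by (simp add: dist_norm)
    have "1 / norm x \<le> 2 ^ Suc k / \<rho>" using k(2) True \<rho> by (simp add: field_simps)
    then have "ennreal (norm (if norm x \<le> \<rho> then 1 / norm x else 0)) \<le> F x k"
      using True ind by (simp add: F_def ennreal_leI)
    also have "\<dots> \<le> (\<Sum>k. F x k)"
      using sum_le_suminf[of "F x" "{k}"] by simp
    finally show ?thesis by (simp only: F_def)
  qed auto
  have vol: "ennreal (2 ^ Suc k / \<rho>) * emeasure lborel (?B k) = ennreal (c k)" for k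
  proof -
    have "2 ^ Suc k / \<rho> * (4 / 3 * pi * (\<rho> / 2 ^ k) ^ 3) = 8 / 3 * pi * \<rho>\<^sup>2 * (1 / 4) ^ k"
    proof -
      have "(4::real) ^ k = 2 ^ k * 2 ^ k" by (simp add: power_mult_distrib[symmetric])
      then show ?thesis using \<rho> by (simp add: field_simps power2_eq_square power3_eq_cube)
    qed
    then show ?thesis
      using \<rho> by (simp add: emeasure_cball unit_ball_vol_3 ennreal_mult'[symmetric] c_def del: power_Suc)
  qed
  have "(\<integral>\<^sup>+x. ennreal (norm (if norm x \<le> \<rho> then 1 / norm (x::space) else 0)) \<partial>lborel)
      \<le> (\<integral>\<^sup>+x. (\<Sum>k. ennreal (2 ^ Suc k / \<rho>) * indicator (?B k) x) \<partial>lborel)"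
    by (intro nn_integral_mono pt)
  also have "\<dots> = (\<Sum>k. \<integral>\<^sup>+x. ennreal (2 ^ Suc k / \<rho>) * indicator (?B k) x \<partial>lborel)"
    by (rule nn_integral_suminf)
      (intro borel_measurable_times_ennreal borel_measurable_const borel_measurable_indicator, simp)
  also have "\<dots> = (\<Sum>k. ennreal (c k))"
    by (simp only: nn_integral_cmult_indicator[of "?B _" lborel] vol sets_lborel borel_closed closed_cball)
  also have "\<dots> < \<infinity>"
  proof -
    have "summable c" unfolding c_def by (intro summable_mult summable_geometric) simp
    then have "(\<Sum>k. ennreal (c k)) = ennreal (suminf c)"
      by (intro suminf_ennreal2) (auto simp: c_def)
    then show ?thesis by simp
  qed
  finally show "(\<integral>\<^sup>+x. ennreal (norm (if norm x \<le> \<rho> then 1 / norm (x::space) else 0)) \<partial>lborel) < \<infinity>" .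
qed

lemma AE_lborel_neq_0: "AE y in lborel. (y :: 'a::euclidean_space) \<noteq> 0"
  using AE_norm_neq[of 0] by simp

lemma integrable_newton_diff:
  assumes "\<rho> > 0"
  shows "integrable lborel (newton_diff \<rho>)"
proof (rule Bochner_Integration.integrable_bound)
  show "integrable lborel (\<lambda>x::space. 1 / (4 * pi) * (if norm x \<le> \<rho> then 1 / norm x else 0))"
    by (intro integrable_mult_right integrable_newton_cball assms)
  show "AE x in lborel. norm (newton_diff \<rho> x) \<le> norm (1 / (4 * pi) * (if norm x \<le> \<rho> then 1 / norm x else 0))"
    using AE_lborel_neq_0
  proof eventually_elim
    case (elim x)
    then show ?case using ball_pot_bounds[OF assms elim] by (simp add: newton_diff_def mult.commute)
  qed
qed measurable

lemma newton_diff_support: "newton_diff \<rho> y \<noteq> 0 \<Longrightarrow> norm y \<le> \<rho>"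
  by (simp add: newton_diff_def split: if_splits)

section \<open>Small radii: principal values and the Laplacian of the near kernel\<close>

lemma conv_diff_left:
  assumes "integrable lborel (\<lambda>y. k y * f (z - (y, 0)))" "integrable lborel (\<lambda>y. l y * f (z - (y, 0)))"
  shows "conv (\<lambda>y. k y - l y) f z = conv k f z - conv l f z"
  unfolding conv_def left_diff_distrib using assms by simp

lemma integrable_conv_ball_pot_hess:
  assumes "f \<in> test_fun \<Omega>" "s > 0"
  shows "integrable lborel (\<lambda>y. ball_pot_hess s i j y * f (z - (y, 0)))"
  by (rule integrable_conv_test_fun[OF assms(1) measurable_ball_pot_hess ball_pot_hess_abs_le[OF assms(2)]])

text \<open>For \<open>s < \<rho>\<close> the kernel \<open>ball_pot s - ball_pot \<rho>\<close>
  vanishes outside the ball of radius \<rho>, is dominated by \<open>1 / (4 * pi * norm y)\<close>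
  inside it, and equals \<open>newton_diff \<rho>\<close> at \<open>y\<close> as soon as
  \<open>s < norm y\<close>. Dominated convergence gives the limit with both derivatives on
  \<open>f\<close>; \<open>conv_ball_pot\<close> then moves them to the kernels that are still
  regular.\<close>

lemma conv_ball_pot_hess_tendsto:
  assumes f: "f \<in> test_fun \<Omega>" and \<rho>: "\<rho> > 0"
  shows "((\<lambda>s. conv (ball_pot_hess s i j) f z) \<longlongrightarrow>
     conv (newton_diff \<rho>) (dir_deriv (e_x i) (dir_deriv (e_x j) f)) z + conv (ball_pot_hess \<rho> i j) f z)
     (at_right 0)"
proof -
  let ?g = "dir_deriv (e_x i) (dir_deriv (e_x j) f)"
  have g: "?g \<in> test_fun \<Omega>" using f by (intro test_fun_dir_deriv)
  have [measurable]: "?g \<in> borel_measurable borel" using g by (rule test_fun_measurable)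
  obtain M where M: "M > 0" "\<forall>z. \<bar>?g z\<bar> \<le> M" using test_fun_bounded[OF g] by blast
  have int_pot: "integrable lborel (\<lambda>y. ball_pot s y * ?g (z - (y, 0)))" if "s > 0" for s
  proof (rule integrable_conv_test_fun[OF g measurable_ball_pot])
    show "\<bar>ball_pot s y\<bar> \<le> 1 / s" for y
    proof (cases "norm y \<le> s")
      case True
      then have "(norm y)\<^sup>2 \<le> s\<^sup>2" by (intro power_mono) auto
      moreover have "0 \<le> (norm y)\<^sup>2" by simp
      ultimately have "\<bar>3 * s\<^sup>2 - (norm y)\<^sup>2\<bar> \<le> 3 * s\<^sup>2" by linarith
      then have "\<bar>ball_pot s y\<bar> \<le> 3 * s\<^sup>2 / (8 * pi * s ^ 3)"
        using True that by (simp add: ball_pot_def abs_divide divide_right_mono)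
      also have "\<dots> = 3 / (8 * pi) / s" using that by (simp add: field_simps eval_nat_numeral)
      also have "\<dots> \<le> 1 / s" using that pi_gt3 by (intro divide_right_mono) (auto simp: field_simps)
      finally show ?thesis .
    next
      case False
      have "1 / (4 * pi * norm y) \<le> 1 / s"
      proof (intro divide_left_mono mult_pos_pos)
        have "1 * s \<le> 4 * pi * norm y" using False that pi_gt3 by (intro mult_mono) auto
        then show "s \<le> 4 * pi * norm y" by simp
        show "0 < norm y" using False that by linarith
      qed (use that in auto)
      then show ?thesis using False by (simp add: ball_pot_def)
    qed
  qed
  \<comment> \<open>The radius is written as \<open>inverse t\<close>, with \<open>t\<close> tending
    to infinity, to fit dominated convergence along \<open>at_top\<close>.\<close>
  have "((\<lambda>t. LINT y|lborel. (ball_pot (inverse t) y - ball_pot \<rho> y) * ?g (z - (y, 0))) \<longlongrightarrow>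
     (LINT y|lborel. newton_diff \<rho> y * ?g (z - (y, 0)))) at_top"
  proof (rule integral_dominated_convergence_at_top[where w = "\<lambda>y. M / (4 * pi) * (if norm y \<le> \<rho> then 1 / norm y else 0)"])
    show "integrable lborel (\<lambda>y::space. M / (4 * pi) * (if norm y \<le> \<rho> then 1 / norm y else 0))"
      by (intro integrable_mult_right integrable_newton_cball \<rho>)
    have small: "\<forall>\<^sub>F t in at_top. 0 < inverse t \<and> inverse t < e" if "e > 0" for e :: real
      using eventually_gt_at_top[of "max 0 (inverse e)"]
    proof eventually_elim
      case (elim t)
      then have "0 < t" "inverse e < t" by auto
      then show ?case using less_imp_inverse_less[of "inverse e" t] that by simp
    qed
    show "AE y in lborel. ((\<lambda>t. (ball_pot (inverse t) y - ball_pot \<rho> y) * ?g (z - (y, 0))) \<longlongrightarrow>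
        newton_diff \<rho> y * ?g (z - (y, 0))) at_top"
      using AE_lborel_neq_0
    proof eventually_elim
      case (elim y)
      then have "norm y > 0" by simp
      from small[OF this]
      have "\<forall>\<^sub>F t in at_top. newton_diff \<rho> y * ?g (z - (y, 0)) = (ball_pot (inverse t) y - ball_pot \<rho> y) * ?g (z - (y, 0))"
        by eventually_elim (simp add: newton_diff_def ball_pot_outside)
      then show ?case by (rule Lim_transform_eventually[OF tendsto_const])
    qed
    show "\<forall>\<^sub>F t in at_top. AE y in lborel. norm ((ball_pot (inverse t) y - ball_pot \<rho> y) * ?g (z - (y, 0)))
       \<le> M / (4 * pi) * (if norm y \<le> \<rho> then 1 / norm y else 0)"
      using small[OF \<rho>]
    proof eventually_elim
      case (elim t)
      show ?case
        using AE_lborel_neq_0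
      proof eventually_elim
        case y: (elim y)
        show ?case
        proof (cases "norm y \<le> \<rho>")
          case True
          have "\<bar>ball_pot (inverse t) y - ball_pot \<rho> y\<bar> \<le> 1 / (4 * pi * norm y)"
            using ball_pot_bounds[OF \<rho> y] ball_pot_bounds[OF conjunct1[OF elim] y] by linarith
          then have "\<bar>ball_pot (inverse t) y - ball_pot \<rho> y\<bar> * \<bar>?g (z - (y, 0))\<bar> \<le> 1 / (4 * pi * norm y) * M"
            using M(1) by (intro mult_mono M(2)[rule_format]) auto
          then show ?thesis using True by (simp add: abs_mult mult_ac)
        next
          case False
          then have "ball_pot (inverse t) y = ball_pot \<rho> y"
            using elim by (simp add: ball_pot_outside)
          then show ?thesis using False by simp
        qed
      qed
    qed
  qed measurable
  moreover have "\<forall>\<^sub>F t in at_top. (LINT y|lborel. (ball_pot (inverse t) y - ball_pot \<rho> y) * ?g (z - (y, 0)))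
      = conv (ball_pot_hess (inverse t) i j) f z - conv (ball_pot_hess \<rho> i j) f z"
    using eventually_gt_at_top[of "0::real"]
  proof eventually_elim
    case (elim t)
    then have t: "inverse t > 0" by simp
    have "(LINT y|lborel. (ball_pot (inverse t) y - ball_pot \<rho> y) * ?g (z - (y, 0)))
        = conv (ball_pot (inverse t)) ?g z - conv (ball_pot \<rho>) ?g z"
      using conv_diff_left[OF int_pot[OF t] int_pot[OF \<rho>]] by (simp add: conv_def)
    then show ?case by (simp only: conv_ball_pot[OF f t] conv_ball_pot[OF f \<rho>])
  qed
  ultimately have "((\<lambda>t. conv (ball_pot_hess (inverse t) i j) f z - conv (ball_pot_hess \<rho> i j) f z) \<longlongrightarrow>
      conv (newton_diff \<rho>) ?g z) at_top"
    unfolding conv_def[of "newton_diff \<rho>"] by (rule Lim_transform_eventually)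
  from tendsto_add[OF this tendsto_const[of "conv (ball_pot_hess \<rho> i j) f z"]]
  have "((\<lambda>t. conv (ball_pot_hess (inverse t) i j) f z) \<longlongrightarrow>
      conv (newton_diff \<rho>) ?g z + conv (ball_pot_hess \<rho> i j) f z) at_top" by simp
  then show ?thesis by (simp only: filterlim_at_right_to_top)
qed

lemma integrable_ball_avg: "integrable lborel (ball_avg s)"
proof (rule integrable_bounded_support)
  show "\<bar>ball_avg s y\<bar> \<le> \<bar>3 / (4 * pi * s ^ 3)\<bar>" for y by (simp add: ball_avg_def)
  show "ball_avg s y \<noteq> 0 \<Longrightarrow> norm y \<le> s" for y by (simp add: ball_avg_def split: if_splits)
qed measurable

lemma ball_avg_support: "ball_avg s y \<noteq> 0 \<Longrightarrow> norm y \<le> s"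
  by (simp add: ball_avg_def split: if_splits)

lemma integral_ball_avg:
  assumes "s > 0"
  shows "(LINT y|lborel. ball_avg s y) = 1"
proof -
  have "ball_avg s = (\<lambda>y. 3 / (4 * pi * s ^ 3) * indicator (cball 0 s) y)"
    by (rule ext) (simp add: ball_avg_def indicator_def dist_norm)
  then have "(LINT y|lborel. ball_avg s y) = 3 / (4 * pi * s ^ 3) * measure lborel (cball (0::space) s)"
    by simp
  also have "measure lborel (cball (0::space) s) = 4 / 3 * pi * s ^ 3"
    using assms by (simp add: measure_def emeasure_cball unit_ball_vol_3)
  finally show ?thesis using assms by simp
qed

text \<open>The averages have total mass 1 and reach no farther than distance \<open>s\<close>, so a
  Lipschitz constant \<open>L\<close> of \<open>f\<close> gives the rate
  \<open>L * s\<close>.\<close>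

lemma conv_ball_avg_tendsto:
  assumes f: "f \<in> test_fun \<Omega>"
  shows "((\<lambda>s. conv (ball_avg s) f z) \<longlongrightarrow> f z) (at_right 0)"
proof -
  obtain L where L: "L > 0" "\<forall>z w. \<bar>f z - f w\<bar> \<le> L * norm (z - w)" using test_fun_Lipschitz[OF f] by blast
  obtain M where M: "\<forall>z. \<bar>f z\<bar> \<le> M" using test_fun_bounded[OF f] by blast
  have mf [measurable]: "f \<in> borel_measurable borel" using f by (rule test_fun_measurable)
  have "\<bar>conv (ball_avg s) f z - f z\<bar> \<le> L * s" if s: "s > 0" for s
  proof -
    have "integrable lborel (\<lambda>y. ball_avg s y * f (z - (y, 0)))"
      using M by (intro integrable_conv[OF integrable_ball_avg]) auto
    then have "conv (ball_avg s) f z - f z = (LINT y|lborel. ball_avg s y * f (z - (y, 0)) - ball_avg s y * f z)"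
      by (simp add: conv_def integrable_ball_avg integral_ball_avg[OF s])
    also have "\<bar>\<dots>\<bar> \<le> (LINT y|lborel. L * s * ball_avg s y)"
    proof (rule abs_integral_le)
      show "\<bar>ball_avg s y * f (z - (y, 0)) - ball_avg s y * f z\<bar> \<le> L * s * ball_avg s y" for y
      proof (cases "norm y \<le> s")
        case True
        have "\<bar>f (z - (y, 0)) - f z\<bar> \<le> L * norm (z - (y, 0) - z)" using L(2) by blast
        also have "\<dots> \<le> L * s" using True L(1) by (simp add: norm_Pair)
        finally have "ball_avg s y * \<bar>f (z - (y, 0)) - f z\<bar> \<le> ball_avg s y * (L * s)"
          using s by (intro mult_left_mono) (auto simp: ball_avg_def)
        moreover have "0 \<le> ball_avg s y" using s by (simp add: ball_avg_def)
        moreover from this have "\<bar>ball_avg s y * f (z - (y, 0)) - ball_avg s y * f z\<bar>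
            = ball_avg s y * \<bar>f (z - (y, 0)) - f z\<bar>"
          by (simp only: right_diff_distrib[symmetric] abs_mult abs_of_nonneg)
        ultimately show ?thesis by (simp only: mult_ac)
      qed (simp add: ball_avg_def)
      show "integrable lborel (\<lambda>y. L * s * ball_avg s y)" by (simp add: integrable_ball_avg)
    qed measurable
    also have "\<dots> = L * s" by (simp add: integral_ball_avg[OF s])
    finally show ?thesis .
  qed
  then have ev: "\<forall>\<^sub>F s in at_right 0. norm (conv (ball_avg s) f z - f z) \<le> L * s"
    by (simp add: eventually_at_filter)
  have "((\<lambda>s. L * s) \<longlongrightarrow> L * 0) (at_right 0)" by (intro tendsto_intros)
  then have "((\<lambda>s. conv (ball_avg s) f z - f z) \<longlongrightarrow> 0) (at_right 0)"
    by (intro Lim_null_comparison[OF ev]) simp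
  then show ?thesis by (simp add: LIM_zero_iff)
qed

text \<open>The trace of \<open>conv_ball_pot_hess_tendsto\<close>. By Poisson's equation the traces
  for radius \<open>s\<close> are \<open>- conv (ball_avg s) f z\<close>, which tend to
  \<open>- f z\<close>; uniqueness of limits yields the identity without differentiating the
  singular kernel.\<close>

lemma conv_newton_diff_laplacian:
  assumes f: "f \<in> test_fun \<Omega>" and \<rho>: "\<rho> > 0"
  shows "(\<Sum>i\<in>UNIV. conv (newton_diff \<rho>) (dir_deriv (e_x i) (dir_deriv (e_x i) f)) z)
     = conv (ball_avg \<rho>) f z - f z"
proof -
  have tr: "(\<Sum>i\<in>UNIV. conv (ball_pot_hess s i i) f z) = - conv (ball_avg s) f z" if "s > 0" for s
  proof -
    have "(\<Sum>i\<in>UNIV. conv (ball_pot_hess s i i) f z)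
        = (LINT y|lborel. (\<Sum>i\<in>UNIV. ball_pot_hess s i i y * f (z - (y, 0))))"
      unfolding conv_def
      by (rule Bochner_Integration.integral_sum[symmetric])
        (rule integrable_conv_ball_pot_hess[OF f that])
    then show ?thesis
      by (simp add: sum_distrib_right[symmetric] ball_pot_hess_trace conv_def)
  qed
  have "((\<lambda>s. \<Sum>i\<in>UNIV. conv (ball_pot_hess s i i) f z) \<longlongrightarrow>
    (\<Sum>i\<in>UNIV. conv (newton_diff \<rho>) (dir_deriv (e_x i) (dir_deriv (e_x i) f)) z + conv (ball_pot_hess \<rho> i i) f z))
    (at_right 0)"
    by (intro tendsto_sum conv_ball_pot_hess_tendsto[OF f \<rho>])
  moreover have "((\<lambda>s. \<Sum>i\<in>UNIV. conv (ball_pot_hess s i i) f z) \<longlongrightarrow> - f z) (at_right 0)"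
    by (rule Lim_transform_eventually[OF tendsto_minus[OF conv_ball_avg_tendsto[OF f]]])
      (simp add: eventually_at_filter tr)
  ultimately have "(\<Sum>i\<in>UNIV. conv (newton_diff \<rho>) (dir_deriv (e_x i) (dir_deriv (e_x i) f)) z
      + conv (ball_pot_hess \<rho> i i) f z) = - f z"
    using tendsto_unique trivial_limit_at_right_real by blast
  then show ?thesis using tr[OF \<rho>] by (simp add: sum.distrib)
qed

text \<open>The truncated kernel is \<open>ball_pot_hess s\<close> plus, on the diagonal, a third of
  the density. In the limit this third becomes \<open>f (x, t) / 3\<close> and cancels the first
  summand of \<open>RR\<close>. The principal value is thereby shown to exist, so \<open>Lim\<close>
  really denotes it, and for every \<rho> the Riesz transform splits into a compactly supported part
  and a part with a bounded kernel.\<close>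

lemma RR_eq:
  assumes f: "f \<in> test_fun \<Omega>" and \<rho>: "\<rho> > 0"
  shows "RR i j (\<lambda>y. f (y, t)) x =
     conv (newton_diff \<rho>) (dir_deriv (e_x i) (dir_deriv (e_x j) f)) (x, t) + conv (ball_pot_hess \<rho> i j) f (x, t)"
    (is "_ = ?R")
proof -
  have mf [measurable]: "f \<in> borel_measurable borel" using f by (rule test_fun_measurable)
  let ?K = "\<lambda>s y. if norm y > s then Kern i j y else 0"
  have eq: "(LINT y:{y. dist x y > s}|lborel. Kern i j (x - y) * f (y, t)) = conv (?K s) f (x, t)" for s
  proof -
    have "?K s \<in> borel_measurable borel" by measurable
    note conv_reflect[OF this mf, of x t]
    moreover have "(\<lambda>y. indicator {y. dist x y > s} y *\<^sub>R (Kern i j (x - y) * f (y, t)))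
        = (\<lambda>y. (if norm (x - y) > s then Kern i j (x - y) else 0) * f (y, t))"
      by (rule ext) (simp add: dist_norm)
    ultimately show ?thesis by (simp only: set_lebesgue_integral_def)
  qed
  have "conv (?K s) f (x, t) = conv (ball_pot_hess s i j) f (x, t) + (if i = j then conv (ball_avg s) f (x, t) / 3 else 0)"
    if "s > 0" for s
  proof -
    obtain M where M: "\<forall>z. \<bar>f z\<bar> \<le> M" using test_fun_bounded[OF f] by blast
    have i1: "integrable lborel (\<lambda>y. ball_avg s y * f ((x, t) - (y, 0)))"
      using M by (intro integrable_conv[OF integrable_ball_avg]) auto
    have K: "(if norm y > s then Kern i j y else 0) = ball_pot_hess s i j y + (if i = j then ball_avg s y / 3 else 0)" for y
      by (simp add: ball_pot_hess_eq)
    have "conv (?K s) f (x, t) = (LINT y|lborel. ball_pot_hess s i j y * f ((x, t) - (y, 0))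
        + (if i = j then ball_avg s y * f ((x, t) - (y, 0)) / 3 else 0))"
      unfolding conv_def K
      by (rule Bochner_Integration.integral_cong[OF refl]) (simp add: distrib_right)
    also have "\<dots> = conv (ball_pot_hess s i j) f (x, t) + (if i = j then conv (ball_avg s) f (x, t) / 3 else 0)"
    proof -
      have i2: "integrable lborel (\<lambda>y. ball_avg s y * f ((x, t) - (y, 0)) / 3)"
        using i1 by (rule integrable_divide)
      show ?thesis
        by (cases "i = j")
          (simp_all only: simp_thms if_True if_False conv_def integral_divide_zero add_0_right
            Bochner_Integration.integral_add[OF integrable_conv_ball_pot_hess[OF f that] i2])
    qed
    finally show ?thesis .
  qed
  then have ev: "\<forall>\<^sub>F s in at_right 0. conv (ball_pot_hess s i j) f (x, t) + (if i = j then conv (ball_avg s) f (x, t) / 3 else 0)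
      = conv (?K s) f (x, t)"
    by (simp add: eventually_at_filter)
  have "((\<lambda>s. conv (ball_pot_hess s i j) f (x, t) + (if i = j then conv (ball_avg s) f (x, t) / 3 else 0)) \<longlongrightarrow>
      ?R + (if i = j then f (x, t) / 3 else 0)) (at_right 0)"
    by (cases "i = j") (auto intro!: tendsto_add conv_ball_pot_hess_tendsto[OF f \<rho>] tendsto_divide conv_ball_avg_tendsto[OF f])
  from Lim_transform_eventually[OF this ev]
  have "Lim (at_right 0) (\<lambda>s. conv (?K s) f (x, t)) = ?R + (if i = j then f (x, t) / 3 else 0)"
    by (intro tendsto_Lim) auto
  then show ?thesis by (simp add: RR_def eq)
qed

section \<open>Fields with decaying energy\<close>

text \<open>The power 4 is the decay of differences of \<open>Kern\<close>, and it beats the cubic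
  growth of the energy on balls. The weight sees the space variable alone: integrability in time
  comes from the field.\<close>

definition weight :: "spacetime \<Rightarrow> real" where
  "weight z = 1 / (1 + norm (fst z)) ^ 4"

lemma measurable_fst_borel [measurable]:
  "(fst :: 'a::{second_countable_topology} \<times> 'b::{second_countable_topology} \<Rightarrow> 'a) \<in> borel_measurable borel"
  by (intro borel_measurable_continuous_onI continuous_intros)

lemma measurable_snd_borel [measurable]:
  "(snd :: 'a::{second_countable_topology} \<times> 'b::{second_countable_topology} \<Rightarrow> 'b) \<in> borel_measurable borel"
  by (intro borel_measurable_continuous_onI continuous_intros)

lemma measurable_weight [measurable]: "weight \<in> borel_measurable borel"
  unfolding weight_def[abs_def] by measurable

lemma weight_pos: "weight z > 0"
proof -
  have "0 < 1 + norm (fst z)" using norm_ge_zero[of "fst z"] by linarith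
  then show ?thesis by (simp add: weight_def)
qed

lemma weight_ge:
  assumes "norm (fst z) \<le> r"
  shows "1 / (1 + r) ^ 4 \<le> weight z"
proof -
  have "0 < 1 + norm (fst z)" using norm_ge_zero[of "fst z"] by linarith
  then show ?thesis
    unfolding weight_def using assms by (intro divide_left_mono power_mono) auto
qed

lemma test_fun_le_weight:
  fixes \<phi> :: "spacetime \<Rightarrow> real"
  assumes "\<phi> \<in> test_fun \<Omega>"
  shows "\<exists>B>0. \<forall>z. \<bar>\<phi> z\<bar> \<le> B * weight z"
proof -
  obtain M where M: "M > 0" "\<forall>z. \<bar>\<phi> z\<bar> \<le> M" using test_fun_bounded[OF assms] by blast
  obtain r where r: "r > 0" "\<forall>z. \<phi> z \<noteq> 0 \<longrightarrow> norm z \<le> r" using test_fun_support_bounded[OF assms] by blast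
  have "\<bar>\<phi> z\<bar> \<le> M * (1 + r) ^ 4 * weight z" for z
  proof (cases "\<phi> z = 0")
    case True
    then show ?thesis using M(1) r(1) weight_pos[of z] by simp
  next
    case False
    have "norm (fst z) \<le> norm z" using norm_fst_le[of "fst z" "snd z"] by simp
    then have "norm (fst z) \<le> r" using r(2) False by fastforce
    from weight_ge[OF this] have "1 \<le> (1 + r) ^ 4 * weight z"
      using r(1) by (simp add: field_simps)
    then have "M * 1 \<le> M * ((1 + r) ^ 4 * weight z)" using M(1) by (intro mult_left_mono) auto
    then show ?thesis using M(2)[rule_format, of z] by (simp add: mult.assoc)
  qed
  then show ?thesis using M(1) r(1) by (intro exI[of _ "M * (1 + r) ^ 4"]) simp
qed

text \<open>The velocity is meant to be extended by 0 beyond its time interval, so that all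
  integrals run over space-time. Balls restrict the space variable and leave time free, as in the
  decay hypothesis of the theorem.\<close>

locale decaying_field =
  fixes v :: "spacetime \<Rightarrow> real^3"
  assumes v_measurable [measurable]: "v \<in> borel_measurable borel"
    and integrable_ball: "\<And>R. integrable lborel (\<lambda>z. if norm (fst z) < R then (norm (v z))\<^sup>2 else 0)"
    and decay: "((\<lambda>R. (LINT z|lborel. (if norm (fst z) < R then (norm (v z))\<^sup>2 else 0)) / R ^ 3) \<longlongrightarrow> 0) at_top"
begin

definition energy :: "real \<Rightarrow> real" where
  "energy R = (LINT z|lborel. (if norm (fst z) < R then (norm (v z))\<^sup>2 else 0))"

lemma measurable_component [measurable]: "(\<lambda>z. v z $ i) \<in> borel_measurable borel"
  by measurable

lemma energy_nonneg: "energy R \<ge> 0"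
  unfolding energy_def by (intro integral_nonneg_AE AE_I2) auto

lemma energy_mono: "R \<le> S \<Longrightarrow> energy R \<le> energy S"
  unfolding energy_def by (intro integral_mono integrable_ball) auto

text \<open>The limit bounds the ratio for large \<open>R\<close> only; for the remaining
  \<open>R \<ge> 1\<close> monotonicity suffices, because \<open>R ^ 3\<close> is at least
  1.\<close>

lemma energy_growth: "\<exists>C>0. \<forall>R\<ge>1. energy R \<le> C * R ^ 3"
proof -
  have "\<forall>\<^sub>F R in at_top. energy R / R ^ 3 < 1"
    using order_tendstoD(2)[OF decay, of 1] by (simp add: energy_def)
  then obtain R0 where R0: "\<And>R. R \<ge> R0 \<Longrightarrow> energy R / R ^ 3 < 1"
    by (auto simp: eventually_at_top_linorder)
  let ?S = "max R0 1"
  have "energy R \<le> (1 + energy ?S) * R ^ 3" if "R \<ge> 1" for R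
  proof (cases "R \<ge> R0")
    case True
    have "energy R \<le> 1 * R ^ 3" using R0[OF True] that by (simp add: field_simps)
    also have "\<dots> \<le> (1 + energy ?S) * R ^ 3"
      using energy_nonneg[of ?S] that by (intro mult_right_mono) auto
    finally show ?thesis .
  next
    case False
    have "energy R \<le> energy ?S" using False by (intro energy_mono) auto
    also have "\<dots> \<le> (1 + energy ?S) * 1" by simp
    also have "\<dots> \<le> (1 + energy ?S) * R ^ 3"
      using energy_nonneg[of ?S] that by (intro mult_left_mono) auto
    finally show ?thesis .
  qed
  then show ?thesis
    using energy_nonneg[of ?S] by (intro exI[of _ "1 + energy ?S"]) auto
qed

text \<open>Where \<open>1 + norm (fst z)\<close> lies between \<open>2 ^ k\<close> and
  \<open>2 ^ Suc k\<close> the weight is at most \<open>(1 / 16) ^ k\<close>, while the energy of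
  the ball of radius \<open>2 ^ Suc k\<close> is at most \<open>C * (2 ^ Suc k) ^ 3\<close>. The
  contributions are dominated by the convergent series with terms
  \<open>8 * C * (1 / 2) ^ k\<close>.\<close>

lemma integrable_weighted: "integrable lborel (\<lambda>z. (norm (v z))\<^sup>2 * weight z)"
proof (rule integrableI_bounded)
  obtain C where C: "C > 0" "\<forall>R\<ge>1. energy R \<le> C * R ^ 3" using energy_growth by blast
  let ?e = "\<lambda>k z. if norm (fst z) < 2 ^ Suc k then (norm (v z))\<^sup>2 else 0"
  define F where "F = (\<lambda>z k. ennreal ((1 / 16) ^ k * ?e k z))"
  have mF: "(\<lambda>z. F z k) \<in> borel_measurable lborel" for k unfolding F_def by measurable
  have pt: "ennreal (norm ((norm (v z))\<^sup>2 * weight z)) \<le> (\<Sum>k. F z k)" for z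
  proof -
    obtain k where k: "2 ^ k \<le> 1 + norm (fst z)" "1 + norm (fst z) < 2 ^ Suc k"
      using ex_dyadic_interval[of "1 + norm (fst z)"] by auto
    have "((2::real) ^ k) ^ 4 = (2 ^ 4) ^ k"
      by (simp only: power_mult[symmetric] mult.commute)
    then have "((2::real) ^ k) ^ 4 = 16 ^ k" by simp
    moreover have "((2::real) ^ k) ^ 4 \<le> (1 + norm (fst z)) ^ 4"
      using k(1) by (intro power_mono) auto
    moreover have "0 < (1 + norm (fst z)) ^ 4"
      using norm_ge_zero[of "fst z"] by (intro zero_less_power) linarith
    ultimately have "weight z \<le> (1 / 16) ^ k"
      unfolding weight_def power_one_over by (intro divide_left_mono) auto
    then have "(norm (v z))\<^sup>2 * weight z \<le> (norm (v z))\<^sup>2 * (1 / 16) ^ k"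
      by (intro mult_left_mono) auto
    also have "\<dots> = (1 / 16) ^ k * ?e k z"
      using k(2) by simp
    finally have "(norm (v z))\<^sup>2 * weight z \<le> (1 / 16) ^ k * ?e k z" .
    then have "ennreal (norm ((norm (v z))\<^sup>2 * weight z)) \<le> F z k"
      unfolding F_def using weight_pos[of z] by (intro ennreal_leI) simp
    also have "\<dots> \<le> (\<Sum>k. F z k)" using sum_le_suminf[of "F z" "{k}"] by simp
    finally show ?thesis .
  qed
  have int: "(\<integral>\<^sup>+z. F z k \<partial>lborel) \<le> ennreal (8 * C * (1 / 2) ^ k)" for k
  proof -
    have "(\<integral>\<^sup>+z. F z k \<partial>lborel) = ennreal (LINT z|lborel. (1 / 16) ^ k * ?e k z)"
      unfolding F_def by (intro nn_integral_eq_integral integrable_mult_right integrable_ball) auto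
    also have "(LINT z|lborel. (1 / 16) ^ k * ?e k z) = (1 / 16) ^ k * energy (2 ^ Suc k)"
      unfolding energy_def by (rule integral_mult_right_zero)
    also have "\<dots> \<le> (1 / 16) ^ k * (C * (2 ^ Suc k) ^ 3)"
      using C(2)[rule_format, of "2 ^ Suc k"] one_le_power[of "2::real" "Suc k"] by (intro mult_left_mono) auto
    also have "\<dots> = 8 * C * (1 / 2) ^ k"
    proof -
      have "(1 / 16) ^ k * (((2::real) ^ k) ^ 3) = (1 / 2) ^ k"
      proof -
        have "((2::real) ^ k) ^ 3 = (2 ^ 3) ^ k"
          by (simp only: power_mult[symmetric] mult.commute)
        then have "(1 / 16) ^ k * (((2::real) ^ k) ^ 3) = (1 / 16 * 2 ^ 3) ^ k"
          by (simp only: power_mult_distrib)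
        then show ?thesis by simp
      qed
      then show ?thesis by (simp add: power_mult_distrib mult_ac)
    qed
    finally show ?thesis by (simp add: ennreal_leI)
  qed
  have "(\<integral>\<^sup>+z. ennreal (norm ((norm (v z))\<^sup>2 * weight z)) \<partial>lborel) \<le> (\<integral>\<^sup>+z. (\<Sum>k. F z k) \<partial>lborel)"
    by (intro nn_integral_mono pt)
  also have "\<dots> = (\<Sum>k. \<integral>\<^sup>+z. F z k \<partial>lborel)" by (rule nn_integral_suminf[OF mF])
  also have "\<dots> \<le> (\<Sum>k. ennreal (8 * C * (1 / 2) ^ k))" by (intro suminf_le int) auto
  also have "\<dots> < \<infinity>"
  proof -
    have "summable (\<lambda>k. 8 * C * (1 / 2) ^ k)" by (intro summable_mult summable_geometric) simp
    then have "(\<Sum>k. ennreal (8 * C * (1 / 2) ^ k)) = ennreal (\<Sum>k. 8 * C * (1 / 2) ^ k)"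
      using C(1) by (intro suminf_ennreal2) auto
    then show ?thesis by simp
  qed
  finally show "(\<integral>\<^sup>+z. ennreal (norm ((norm (v z))\<^sup>2 * weight z)) \<partial>lborel) < \<infinity>" .
qed measurable

lemma abs_component_mult_le: "\<bar>v z $ i * v z $ j\<bar> \<le> (norm (v z))\<^sup>2"
  unfolding abs_mult power2_eq_square by (intro mult_mono component_le_norm_cart) auto

lemma integrable_vv:
  assumes "g \<in> borel_measurable borel" "\<And>z. \<bar>g z\<bar> \<le> B * weight z"
  shows "integrable lborel (\<lambda>z. v z $ i * v z $ j * g z)"
proof (rule Bochner_Integration.integrable_bound)
  show "integrable lborel (\<lambda>z. B * ((norm (v z))\<^sup>2 * weight z))"
    by (intro integrable_mult_right integrable_weighted)
  show "AE z in lborel. norm (v z $ i * v z $ j * g z) \<le> norm (B * ((norm (v z))\<^sup>2 * weight z))"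
  proof (rule AE_I2)
    fix z
    have "\<bar>v z $ i * v z $ j\<bar> * \<bar>g z\<bar> \<le> (norm (v z))\<^sup>2 * (B * weight z)"
      by (intro mult_mono abs_component_mult_le assms(2)) auto
    also have "\<dots> \<le> \<bar>B * ((norm (v z))\<^sup>2 * weight z)\<bar>"
      by (rule order_trans[OF _ abs_ge_self]) (simp add: mult_ac)
    finally show "norm (v z $ i * v z $ j * g z) \<le> norm (B * ((norm (v z))\<^sup>2 * weight z))"
      by (simp only: real_norm_def abs_mult)
  qed
qed (use assms(1) in measurable)

lemma integrable_vv_test_fun:
  assumes "g \<in> test_fun \<Omega>"
  shows "integrable lborel (\<lambda>z. v z $ i * v z $ j * g z)"
proof -
  obtain B where "\<forall>z. \<bar>g z\<bar> \<le> B * weight z" using test_fun_le_weight[OF assms] by blast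
  then show ?thesis by (intro integrable_vv[OF test_fun_measurable[OF assms]]) auto
qed

lemma energy_scaled: "((\<lambda>\<rho>. energy (2 * \<rho>) / \<rho> ^ 3) \<longlongrightarrow> 0) at_top"
proof -
  have "filterlim (\<lambda>\<rho>::real. 2 * \<rho>) at_top at_top"
    by (intro filterlim_tendsto_pos_mult_at_top[OF tendsto_const _ filterlim_ident]) simp
  from filterlim_compose[OF decay this]
  have "((\<lambda>\<rho>. energy (2 * \<rho>) / (2 * \<rho>) ^ 3) \<longlongrightarrow> 0) at_top" by (simp add: energy_def)
  from tendsto_mult[OF tendsto_const[of 8] this] show ?thesis by (simp add: power_mult_distrib)
qed

lemma tail_tendsto: "((\<lambda>\<rho>. LINT z|lborel. (if 2 * \<rho> \<le> norm (fst z) then (norm (v z))\<^sup>2 * weight z else 0)) \<longlongrightarrow> 0) at_top"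
proof -
  have "((\<lambda>\<rho>. LINT z|lborel. (if 2 * \<rho> \<le> norm (fst z) then (norm (v z))\<^sup>2 * weight z else 0)) \<longlongrightarrow> (LINT z|(lborel :: spacetime measure). 0)) at_top"
  proof (rule integral_dominated_convergence_at_top[OF _ _ integrable_weighted])
    show "AE z in lborel. ((\<lambda>\<rho>. if 2 * \<rho> \<le> norm (fst z) then (norm (v z))\<^sup>2 * weight z else 0) \<longlongrightarrow> 0) at_top"
    proof (intro AE_I2 tendsto_eventually)
      fix z
      show "\<forall>\<^sub>F \<rho> in at_top. (if 2 * \<rho> \<le> norm (fst z) then (norm (v z))\<^sup>2 * weight z else 0) = 0"
        using eventually_gt_at_top[of "norm (fst z)"]
        by eventually_elim (use norm_ge_zero[of "fst z"] in \<open>auto simp del: norm_ge_zero\<close>)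
    qed
    show "\<forall>\<^sub>F \<rho> in at_top. AE z in lborel. norm (if 2 * \<rho> \<le> norm (fst z) then (norm (v z))\<^sup>2 * weight z else 0) \<le> (norm (v z))\<^sup>2 * weight z"
      using weight_pos by (intro always_eventually allI AE_I2) (auto simp: less_imp_le)
  qed measurable
  then show ?thesis by simp
qed

end

section \<open>Convolutions with the kernels of large radius\<close>

lemma integral_abs_slice_le:
  fixes f :: "spacetime \<Rightarrow> real"
  assumes "f \<in> borel_measurable borel" "\<And>z. \<bar>f z\<bar> \<le> M" "\<And>z. f z \<noteq> 0 \<Longrightarrow> norm z \<le> r" "M \<ge> 0"
  shows "integrable lborel (\<lambda>y. \<bar>f (y, t)\<bar>)"
    and "(LINT y|lborel. \<bar>f (y, t)\<bar>) \<le> M * measure lborel (cball (0::space) r)"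
proof -
  note assms(1)[measurable]
  have supp: "norm y \<le> r" if "f (y, t) \<noteq> 0" for y
    using assms(3)[OF that] norm_fst_le[of y t] by linarith
  have ind: "\<bar>f (y, t)\<bar> \<le> M * indicator (cball 0 r) y" for y
    using supp[of y] assms(2)[of "(y, t)"] assms(4) by (cases "f (y, t) = 0") (auto simp: dist_norm)
  show i: "integrable lborel (\<lambda>y. \<bar>f (y, t)\<bar>)"
    by (rule integrable_bounded_support[of _ M r]) (use supp assms(2) in auto)
  have "(LINT y|lborel. \<bar>f (y, t)\<bar>) \<le> (LINT y|lborel. M * indicator (cball (0::space) r) y)"
    using emeasure_lborel_cball_finite[of "0::space" r] ind by (intro integral_mono i) auto
  then show "(LINT y|lborel. \<bar>f (y, t)\<bar>) \<le> M * measure lborel (cball (0::space) r)" by simp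
qed

lemma integrable_test_fun_slice:
  fixes f :: "spacetime \<Rightarrow> real"
  assumes f: "f \<in> test_fun \<Omega>"
  shows "integrable lborel (\<lambda>y. f (y, t))"
proof -
  have [measurable]: "f \<in> borel_measurable borel" using f by (rule test_fun_measurable)
  obtain M where M: "M > 0" "\<forall>z. \<bar>f z\<bar> \<le> M" using test_fun_bounded[OF f] by blast
  obtain r where r: "\<forall>z. f z \<noteq> 0 \<longrightarrow> norm z \<le> r" using test_fun_support_bounded[OF f] by blast
  have "integrable lborel (\<lambda>y. \<bar>f (y, t)\<bar>)"
    by (rule integral_abs_slice_le(1)[of f M r]) (use M r in auto)
  then show ?thesis by (subst (asm) integrable_abs_iff) auto
qed

lemma conv_abs_le:
  fixes f :: "spacetime \<Rightarrow> real"
  assumes [measurable]: "k \<in> borel_measurable borel" "f \<in> borel_measurable borel"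
    and k: "\<And>y. \<bar>k y\<bar> \<le> A" and f: "integrable lborel (\<lambda>y. \<bar>f (y, t)\<bar>)"
  shows "\<bar>conv k f (x, t)\<bar> \<le> A * (LINT y|lborel. \<bar>f (y, t)\<bar>)"
proof -
  have "\<bar>LINT y|lborel. k (x - y) * f (y, t)\<bar> \<le> (LINT y|lborel. A * \<bar>f (y, t)\<bar>)"
    by (rule abs_integral_le) (use f k in \<open>auto simp: abs_mult mult_right_mono\<close>)
  then show ?thesis by (simp add: conv_reflect)
qed

text \<open>Since \<open>f\<close> has mean zero, the kernel may be replaced by its difference with the value at \<open>x\<close>.\<close>

lemma conv_ball_pot_hess_bounds:
  assumes f: "f \<in> test_fun \<Omega>" and mean: "\<And>t. (LINT y|lborel. f (y, t)) = 0"
  shows "\<exists>C>0. \<exists>r\<ge>1. \<forall>\<rho>>r. \<forall>z i j. \<bar>conv (ball_pot_hess \<rho> i j) f z\<bar> \<le> C / \<rho> ^ 3 \<and>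
    (2 * \<rho> \<le> norm (fst z) \<longrightarrow> \<bar>conv (ball_pot_hess \<rho> i j) f z\<bar> \<le> C * weight z)"
proof -
  obtain M where M: "M > 0" "\<forall>z. \<bar>f z\<bar> \<le> M" using test_fun_bounded[OF f] by blast
  obtain r0 where r0: "r0 > 0" "\<forall>z. f z \<noteq> 0 \<longrightarrow> norm z \<le> r0" using test_fun_support_bounded[OF f] by blast
  define r where "r = max r0 1"
  have r: "r \<ge> 1" "\<And>z. f z \<noteq> 0 \<Longrightarrow> norm z \<le> r" using r0 by (auto simp: r_def le_max_iff_disj)
  have [measurable]: "f \<in> borel_measurable borel" using f by (rule test_fun_measurable)
  define J where "J = M * measure lborel (cball (0::space) r)"
  have J: "integrable lborel (\<lambda>y. \<bar>f (y, t)\<bar>)" "(LINT y|lborel. \<bar>f (y, t)\<bar>) \<le> J" for t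
    using integral_abs_slice_le[of f M r t] M r(2) by (auto simp: J_def)
  have "J \<ge> 0" using M(1) by (simp add: J_def)
  \<comment> \<open>The factor \<open>568 * r\<close> comes from \<open>Kern_diff_le\<close>, and 16
    from replacing \<open>norm x\<close> by \<open>1 + norm x\<close>, which is at most
    \<open>2 * norm x\<close> in the far region because \<open>r \<ge> 1\<close>. The summand 1
    makes the constant positive.\<close>
  define C where "C = 1 + J + 568 * r * J * 16"
  have C: "C > 0" "J \<le> C" "568 * r * J * 16 \<le> C" using \<open>J \<ge> 0\<close> r(1) by (auto simp: C_def add_pos_nonneg)
  have "\<bar>conv (ball_pot_hess \<rho> i j) f (x, t)\<bar> \<le> C / \<rho> ^ 3 \<and>
      (2 * \<rho> \<le> norm x \<longrightarrow> \<bar>conv (ball_pot_hess \<rho> i j) f (x, t)\<bar> \<le> C * weight (x, t))"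
    if \<rho>: "\<rho> > r" for \<rho> x t i j
  proof (intro conjI impI)
    have "\<rho> > 0" using \<rho> r(1) by simp
    have "\<bar>conv (ball_pot_hess \<rho> i j) f (x, t)\<bar> \<le> 1 / \<rho> ^ 3 * (LINT y|lborel. \<bar>f (y, t)\<bar>)"
      using ball_pot_hess_abs_le[OF \<open>\<rho> > 0\<close>] by (intro conv_abs_le J) auto
    also have "\<dots> \<le> 1 / \<rho> ^ 3 * C"
      using J(2)[of t] C(2) \<open>\<rho> > 0\<close> by (intro mult_left_mono) auto
    finally show "\<bar>conv (ball_pot_hess \<rho> i j) f (x, t)\<bar> \<le> C / \<rho> ^ 3" by simp
    assume x: "2 * \<rho> \<le> norm x"
    then have "x \<noteq> 0" "norm x \<ge> 1" using \<rho> r(1) by auto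
    \<comment> \<open>Seen from such an \<open>x\<close>, the support of \<open>f\<close> lies
      beyond the range of the regularisation, so the true kernel appears.\<close>
    have eq: "ball_pot_hess \<rho> i j (x - y) * f (y, t) = Kern i j (x - y) * f (y, t)" for y
    proof (cases "f (y, t) = 0")
      case False
      then have "norm y \<le> r" using r(2)[OF False] norm_fst_le[of y t] by linarith
      then have "norm (x - y) > \<rho>" using x \<rho> norm_triangle_ineq2[of x y] by linarith
      then show ?thesis by (simp add: ball_pot_hess_def)
    qed simp
    have f1: "integrable lborel (\<lambda>y. f (y, t))" by (rule integrable_test_fun_slice[OF f])
    have "integrable lborel (\<lambda>y. ball_pot_hess \<rho> i j (x - y) * f (y, t))"
    proof (rule Bochner_Integration.integrable_bound[OF integrable_mult_right[OF J(1)[of t], of "1 / \<rho> ^ 3"]])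
      show "AE y in lborel. norm (ball_pot_hess \<rho> i j (x - y) * f (y, t)) \<le> norm (1 / \<rho> ^ 3 * \<bar>f (y, t)\<bar>)"
      proof (rule AE_I2)
        fix y
        have "\<bar>ball_pot_hess \<rho> i j (x - y)\<bar> * \<bar>f (y, t)\<bar> \<le> 1 / \<rho> ^ 3 * \<bar>f (y, t)\<bar>"
          by (intro mult_right_mono ball_pot_hess_abs_le \<open>\<rho> > 0\<close>) auto
        then show "norm (ball_pot_hess \<rho> i j (x - y) * f (y, t)) \<le> norm (1 / \<rho> ^ 3 * \<bar>f (y, t)\<bar>)"
          using \<open>\<rho> > 0\<close> by (simp add: abs_mult)
      qed
    qed measurable
    then have k1: "integrable lborel (\<lambda>y. Kern i j (x - y) * f (y, t))" by (simp only: eq)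
    have "conv (ball_pot_hess \<rho> i j) f (x, t) = (LINT y|lborel. Kern i j (x - y) * f (y, t)) - Kern i j x * (LINT y|lborel. f (y, t))"
      by (simp add: conv_reflect eq mean)
    also have "\<dots> = (LINT y|lborel. (Kern i j (x - y) - Kern i j x) * f (y, t))"
      using k1 f1 by (simp add: left_diff_distrib)
    also have "\<bar>\<dots>\<bar> \<le> (LINT y|lborel. 568 * r / norm x ^ 4 * \<bar>f (y, t)\<bar>)"
    proof (rule abs_integral_le)
      show "integrable lborel (\<lambda>y. 568 * r / norm x ^ 4 * \<bar>f (y, t)\<bar>)" by (intro integrable_mult_right J)
      show "\<bar>(Kern i j (x - y) - Kern i j x) * f (y, t)\<bar> \<le> 568 * r / norm x ^ 4 * \<bar>f (y, t)\<bar>" for y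
      proof (cases "f (y, t) = 0")
        case False
        then have y: "norm y \<le> r" using r(2)[OF False] norm_fst_le[of y t] by linarith
        then have "2 * norm y \<le> norm x" using x \<rho> by linarith
        from Kern_diff_le[OF \<open>x \<noteq> 0\<close> this]
        have "\<bar>Kern i j (x - y) - Kern i j x\<bar> \<le> 568 * norm y / norm x ^ 4" .
        also have "\<dots> \<le> 568 * r / norm x ^ 4" using y by (intro divide_right_mono) auto
        finally show ?thesis unfolding abs_mult by (intro mult_right_mono) auto
      qed simp
    qed measurable
    also have "\<dots> = 568 * r / norm x ^ 4 * (LINT y|lborel. \<bar>f (y, t)\<bar>)" by simp
    also have "\<dots> \<le> 568 * r / norm x ^ 4 * J" using J(2)[of t] r(1) by (intro mult_left_mono) auto
    also have "\<dots> = 568 * r * J * 16 * (1 / (2 * norm x) ^ 4)"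
      by (simp add: power_mult_distrib)
    also have "\<dots> \<le> C * (1 / (1 + norm x) ^ 4)"
    proof (intro mult_mono C divide_left_mono power_mono)
      show "0 < (2 * norm x) ^ 4 * (1 + norm x) ^ 4"
        using \<open>norm x \<ge> 1\<close> by (intro mult_pos_pos zero_less_power) linarith+
    qed (use \<open>norm x \<ge> 1\<close> C in auto)
    finally show "\<bar>conv (ball_pot_hess \<rho> i j) f (x, t)\<bar> \<le> C * weight (x, t)" by (simp add: weight_def)
  qed
  then show ?thesis
    using C(1) r(1) by (intro exI[of _ C] conjI exI[of _ r]) auto
qed

text \<open>The slices of \<open>f\<close> have integrals bounded uniformly in time, and the density
  is at most \<open>1 / \<rho> ^ 3\<close>. For \<open>\<rho> > r\<close> the spatial support has
  radius at most \<open>r + \<rho>\<close>, less than \<open>2 * \<rho>\<close>. The bound in time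
  keeps the volume of the space-time support of order \<open>\<rho> ^ 3\<close>.\<close>

lemma conv_ball_avg_bounds:
  assumes f: "f \<in> test_fun \<Omega>"
  shows "\<exists>C>0. \<exists>r\<ge>1. \<forall>\<rho>>r. \<forall>z. \<bar>conv (ball_avg \<rho>) f z\<bar> \<le> C / \<rho> ^ 3 \<and>
    (conv (ball_avg \<rho>) f z \<noteq> 0 \<longrightarrow> norm (fst z) < 2 * \<rho> \<and> \<bar>snd z\<bar> \<le> r)"
proof -
  obtain M where M: "M > 0" "\<forall>z. \<bar>f z\<bar> \<le> M" using test_fun_bounded[OF f] by blast
  obtain r0 where r0: "r0 > 0" "\<forall>z. f z \<noteq> 0 \<longrightarrow> norm z \<le> r0" using test_fun_support_bounded[OF f] by blast
  define r where "r = max r0 1"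
  have r: "r \<ge> 1" "\<And>z. f z \<noteq> 0 \<Longrightarrow> norm z \<le> r" using r0 by (auto simp: r_def le_max_iff_disj)
  have [measurable]: "f \<in> borel_measurable borel" using f by (rule test_fun_measurable)
  define J where "J = M * measure lborel (cball (0::space) r)"
  have J: "integrable lborel (\<lambda>y. \<bar>f (y, t)\<bar>)" "(LINT y|lborel. \<bar>f (y, t)\<bar>) \<le> J" for t
    using integral_abs_slice_le[of f M r t] M r(2) by (auto simp: J_def)
  have "J \<ge> 0" using M(1) by (simp add: J_def)
  have "\<bar>conv (ball_avg \<rho>) f (x, t)\<bar> \<le> (1 + J) / \<rho> ^ 3 \<and>
     (conv (ball_avg \<rho>) f (x, t) \<noteq> 0 \<longrightarrow> norm x < 2 * \<rho> \<and> \<bar>t\<bar> \<le> r)" if \<rho>: "\<rho> > r" for \<rho> x t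
  proof (intro conjI impI)
    have "\<rho> > 0" using \<rho> r(1) by simp
    have avg: "\<bar>ball_avg \<rho> y\<bar> \<le> 1 / \<rho> ^ 3" for y
    proof -
      have "3 / (4 * pi * \<rho> ^ 3) = 3 / (4 * pi) * (1 / \<rho> ^ 3)" by simp
      also have "\<dots> \<le> 1 * (1 / \<rho> ^ 3)" using pi_gt3 \<open>\<rho> > 0\<close> by (intro mult_right_mono) auto
      finally show ?thesis using \<open>\<rho> > 0\<close> by (simp add: ball_avg_def)
    qed
    have "\<bar>conv (ball_avg \<rho>) f (x, t)\<bar> \<le> 1 / \<rho> ^ 3 * (LINT y|lborel. \<bar>f (y, t)\<bar>)"
      using avg by (intro conv_abs_le J) auto
    also have "\<dots> \<le> 1 / \<rho> ^ 3 * (1 + J)"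
      using J(2)[of t] \<open>\<rho> > 0\<close> by (intro mult_left_mono) auto
    finally show "\<bar>conv (ball_avg \<rho>) f (x, t)\<bar> \<le> (1 + J) / \<rho> ^ 3" by simp
    assume "conv (ball_avg \<rho>) f (x, t) \<noteq> 0"
    then obtain y where y: "f ((x, t) - (y, 0)) \<noteq> 0" "ball_avg \<rho> y \<noteq> 0"
      using conv_eq_0[of f "(x, t)" "ball_avg \<rho>"] by blast
    have "norm (x - y, t) \<le> r" using r(2)[OF y(1)] by simp
    then have "norm (x - y) \<le> r" "norm t \<le> r"
      using norm_fst_le[of "x - y" t] norm_snd_le[of t "x - y"] by linarith+
    moreover have "norm y \<le> \<rho>" using y(2) by (rule ball_avg_support)
    ultimately show "norm x < 2 * \<rho>" "\<bar>t\<bar> \<le> r"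
      using \<rho> norm_triangle_ineq[of "x - y" y] by auto
  qed
  then show ?thesis
    using \<open>J \<ge> 0\<close> r(1) by (intro exI[of _ "1 + J"] conjI exI[of _ r]) auto
qed

context decaying_field
begin

text \<open>Within radius \<open>2 * \<rho>\<close> the kernel is of order
  \<open>1 / \<rho> ^ 3\<close>, and the decay of the energy is exactly what makes the product
  small. Beyond that radius the mean zero bound by \<open>weight\<close> leaves the tail of a
  convergent integral.\<close>

lemma hess_term:
  assumes f: "f \<in> test_fun \<Omega>" and mean: "\<And>t. (LINT y|lborel. f (y, t)) = 0"
  shows "\<exists>r>0. \<forall>\<rho>>r. integrable lborel (\<lambda>z. v z $ i * v z $ j * conv (ball_pot_hess \<rho> i j) f z) \<and>
      (\<exists>B. \<forall>z. \<bar>conv (ball_pot_hess \<rho> i j) f z\<bar> \<le> B * weight z)"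
    and "((\<lambda>\<rho>. LINT z|lborel. v z $ i * v z $ j * conv (ball_pot_hess \<rho> i j) f z) \<longlongrightarrow> 0) at_top"
proof -
  have [measurable]: "f \<in> borel_measurable borel" using f by (rule test_fun_measurable)
  obtain C r where C: "C > 0" and r: "r \<ge> 1" and
    bd: "\<And>\<rho> z. \<rho> > r \<Longrightarrow> \<bar>conv (ball_pot_hess \<rho> i j) f z\<bar> \<le> C / \<rho> ^ 3"
    "\<And>\<rho> z. \<rho> > r \<Longrightarrow> 2 * \<rho> \<le> norm (fst z) \<Longrightarrow> \<bar>conv (ball_pot_hess \<rho> i j) f z\<bar> \<le> C * weight z"
    using conv_ball_pot_hess_bounds[OF f mean] by metis
  have wb: "\<exists>B. \<forall>z. \<bar>conv (ball_pot_hess \<rho> i j) f z\<bar> \<le> B * weight z" if \<rho>: "\<rho> > r" for \<rho>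
  proof (intro exI allI)
    fix z
    \<comment> \<open>The factor \<open>(1 + 2 * \<rho>) ^ 4\<close> compensates the lower bound of
      \<open>weight\<close> on the ball of radius \<open>2 * \<rho>\<close>.\<close>
    let ?B = "C / \<rho> ^ 3 * (1 + 2 * \<rho>) ^ 4"
    have "0 \<le> ?B" using C r \<rho> by simp
    show "\<bar>conv (ball_pot_hess \<rho> i j) f z\<bar> \<le> (?B + C) * weight z"
    proof (cases "2 * \<rho> \<le> norm (fst z)")
      case True
      have "C * weight z \<le> (?B + C) * weight z"
        using weight_pos[of z] \<open>0 \<le> ?B\<close> by (intro mult_right_mono) auto
      then show ?thesis using bd(2)[OF \<rho> True] by linarith
    next
      case False
      then have "1 / (1 + 2 * \<rho>) ^ 4 \<le> weight z" by (intro weight_ge) auto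
      then have "?B * (1 / (1 + 2 * \<rho>) ^ 4) \<le> ?B * weight z" using \<open>0 \<le> ?B\<close> by (intro mult_left_mono)
      moreover have "?B * (1 / (1 + 2 * \<rho>) ^ 4) = C / \<rho> ^ 3" using r \<rho> by simp
      ultimately have "C / \<rho> ^ 3 \<le> ?B * weight z" by simp
      also have "\<dots> \<le> (?B + C) * weight z"
        using weight_pos[of z] C by (intro mult_right_mono) auto
      finally show ?thesis using bd(1)[OF \<rho>, of z] by linarith
    qed
  qed
  then have int: "integrable lborel (\<lambda>z. v z $ i * v z $ j * conv (ball_pot_hess \<rho> i j) f z)" if "\<rho> > r" for \<rho>
    using wb[OF that] by (auto intro!: integrable_vv)
  show "\<exists>r>0. \<forall>\<rho>>r. integrable lborel (\<lambda>z. v z $ i * v z $ j * conv (ball_pot_hess \<rho> i j) f z) \<and>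
      (\<exists>B. \<forall>z. \<bar>conv (ball_pot_hess \<rho> i j) f z\<bar> \<le> B * weight z)"
    using int wb r by (intro exI[of _ r]) auto
  let ?tail = "\<lambda>\<rho>. LINT z|lborel. (if 2 * \<rho> \<le> norm (fst z) then (norm (v z))\<^sup>2 * weight z else 0)"
  have bnd: "\<bar>LINT z|lborel. v z $ i * v z $ j * conv (ball_pot_hess \<rho> i j) f z\<bar> \<le> C * (energy (2 * \<rho>) / \<rho> ^ 3) + C * ?tail \<rho>"
    if \<rho>: "\<rho> > r" for \<rho>
  proof -
    have it: "integrable lborel (\<lambda>z. if 2 * \<rho> \<le> norm (fst z) then (norm (v z))\<^sup>2 * weight z else 0)"
      by (rule Bochner_Integration.integrable_bound[OF integrable_weighted]) (auto intro!: AE_I2)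
    have "\<bar>LINT z|lborel. v z $ i * v z $ j * conv (ball_pot_hess \<rho> i j) f z\<bar>
      \<le> (LINT z|lborel. C / \<rho> ^ 3 * (if norm (fst z) < 2 * \<rho> then (norm (v z))\<^sup>2 else 0)
            + C * (if 2 * \<rho> \<le> norm (fst z) then (norm (v z))\<^sup>2 * weight z else 0))"
    proof (rule abs_integral_le)
      show "integrable lborel (\<lambda>z. C / \<rho> ^ 3 * (if norm (fst z) < 2 * \<rho> then (norm (v z))\<^sup>2 else 0)
            + C * (if 2 * \<rho> \<le> norm (fst z) then (norm (v z))\<^sup>2 * weight z else 0))"
        by (intro Bochner_Integration.integrable_add integrable_mult_right integrable_ball it)
      fix z
      show "\<bar>v z $ i * v z $ j * conv (ball_pot_hess \<rho> i j) f z\<bar> \<le>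
        C / \<rho> ^ 3 * (if norm (fst z) < 2 * \<rho> then (norm (v z))\<^sup>2 else 0)
            + C * (if 2 * \<rho> \<le> norm (fst z) then (norm (v z))\<^sup>2 * weight z else 0)"
      proof (cases "2 * \<rho> \<le> norm (fst z)")
        case True
        have "\<bar>v z $ i * v z $ j\<bar> * \<bar>conv (ball_pot_hess \<rho> i j) f z\<bar> \<le> (norm (v z))\<^sup>2 * (C * weight z)"
          by (intro mult_mono abs_component_mult_le bd(2) \<rho> True) auto
        then show ?thesis using True by (simp add: abs_mult mult_ac)
      next
        case False
        have "\<bar>v z $ i * v z $ j\<bar> * \<bar>conv (ball_pot_hess \<rho> i j) f z\<bar> \<le> (norm (v z))\<^sup>2 * (C / \<rho> ^ 3)"
          by (intro mult_mono abs_component_mult_le bd(1) \<rho>) auto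
        then show ?thesis using False by (simp add: abs_mult mult_ac)
      qed
    qed measurable
    also have "\<dots> = C / \<rho> ^ 3 * energy (2 * \<rho>) + C * ?tail \<rho>"
      unfolding energy_def
      by (simp only: Bochner_Integration.integral_add[OF integrable_mult_right[OF integrable_ball] integrable_mult_right[OF it]]
          integral_mult_right_zero)
    finally show ?thesis by simp
  qed
  have ev: "\<forall>\<^sub>F \<rho> in at_top. norm (LINT z|lborel. v z $ i * v z $ j * conv (ball_pot_hess \<rho> i j) f z)
      \<le> C * (energy (2 * \<rho>) / \<rho> ^ 3) + C * ?tail \<rho>"
    unfolding real_norm_def by (rule eventually_mono[OF eventually_gt_at_top[of r]]) (rule bnd)
  have "((\<lambda>\<rho>. C * (energy (2 * \<rho>) / \<rho> ^ 3) + C * ?tail \<rho>) \<longlongrightarrow> C * 0 + C * 0) at_top"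
    by (intro tendsto_intros energy_scaled tail_tendsto)
  then show "((\<lambda>\<rho>. LINT z|lborel. v z $ i * v z $ j * conv (ball_pot_hess \<rho> i j) f z) \<longlongrightarrow> 0) at_top"
    by (intro Lim_null_comparison[OF ev]) simp
qed

lemma avg_quadratic_term:
  assumes f: "f \<in> test_fun \<Omega>"
  shows "((\<lambda>\<rho>. LINT z|lborel. v z $ i * v z $ j * conv (ball_avg \<rho>) f z) \<longlongrightarrow> 0) at_top"
proof -
  have [measurable]: "f \<in> borel_measurable borel" using f by (rule test_fun_measurable)
  obtain C r where C: "C > 0" and r: "r \<ge> 1" and
    bd: "\<And>\<rho> z. \<rho> > r \<Longrightarrow> \<bar>conv (ball_avg \<rho>) f z\<bar> \<le> C / \<rho> ^ 3"
    "\<And>\<rho> z. \<rho> > r \<Longrightarrow> conv (ball_avg \<rho>) f z \<noteq> 0 \<Longrightarrow> norm (fst z) < 2 * \<rho>"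
    using conv_ball_avg_bounds[OF f] by metis
  have bnd: "\<bar>LINT z|lborel. v z $ i * v z $ j * conv (ball_avg \<rho>) f z\<bar> \<le> C * (energy (2 * \<rho>) / \<rho> ^ 3)"
    if \<rho>: "\<rho> > r" for \<rho>
  proof -
    have "\<bar>LINT z|lborel. v z $ i * v z $ j * conv (ball_avg \<rho>) f z\<bar>
      \<le> (LINT z|lborel. C / \<rho> ^ 3 * (if norm (fst z) < 2 * \<rho> then (norm (v z))\<^sup>2 else 0))"
    proof (rule abs_integral_le)
      fix z
      have "\<bar>v z $ i * v z $ j\<bar> * \<bar>conv (ball_avg \<rho>) f z\<bar> \<le> (norm (v z))\<^sup>2 * (C / \<rho> ^ 3)"
        by (intro mult_mono abs_component_mult_le bd(1) \<rho>) auto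
      then show "\<bar>v z $ i * v z $ j * conv (ball_avg \<rho>) f z\<bar> \<le>
        C / \<rho> ^ 3 * (if norm (fst z) < 2 * \<rho> then (norm (v z))\<^sup>2 else 0)"
        using bd(2)[OF \<rho>, of z] by (cases "conv (ball_avg \<rho>) f z = 0") (use C r \<rho> in \<open>auto simp: abs_mult mult_ac\<close>)
    qed (intro integrable_mult_right integrable_ball, measurable)
    also have "\<dots> = C / \<rho> ^ 3 * energy (2 * \<rho>)"
      unfolding energy_def by (rule integral_mult_right_zero)
    finally show ?thesis by simp
  qed
  have ev: "\<forall>\<^sub>F \<rho> in at_top. norm (LINT z|lborel. v z $ i * v z $ j * conv (ball_avg \<rho>) f z)
      \<le> C * (energy (2 * \<rho>) / \<rho> ^ 3)"
    unfolding real_norm_def by (rule eventually_mono[OF eventually_gt_at_top[of r]]) (rule bnd)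
  have "((\<lambda>\<rho>. C * (energy (2 * \<rho>) / \<rho> ^ 3)) \<longlongrightarrow> C * 0) at_top"
    by (intro tendsto_intros energy_scaled)
  then show ?thesis by (intro Lim_null_comparison[OF ev]) simp
qed

text \<open>The size of \<open>v\<close> is split by
  \<open>norm (v z) \<le> e + (norm (v z))\<^sup>2 / e\<close>. The first part contributes a
  multiple of \<open>e\<close> uniformly in \<rho>, since volume and normalisation cancel; the
  second tends to 0 for fixed \<open>e\<close> by the decay of the energy.\<close>

lemma avg_linear_term:
  assumes f: "f \<in> test_fun \<Omega>"
  shows "((\<lambda>\<rho>. LINT z|lborel. v z $ i * conv (ball_avg \<rho>) f z) \<longlongrightarrow> 0) at_top"
proof -
  have [measurable]: "f \<in> borel_measurable borel" using f by (rule test_fun_measurable)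
  obtain C r where C: "C > 0" and r: "r \<ge> 1" and
    bd: "\<And>\<rho> z. \<rho> > r \<Longrightarrow> \<bar>conv (ball_avg \<rho>) f z\<bar> \<le> C / \<rho> ^ 3"
    "\<And>\<rho> z. \<rho> > r \<Longrightarrow> conv (ball_avg \<rho>) f z \<noteq> 0 \<Longrightarrow> norm (fst z) < 2 * \<rho> \<and> \<bar>snd z\<bar> \<le> r"
    using conv_ball_avg_bounds[OF f] by metis
  let ?I = "\<lambda>\<rho>. LINT z|lborel. v z $ i * conv (ball_avg \<rho>) f z"
  have bound: "\<bar>?I \<rho>\<bar> \<le> 64 / 3 * pi * r * C * e + C / e * (energy (2 * \<rho>) / \<rho> ^ 3)"
    if \<rho>: "\<rho> > r" and e: "e > 0" for \<rho> e
  proof -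
    have \<rho>0: "\<rho> > 0" using \<rho> r by simp
    \<comment> \<open>A ball of radius \<open>2 * \<rho>\<close> times an interval of length
      \<open>2 * r\<close>: the volume has the factor 4/3 times 8 times 2, that is 64/3.\<close>
    let ?A = "ball (0::space) (2 * \<rho>) \<times> {-r..r}"
    have mA: "?A \<in> sets (lborel \<Otimes>\<^sub>M lborel)" by simp
    have emA: "emeasure lborel ?A = ennreal (64 / 3 * pi * r * \<rho> ^ 3)"
    proof -
      have "emeasure lborel ?A = emeasure (lborel \<Otimes>\<^sub>M lborel) ?A" by (simp only: lborel_prod)
      also have "\<dots> = emeasure lborel (ball (0::space) (2 * \<rho>)) * emeasure lborel {-r..r}"
        by (rule lborel.emeasure_pair_measure_Times) auto
      also have "\<dots> = ennreal (64 / 3 * pi * r * \<rho> ^ 3)"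
        using r \<rho>0 by (simp add: emeasure_ball unit_ball_vol_3 ennreal_mult'[symmetric] power_mult_distrib mult_ac)
      finally show ?thesis .
    qed
    have sA: "?A \<in> sets lborel" using mA by (simp only: lborel_prod)
    have iA: "integrable lborel (indicator ?A :: spacetime \<Rightarrow> real)"
      using sA emA by simp
    have LA: "(LINT z|lborel. indicator ?A z) = 64 / 3 * pi * r * \<rho> ^ 3"
      using sA emA r \<rho>0 by (simp add: measure_def)
    have "\<bar>?I \<rho>\<bar> \<le> (LINT z|lborel. C / \<rho> ^ 3 * e * indicator ?A z
        + C / \<rho> ^ 3 / e * (if norm (fst z) < 2 * \<rho> then (norm (v z))\<^sup>2 else 0))"
    proof (rule abs_integral_le)
      fix z
      show "\<bar>v z $ i * conv (ball_avg \<rho>) f z\<bar> \<le> C / \<rho> ^ 3 * e * indicator ?A z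
        + C / \<rho> ^ 3 / e * (if norm (fst z) < 2 * \<rho> then (norm (v z))\<^sup>2 else 0)"
      proof (cases "conv (ball_avg \<rho>) f z = 0")
        case False
        then have z: "norm (fst z) < 2 * \<rho>" "\<bar>snd z\<bar> \<le> r" using bd(2)[OF \<rho>] by auto
        then have zA: "z \<in> ?A" by (cases z) (auto simp: dist_norm)
        have "\<bar>v z $ i\<bar> \<le> e + (norm (v z))\<^sup>2 / e"
        proof -
          have "\<bar>v z $ i\<bar> \<le> norm (v z)" by (rule component_le_norm_cart)
          also have "norm (v z) \<le> e + (norm (v z))\<^sup>2 / e"
          proof (cases "norm (v z) \<le> e")
            case True
            moreover have "0 \<le> (norm (v z))\<^sup>2 / e" using e by simp
            ultimately show ?thesis by linarith
          next
            case False
            then have "norm (v z) * e \<le> (norm (v z))\<^sup>2" by (simp add: power2_eq_square mult_left_mono)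
            then have "norm (v z) \<le> (norm (v z))\<^sup>2 / e" using e by (simp add: pos_le_divide_eq)
            then show ?thesis using e by linarith
          qed
          finally show ?thesis .
        qed
        then have "\<bar>v z $ i\<bar> * \<bar>conv (ball_avg \<rho>) f z\<bar> \<le> (e + (norm (v z))\<^sup>2 / e) * (C / \<rho> ^ 3)"
          using e by (intro mult_mono bd(1) \<rho>) auto
        also have "\<dots> = C / \<rho> ^ 3 * e * indicator ?A z
            + C / \<rho> ^ 3 / e * (if norm (fst z) < 2 * \<rho> then (norm (v z))\<^sup>2 else 0)"
          using zA z(1) by (simp add: algebra_simps)
        finally show ?thesis by (simp only: abs_mult)
      qed (use C \<rho>0 e in simp)
      show "integrable lborel (\<lambda>z. C / \<rho> ^ 3 * e * indicator ?A z
        + C / \<rho> ^ 3 / e * (if norm (fst z) < 2 * \<rho> then (norm (v z))\<^sup>2 else 0))"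
        by (intro Bochner_Integration.integrable_add integrable_mult_right integrable_ball iA)
    qed measurable
    also have "\<dots> = C / \<rho> ^ 3 * e * (64 / 3 * pi * r * \<rho> ^ 3) + C / \<rho> ^ 3 / e * energy (2 * \<rho>)"
      unfolding energy_def
      by (simp only: Bochner_Integration.integral_add[OF integrable_mult_right[OF iA] integrable_mult_right[OF integrable_ball]]
          integral_mult_right_zero LA)
    also have "\<dots> = 64 / 3 * pi * r * C * e + C / e * (energy (2 * \<rho>) / \<rho> ^ 3)"
      using \<rho>0 by (simp add: mult_ac)
    finally show ?thesis .
  qed
  show ?thesis
  proof (rule tendstoI)
    fix d :: real assume "d > 0"
    \<comment> \<open>Half of \<open>d\<close> is spent on the part proportional to
      \<open>e\<close>, the other half on the part that tends to 0.\<close>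
    define e where "e = d / (2 * (64 / 3 * pi * r * C))"
    have e: "e > 0" and ed: "64 / 3 * pi * r * C * e = d / 2"
      using \<open>d > 0\<close> C r by (simp_all add: e_def)
    have "((\<lambda>\<rho>. C / e * (energy (2 * \<rho>) / \<rho> ^ 3)) \<longlongrightarrow> C / e * 0) at_top"
      by (intro tendsto_intros energy_scaled)
    then have "\<forall>\<^sub>F \<rho> in at_top. C / e * (energy (2 * \<rho>) / \<rho> ^ 3) < d / 2"
      using \<open>d > 0\<close> by (intro order_tendstoD(2)) auto
    then show "\<forall>\<^sub>F \<rho> in at_top. dist (?I \<rho>) 0 < d"
      using eventually_gt_at_top[of r]
    proof eventually_elim
      case (elim \<rho>)
      then show ?case using bound[OF elim(2) e] ed by simp
    qed
  qed
qed

end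

section \<open>The pressure away from the harmonic part\<close>

lemma test_fun_commute:
  fixes \<phi> :: "'a::euclidean_space \<Rightarrow> real"
  assumes "\<phi> \<in> test_fun \<Omega>"
  shows "dir_deriv v (dir_deriv w \<phi>) = dir_deriv w (dir_deriv v \<phi>)"
  by (rule ext) (rule test_fun_dir_deriv_commute[OF assms])

text \<open>Integration by parts against the constant kernel 1, whose derivative is 0.\<close>

lemma integral_spatial_dir_deriv_0:
  fixes f :: "'a::euclidean_space \<times> 'b::euclidean_space \<Rightarrow> real"
  assumes f: "f \<in> test_fun \<Omega>"
  shows "(LINT y|lborel. dir_deriv (e, 0) f (y, t)) = 0"
proof -
  have m: "dir_deriv (e, 0) f \<in> borel_measurable borel"
    using test_fun_dir_deriv[OF f] by (rule test_fun_measurable)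
  have "conv (\<lambda>_. 1) (dir_deriv (e, 0) f) (0, t) = conv (\<lambda>_. 0) f (0, t)"
    by (rule conv_by_parts[OF f lipschitz_on_constant]) auto
  then show ?thesis
    using conv_reflect[OF _ m, of "\<lambda>_. 1" 0 t] by (simp add: conv_def)
qed

lemma conv_sum:
  assumes "\<And>i. i \<in> I \<Longrightarrow> integrable lborel (\<lambda>y. k y * f i (z - (y, 0)))"
  shows "conv k (\<lambda>z. \<Sum>i\<in>I. f i z) z = (\<Sum>i\<in>I. conv k (f i) z)"
  unfolding conv_def using assms by (simp add: sum_distrib_left)

text \<open>The distributional equations with all derivatives moved to the test function and the
  pressure term isolated. First-order terms change sign once and the Laplacian twice, so all three
  terms on the right carry a minus.\<close>

locale weak_NSE = decaying_field +
  fixes p :: "(spacetime \<Rightarrow> real) \<Rightarrow> real" and I :: "real set"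
  assumes p_lincomb: "\<And>\<phi> \<psi> a b. \<phi> \<in> test_fun (UNIV \<times> I) \<Longrightarrow> \<psi> \<in> test_fun (UNIV \<times> I) \<Longrightarrow>
      p (\<lambda>z. a * \<phi> z + b * \<psi> z) = a * p \<phi> + b * p \<psi>"
    and momentum: "\<And>\<phi> k. \<phi> \<in> test_fun (UNIV \<times> I) \<Longrightarrow>
      p (dir_deriv (e_x k) \<phi>) = - (LINT z|lborel. v z $ k * dir_deriv e_t \<phi> z)
        - (\<Sum>j\<in>UNIV. LINT z|lborel. v z $ k * dir_deriv (e_x j) (dir_deriv (e_x j) \<phi>) z)
        - (\<Sum>j\<in>UNIV. LINT z|lborel. v z $ j * v z $ k * dir_deriv (e_x j) \<phi> z)"
    and div_free: "\<And>\<phi>. \<phi> \<in> test_fun (UNIV \<times> I) \<Longrightarrow>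
      (\<Sum>j\<in>UNIV. LINT z|lborel. v z $ j * dir_deriv (e_x j) \<phi> z) = 0"
begin

lemma p_sum:
  assumes "finite J" "J \<noteq> {}" "\<And>i. i \<in> J \<Longrightarrow> f i \<in> test_fun (UNIV \<times> I)"
  shows "p (\<lambda>z. \<Sum>i\<in>J. f i z) = (\<Sum>i\<in>J. p (f i))"
  using assms
proof (induction rule: finite_ne_induct)
  case (insert i J)
  have J: "(\<lambda>z. \<Sum>i\<in>J. f i z) \<in> test_fun (UNIV \<times> I)" and fi: "f i \<in> test_fun (UNIV \<times> I)"
    using insert.hyps insert.prems by (auto intro!: test_fun_sum)
  have "p (\<lambda>z. \<Sum>i\<in>insert i J. f i z) = p (\<lambda>z. 1 * f i z + 1 * (\<Sum>i\<in>J. f i z))"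
    using insert.hyps by simp
  also have "\<dots> = p (f i) + p (\<lambda>z. \<Sum>i\<in>J. f i z)"
    using p_lincomb[OF fi J, of 1 1] by simp
  also have "p (\<lambda>z. \<Sum>i\<in>J. f i z) = (\<Sum>i\<in>J. p (f i))"
    using insert.IH insert.prems by simp
  finally show ?case using insert.hyps by simp
qed simp

text \<open>Testing the momentum equation with the gradient of \<open>conv (newton_diff \<rho>) f\<close>: the linear terms
  vanish since the field is divergence free.\<close>

lemma pressure_eq:
  assumes f: "f \<in> test_fun (UNIV \<times> I)" and \<rho>: "\<rho> > 0"
  shows "p f = p (conv (ball_avg \<rho>) f)
     + (\<Sum>l\<in>UNIV. \<Sum>j\<in>UNIV. LINT z|lborel. v z $ j * v z $ l *
          conv (newton_diff \<rho>) (dir_deriv (e_x j) (dir_deriv (e_x l) f)) z)"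
proof -
  define \<Phi> where "\<Phi> = conv (newton_diff \<rho>) f"
  note nd = integrable_newton_diff[OF \<rho>]
  have \<Phi>: "\<Phi> \<in> test_fun (UNIV \<times> I)"
    unfolding \<Phi>_def by (rule test_fun_conv[OF nd newton_diff_support f])
  have avg: "conv (ball_avg \<rho>) f \<in> test_fun (UNIV \<times> I)"
    by (rule test_fun_conv[OF integrable_ball_avg ball_avg_support f])
  note d\<Phi> = test_fun_dir_deriv[OF \<Phi>]
  have dd: "dir_deriv v (dir_deriv w \<Phi>) = conv (newton_diff \<rho>) (dir_deriv v (dir_deriv w f))" for v w
    unfolding \<Phi>_def by (simp only: dir_deriv_conv[OF nd f] dir_deriv_conv[OF nd test_fun_dir_deriv[OF f]])
  have lap: "(\<lambda>z. \<Sum>l\<in>UNIV. dir_deriv (e_x l) (dir_deriv (e_x l) \<Phi>) z)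
      = (\<lambda>z. 1 * conv (ball_avg \<rho>) f z + (- 1) * f z)"
    unfolding dd by (rule ext) (simp add: conv_newton_diff_laplacian[OF f \<rho>])
  have "p (conv (ball_avg \<rho>) f) - p f = p (\<lambda>z. 1 * conv (ball_avg \<rho>) f z + (- 1) * f z)"
    using p_lincomb[OF avg f, of 1 "-1"] by simp
  also have "\<dots> = (\<Sum>l\<in>UNIV. p (dir_deriv (e_x l) (dir_deriv (e_x l) \<Phi>)))"
    unfolding lap[symmetric] by (rule p_sum) (auto intro: test_fun_dir_deriv \<Phi>)
  also have "\<dots> = - (\<Sum>l\<in>UNIV. LINT z|lborel. v z $ l * dir_deriv e_t (dir_deriv (e_x l) \<Phi>) z)
        - (\<Sum>l\<in>UNIV. \<Sum>j\<in>UNIV. LINT z|lborel. v z $ l * dir_deriv (e_x j) (dir_deriv (e_x j) (dir_deriv (e_x l) \<Phi>)) z)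
        - (\<Sum>l\<in>UNIV. \<Sum>j\<in>UNIV. LINT z|lborel. v z $ j * v z $ l * dir_deriv (e_x j) (dir_deriv (e_x l) \<Phi>) z)"
    by (simp only: momentum[OF d\<Phi>] sum_subtractf sum_negf)
  \<comment> \<open>Derivatives commute, so this is the divergence condition tested with the time
    derivative of \<Phi>. The viscous term below is treated in the same way, with second spatial
    derivatives of \<Phi>.\<close>
  also have "(\<Sum>l\<in>UNIV. LINT z|lborel. v z $ l * dir_deriv e_t (dir_deriv (e_x l) \<Phi>) z) = 0"
    unfolding test_fun_commute[OF \<Phi>, of e_t] by (rule div_free[OF d\<Phi>])
  also have "(\<Sum>l\<in>UNIV. \<Sum>j\<in>UNIV. LINT z|lborel. v z $ l * dir_deriv (e_x j) (dir_deriv (e_x j) (dir_deriv (e_x l) \<Phi>)) z)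
      = (\<Sum>j\<in>UNIV. \<Sum>l\<in>UNIV. LINT z|lborel. v z $ l * dir_deriv (e_x l) (dir_deriv (e_x j) (dir_deriv (e_x j) \<Phi>)) z)"
  proof (subst sum.swap, intro sum.cong refl)
    fix j l
    have "dir_deriv (e_x j) (dir_deriv (e_x j) (dir_deriv (e_x l) \<Phi>)) = dir_deriv (e_x l) (dir_deriv (e_x j) (dir_deriv (e_x j) \<Phi>))"
      by (subst test_fun_commute[OF \<Phi>]) (rule test_fun_commute[OF d\<Phi>])
    then show "(LINT z|lborel. v z $ l * dir_deriv (e_x j) (dir_deriv (e_x j) (dir_deriv (e_x l) \<Phi>)) z)
        = (LINT z|lborel. v z $ l * dir_deriv (e_x l) (dir_deriv (e_x j) (dir_deriv (e_x j) \<Phi>)) z)"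
      by (simp only:)
  qed
  also have "\<dots> = 0"
    by (simp only: div_free[OF test_fun_dir_deriv[OF d\<Phi>]] sum.neutral_const)
  finally show ?thesis unfolding dd by simp
qed

text \<open>Convolution commutes with differentiation, so every derivative of the momentum equation
  can be left on \<psi>. What remains are averages of fixed test functions, to which the linear and
  quadratic limits apply.\<close>

lemma pressure_avg_tendsto:
  assumes \<psi>: "\<And>k. \<psi> k \<in> test_fun (UNIV \<times> I)"
  shows "((\<lambda>\<rho>. p (conv (ball_avg \<rho>) (\<lambda>z. \<Sum>k\<in>(UNIV :: 3 set). dir_deriv (e_x k) (\<psi> k) z))) \<longlongrightarrow> 0) at_top"
proof -
  note av = integrable_ball_avg
  note d\<psi> = test_fun_dir_deriv[OF \<psi>]
  have eq: "p (conv (ball_avg \<rho>) (\<lambda>z. \<Sum>k\<in>UNIV. dir_deriv (e_x k) (\<psi> k) z))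
     = (\<Sum>k\<in>UNIV. - (LINT z|lborel. v z $ k * conv (ball_avg \<rho>) (dir_deriv e_t (\<psi> k)) z)
        - (\<Sum>j\<in>UNIV. LINT z|lborel. v z $ k * conv (ball_avg \<rho>) (dir_deriv (e_x j) (dir_deriv (e_x j) (\<psi> k))) z)
        - (\<Sum>j\<in>UNIV. LINT z|lborel. v z $ j * v z $ k * conv (ball_avg \<rho>) (dir_deriv (e_x j) (\<psi> k)) z))" for \<rho>
  proof -
    have avg: "conv (ball_avg \<rho>) (\<psi> k) \<in> test_fun (UNIV \<times> I)" for k
      by (rule test_fun_conv[OF av ball_avg_support \<psi>])
    have int: "integrable lborel (\<lambda>y. ball_avg \<rho> y * g (z - (y, 0)))" if g: "g \<in> test_fun (UNIV \<times> I)" for g and z :: spacetime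
    proof -
      obtain M where "\<forall>z. \<bar>g z\<bar> \<le> M" using test_fun_bounded[OF g] by blast
      then show ?thesis by (intro integrable_conv[OF av test_fun_measurable[OF g]]) auto
    qed
    have "conv (ball_avg \<rho>) (\<lambda>z. \<Sum>k\<in>UNIV. dir_deriv (e_x k) (\<psi> k) z)
        = (\<lambda>z. \<Sum>k\<in>UNIV. dir_deriv (e_x k) (conv (ball_avg \<rho>) (\<psi> k)) z)"
      unfolding dir_deriv_conv[OF av \<psi>] by (rule ext, rule conv_sum) (rule int[OF d\<psi>])
    then have "p (conv (ball_avg \<rho>) (\<lambda>z. \<Sum>k\<in>UNIV. dir_deriv (e_x k) (\<psi> k) z))
        = (\<Sum>k\<in>UNIV. p (dir_deriv (e_x k) (conv (ball_avg \<rho>) (\<psi> k))))"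
      by (simp only:) (rule p_sum, auto intro: test_fun_dir_deriv avg)
    from this[unfolded momentum[OF avg], unfolded dir_deriv_conv[OF av \<psi>] dir_deriv_conv[OF av d\<psi>]]
    show ?thesis .
  qed
  have "((\<lambda>\<rho>. \<Sum>k\<in>UNIV. - (LINT z|lborel. v z $ k * conv (ball_avg \<rho>) (dir_deriv e_t (\<psi> k)) z)
        - (\<Sum>j\<in>UNIV. LINT z|lborel. v z $ k * conv (ball_avg \<rho>) (dir_deriv (e_x j) (dir_deriv (e_x j) (\<psi> k))) z)
        - (\<Sum>j\<in>UNIV. LINT z|lborel. v z $ j * v z $ k * conv (ball_avg \<rho>) (dir_deriv (e_x j) (\<psi> k)) z))
     \<longlongrightarrow> (\<Sum>k\<in>(UNIV::3 set). - 0 - (\<Sum>j\<in>(UNIV::3 set). 0) - (\<Sum>j\<in>(UNIV::3 set). 0))) at_top"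
    by (intro tendsto_sum tendsto_diff tendsto_minus
        avg_linear_term[OF d\<psi>] avg_linear_term[OF test_fun_dir_deriv[OF d\<psi>]] avg_quadratic_term[OF d\<psi>])
  then show ?thesis unfolding eq by simp
qed

end

section \<open>Riesz transforms on space-time and the pressure formula\<close>

definition riesz :: "3 \<Rightarrow> 3 \<Rightarrow> (spacetime \<Rightarrow> real) \<Rightarrow> spacetime \<Rightarrow> real" where
  "riesz i j f z = RR i j (\<lambda>y. f (y, snd z)) (fst z)"

lemma riesz_eq:
  assumes "f \<in> test_fun \<Omega>" "\<rho> > 0"
  shows "riesz i j f z = conv (newton_diff \<rho>) (dir_deriv (e_x i) (dir_deriv (e_x j) f)) z + conv (ball_pot_hess \<rho> i j) f z"
  using RR_eq[OF assms, of i j "snd z" "fst z"] by (simp add: riesz_def)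

text \<open>The operator is defined through \<open>Lim\<close>; the representation with radius 1
  exhibits it as a sum of two convolutions of measurable functions.\<close>

lemma measurable_riesz:
  assumes f: "f \<in> test_fun \<Omega>"
  shows "riesz i j f \<in> borel_measurable borel"
proof -
  have [measurable]: "f \<in> borel_measurable borel" "dir_deriv (e_x i) (dir_deriv (e_x j) f) \<in> borel_measurable borel"
    using f by (auto intro: test_fun_measurable test_fun_dir_deriv)
  have "riesz i j f = (\<lambda>z. conv (newton_diff 1) (dir_deriv (e_x i) (dir_deriv (e_x j) f)) z + conv (ball_pot_hess 1 i j) f z)"
    by (rule ext) (rule riesz_eq[OF f], simp)
  then show ?thesis by simp
qed

lemma test_fun_conv_newton_diff:
  fixes f :: "spacetime \<Rightarrow> real"
  assumes "f \<in> test_fun (UNIV \<times> I)" "\<rho> > 0"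
  shows "conv (newton_diff \<rho>) (dir_deriv v (dir_deriv w f)) \<in> test_fun (UNIV \<times> I)"
  by (intro test_fun_conv[OF integrable_newton_diff newton_diff_support] test_fun_dir_deriv assms)

text \<open>The near part is a test function, and the far part is bounded by the weight because
  \<open>f\<close> has mean zero. Any radius beyond the threshold in \<open>hess_term\<close>
  serves.\<close>

lemma riesz_le_weight:
  assumes f: "f \<in> test_fun (UNIV \<times> I)" and mean: "\<And>t. (LINT y|lborel. f (y, t)) = 0"
  shows "\<exists>B>0. \<forall>z. \<bar>riesz i j f z\<bar> \<le> B * weight z"
proof -
  \<comment> \<open>The kernel bound in \<open>hess_term\<close> does not involve the field, so the
    zero field is used to obtain it.\<close>
  interpret decaying_field "\<lambda>_. 0" by unfold_locales (simp_all cong: if_cong)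
  obtain r where r: "r > 0" "\<forall>\<rho>>r. \<exists>B. \<forall>z. \<bar>conv (ball_pot_hess \<rho> i j) f z\<bar> \<le> B * weight z"
    using hess_term(1)[OF f mean] by blast
  then obtain B where B: "\<forall>z. \<bar>conv (ball_pot_hess (r + 1) i j) f z\<bar> \<le> B * weight z" by force
  have r1: "r + 1 > 0" using r by simp
  obtain A where A: "\<forall>z. \<bar>conv (newton_diff (r + 1)) (dir_deriv (e_x i) (dir_deriv (e_x j) f)) z\<bar> \<le> A * weight z"
    using test_fun_le_weight[OF test_fun_conv_newton_diff[OF f r1]] by blast
  have "\<bar>riesz i j f z\<bar> \<le> (\<bar>A\<bar> + \<bar>B\<bar> + 1) * weight z" for z
  proof -
    have "\<bar>riesz i j f z\<bar> \<le> (A + B) * weight z"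
      unfolding riesz_eq[OF f r1] using A[rule_format, of z] B[rule_format, of z]
      by (simp add: distrib_right)
    also have "\<dots> \<le> (\<bar>A\<bar> + \<bar>B\<bar> + 1) * weight z"
      using weight_pos[of z] by (intro mult_right_mono) auto
    finally show ?thesis .
  qed
  then show ?thesis by (intro exI[of _ "\<bar>A\<bar> + \<bar>B\<bar> + 1"]) auto
qed

lemma integral_divergence_0:
  fixes \<psi> :: "3 \<Rightarrow> spacetime \<Rightarrow> real"
  assumes \<psi>: "\<And>k. \<psi> k \<in> test_fun \<Omega>"
    and f_def: "f = (\<lambda>z. \<Sum>k\<in>(UNIV :: 3 set). dir_deriv (e_x k) (\<psi> k) z)"
  shows "(LINT y|lborel. f (y, t)) = 0"
proof -
  note g = test_fun_dir_deriv[OF \<psi>]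
  show ?thesis
    unfolding f_def e_x_def
    by (subst Bochner_Integration.integral_sum)
      (auto simp: integral_spatial_dir_deriv_0[OF \<psi>] intro: integrable_test_fun_slice[OF g])
qed

context weak_NSE
begin

text \<open>Neither \<open>p f\<close> nor the Riesz transform depends on \<rho>. Writing the near
  kernel in \<open>pressure_eq\<close> as \<open>riesz\<close> minus the Hessian term leaves two
  quantities that depend on \<rho>, and both tend to 0.\<close>

lemma pressure_formula:
  assumes \<psi>: "\<And>k. \<psi> k \<in> test_fun (UNIV \<times> I)"
    and f_def: "f = (\<lambda>z. \<Sum>k\<in>(UNIV :: 3 set). dir_deriv (e_x k) (\<psi> k) z)"
  shows "p f = (\<Sum>l\<in>UNIV. \<Sum>j\<in>UNIV. LINT z|lborel. v z $ j * v z $ l * riesz j l f z)"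
proof -
  have f: "f \<in> test_fun (UNIV \<times> I)"
    unfolding f_def by (intro test_fun_sum test_fun_dir_deriv \<psi>) auto
  note mean = integral_divergence_0[of \<psi>, OF \<psi> f_def]
  have [measurable]: "f \<in> borel_measurable borel" using f by (rule test_fun_measurable)
  let ?S = "\<lambda>j l. LINT z|lborel. v z $ j * v z $ l * riesz j l f z"
  let ?H = "\<lambda>\<rho> j l. LINT z|lborel. v z $ j * v z $ l * conv (ball_pot_hess \<rho> j l) f z"
  have int: "\<forall>\<^sub>F \<rho> in at_top. integrable lborel (\<lambda>z. v z $ j * v z $ l * conv (ball_pot_hess \<rho> j l) f z)" for j l
  proof -
    obtain r where "\<forall>\<rho>>r. integrable lborel (\<lambda>z. v z $ j * v z $ l * conv (ball_pot_hess \<rho> j l) f z)"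
      using hess_term(1)[OF f mean, of j l] by blast
    then show ?thesis by (auto simp: eventually_at_top_dense)
  qed
  have "\<forall>\<^sub>F \<rho> in at_top. \<rho> > 0 \<and>
      (\<forall>j l. integrable lborel (\<lambda>z. v z $ j * v z $ l * conv (ball_pot_hess \<rho> j l) f z))"
    by (intro eventually_conj eventually_gt_at_top eventually_all_finite int)
  then have ev: "\<forall>\<^sub>F \<rho> in at_top. p (conv (ball_avg \<rho>) f) + (\<Sum>l\<in>UNIV. \<Sum>j\<in>UNIV. ?S j l - ?H \<rho> j l) = p f"
  proof eventually_elim
    case (elim \<rho>)
    then have \<rho>: "\<rho> > 0" by simp
    have "(LINT z|lborel. v z $ j * v z $ l * conv (newton_diff \<rho>) (dir_deriv (e_x j) (dir_deriv (e_x l) f)) z)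
        = ?S j l - ?H \<rho> j l" for j l
    proof -
      have i1: "integrable lborel (\<lambda>z. v z $ j * v z $ l * conv (newton_diff \<rho>) (dir_deriv (e_x j) (dir_deriv (e_x l) f)) z)"
        by (rule integrable_vv_test_fun[OF test_fun_conv_newton_diff[OF f \<rho>]])
      have i2: "integrable lborel (\<lambda>z. v z $ j * v z $ l * conv (ball_pot_hess \<rho> j l) f z)"
        using elim by blast
      show ?thesis
        unfolding riesz_eq[OF f \<rho>] distrib_left
        by (simp only: Bochner_Integration.integral_add[OF i1 i2] add_diff_cancel_right')
    qed
    then show ?case using pressure_eq[OF f \<rho>] by simp
  qed
  have "((\<lambda>\<rho>. p (conv (ball_avg \<rho>) f) + (\<Sum>l\<in>UNIV. \<Sum>j\<in>UNIV. ?S j l - ?H \<rho> j l))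
      \<longlongrightarrow> 0 + (\<Sum>l\<in>UNIV. \<Sum>j\<in>UNIV. ?S j l - 0)) at_top"
    by (intro tendsto_add tendsto_sum tendsto_diff tendsto_const hess_term(2)[OF f mean]
        pressure_avg_tendsto[of \<psi>, OF \<psi>, folded f_def])
  moreover have "((\<lambda>\<rho>. p (conv (ball_avg \<rho>) f) + (\<Sum>l\<in>UNIV. \<Sum>j\<in>UNIV. ?S j l - ?H \<rho> j l)) \<longlongrightarrow> p f) at_top"
    using ev by (rule tendsto_eventually)
  ultimately show ?thesis
    using tendsto_unique[OF trivial_limit_at_top_linorder] by fastforce
qed

end

section \<open>The far-field term\<close>

lemma nn_integral_lborel_triple:
  fixes g :: "('a::euclidean_space \<times> 'b::euclidean_space) \<times> 'c::euclidean_space \<Rightarrow> ennreal"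
  assumes [measurable]: "g \<in> borel_measurable borel"
  shows "(\<integral>\<^sup>+w. g w \<partial>lborel) = (\<integral>\<^sup>+x. \<integral>\<^sup>+t. \<integral>\<^sup>+y. g ((x, t), y) \<partial>lborel \<partial>lborel \<partial>lborel)"
proof -
  have m: "g \<in> borel_measurable (lborel \<Otimes>\<^sub>M lborel)" by (simp add: lborel_prod)
  have m2: "(\<lambda>z. \<integral>\<^sup>+y. g (z, y) \<partial>lborel) \<in> borel_measurable (lborel \<Otimes>\<^sub>M lborel)"
    using lborel.borel_measurable_nn_integral_fst[OF m] by (simp add: lborel_prod)
  have "(\<integral>\<^sup>+w. g w \<partial>lborel) = (\<integral>\<^sup>+z. \<integral>\<^sup>+y. g (z, y) \<partial>lborel \<partial>lborel)"
    using lborel.nn_integral_fst[OF m] by (simp add: lborel_prod)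
  also have "\<dots> = (\<integral>\<^sup>+x. \<integral>\<^sup>+t. \<integral>\<^sup>+y. g ((x, t), y) \<partial>lborel \<partial>lborel \<partial>lborel)"
    using lborel.nn_integral_fst[OF m2] by (simp add: lborel_prod)
  finally show ?thesis .
qed

text \<open>Exchanging \<open>x\<close> and \<open>y\<close> in \<open>((x, t), y)\<close>, with
  \<open>t\<close> as a spectator, is a product of three adjacent transpositions, each an instance
  of Tonelli's theorem for indicators. Phrased as a change of variables it also serves signed
  integrands.\<close>

lemma lborel_distr_swap_outer:
  "distr lborel borel (\<lambda>w. ((snd w, snd (fst w)), fst (fst w)))
    = (lborel :: (('c::euclidean_space \<times> 'b::euclidean_space) \<times> 'a::euclidean_space) measure)"
proof (rule measure_eqI)
  fix A :: "(('c \<times> 'b) \<times> 'a) set"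
  assume "A \<in> sets (distr lborel borel (\<lambda>w. ((snd w, snd (fst w)), fst (fst w))))"
  then have A [measurable]: "A \<in> sets borel" by simp
  have P [measurable]: "(\<lambda>w::('a \<times> 'b) \<times> 'c. ((snd w, snd (fst w)), fst (fst w))) \<in> borel_measurable borel"
    by measurable
  have iP: "(\<lambda>w::('a \<times> 'b) \<times> 'c. indicator A ((snd w, snd (fst w)), fst (fst w)) :: ennreal) \<in> borel_measurable borel"
    by measurable
  have [measurable]: "(\<lambda>(x, y). indicator A ((y, t), x) :: ennreal) \<in> borel_measurable (lborel \<Otimes>\<^sub>M lborel)" for t
  proof -
    have "(\<lambda>w::'a \<times> 'c. indicator A ((snd w, t), fst w) :: ennreal) \<in> borel_measurable borel" by measurable
    then show ?thesis by (simp add: lborel_prod case_prod_beta)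
  qed
  have m1: "(\<lambda>(x, t). \<integral>\<^sup>+y. indicator A ((y, t), x) \<partial>lborel) \<in> borel_measurable (lborel \<Otimes>\<^sub>M (lborel :: 'b measure))"
  proof -
    have "(\<lambda>w::('a \<times> 'b) \<times> 'c. indicator A ((snd w, snd (fst w)), fst (fst w)) :: ennreal) \<in> borel_measurable (lborel \<Otimes>\<^sub>M lborel)"
      using iP by (simp add: lborel_prod)
    from lborel.borel_measurable_nn_integral_fst[OF this] show ?thesis
      by (simp add: lborel_prod case_prod_beta)
  qed
  have m2: "(\<lambda>(t, y). \<integral>\<^sup>+x. indicator A ((y, t), x) \<partial>lborel) \<in> borel_measurable (lborel \<Otimes>\<^sub>M lborel)"
  proof -
    have "(\<lambda>w::('b \<times> 'c) \<times> 'a. indicator A ((snd (fst w), fst (fst w)), snd w) :: ennreal) \<in> borel_measurable borel"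
      by measurable
    then have "(\<lambda>w::('b \<times> 'c) \<times> 'a. indicator A ((snd (fst w), fst (fst w)), snd w) :: ennreal) \<in> borel_measurable (lborel \<Otimes>\<^sub>M lborel)"
      by (simp add: lborel_prod)
    from lborel.borel_measurable_nn_integral_fst[OF this] show ?thesis
      by (simp add: lborel_prod case_prod_beta)
  qed
  have "emeasure (distr lborel borel (\<lambda>w::('a \<times> 'b) \<times> 'c. ((snd w, snd (fst w)), fst (fst w)))) A
      = (\<integral>\<^sup>+w. indicator A w \<partial>distr lborel borel (\<lambda>w::('a \<times> 'b) \<times> 'c. ((snd w, snd (fst w)), fst (fst w))))"
    by simp
  also have "\<dots> = (\<integral>\<^sup>+w. indicator A ((snd w, snd (fst w)), fst (fst w)) \<partial>lborel)"
    by (rule nn_integral_distr) measurable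
  also have "\<dots> = (\<integral>\<^sup>+x. \<integral>\<^sup>+t. \<integral>\<^sup>+y. indicator A ((y, t), x) \<partial>lborel \<partial>lborel \<partial>lborel)"
    using nn_integral_lborel_triple[OF iP] by simp
  also have "\<dots> = (\<integral>\<^sup>+t. \<integral>\<^sup>+x. \<integral>\<^sup>+y. indicator A ((y, t), x) \<partial>lborel \<partial>lborel \<partial>lborel)"
    by (rule lborel_pair.Fubini'[OF m1, symmetric])
  also have "\<dots> = (\<integral>\<^sup>+t. \<integral>\<^sup>+y. \<integral>\<^sup>+x. indicator A ((y, t), x) \<partial>lborel \<partial>lborel \<partial>lborel)"
    by (intro nn_integral_cong lborel_pair.Fubini'[symmetric]) measurable
  also have "\<dots> = (\<integral>\<^sup>+y. \<integral>\<^sup>+t. \<integral>\<^sup>+x. indicator A ((y, t), x) \<partial>lborel \<partial>lborel \<partial>lborel)"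
    by (rule lborel_pair.Fubini'[OF m2, symmetric])
  also have "\<dots> = (\<integral>\<^sup>+w. indicator A w \<partial>lborel)"
    by (rule nn_integral_lborel_triple[symmetric]) measurable
  finally show "emeasure (distr lborel borel (\<lambda>w::('a \<times> 'b) \<times> 'c. ((snd w, snd (fst w)), fst (fst w)))) A = emeasure lborel A"
    by simp
qed simp

text \<open>The majorant is the product of an integrable function of \<open>(y, t)\<close> and the
  indicator of a ball in \<open>x\<close>, hence integrable on the triple product; Fubini's theorem
  then applies in both orders.\<close>

lemma integral_swap_outer:
  fixes G :: "'a::euclidean_space \<Rightarrow> 'b::euclidean_space \<Rightarrow> 'c::euclidean_space \<Rightarrow> real"
  assumes G [measurable]: "(\<lambda>w. G (fst (fst w)) (snd (fst w)) (snd w)) \<in> borel_measurable borel"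
    and h: "integrable lborel h"
    and bound: "\<And>x t y. \<bar>G x t y\<bar> \<le> (if norm x \<le> r then h (y, t) else 0)"
  shows "(LINT z|lborel. LINT y|lborel. G (fst z) (snd z) y) = (LINT z|lborel. LINT x|lborel. G x (snd z) (fst z))"
proof -
  let ?P = "\<lambda>w::('c \<times> 'b) \<times> 'a. ((snd w, snd (fst w)), fst (fst w))"
  let ?g = "\<lambda>w::('a \<times> 'b) \<times> 'c. G (fst (fst w)) (snd (fst w)) (snd w)"
  have P [measurable]: "?P \<in> borel_measurable borel" by measurable
  have gP: "(\<lambda>w. ?g (?P w)) \<in> borel_measurable borel" by measurable
  have [measurable]: "h \<in> borel_measurable borel" using h by simp
  have "integrable (lborel \<Otimes>\<^sub>M lborel) (\<lambda>w::('c \<times> 'b) \<times> 'a. h (fst w) * indicator (cball 0 r) (snd w))"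
  proof (rule lborel_pair.Fubini_integrable)
    have "(\<lambda>w::('c \<times> 'b) \<times> 'a. h (fst w) * indicator (cball 0 r) (snd w)) \<in> borel_measurable borel"
      by (intro borel_measurable_times measurable_compose[OF measurable_fst_borel]
          measurable_compose[OF measurable_snd_borel]) (use h borel_measurable_indicator[OF borel_closed[OF closed_cball]] in simp_all)
    then show "(\<lambda>w::('c \<times> 'b) \<times> 'a. h (fst w) * indicator (cball 0 r) (snd w)) \<in> borel_measurable (lborel \<Otimes>\<^sub>M lborel)"
      by (simp add: lborel_prod)
    have "(\<lambda>z. LINT y|lborel. norm (h (fst (z, y)) * indicator (cball 0 r) (snd (z, y :: 'a))))
        = (\<lambda>z. \<bar>h z\<bar> * measure lborel (cball (0::'a) r))"
      by (rule ext) (simp add: abs_mult)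
    then show "integrable lborel (\<lambda>z. LINT y|lborel. norm (h (fst (z, y)) * indicator (cball 0 r) (snd (z, y :: 'a))))"
      using h by simp
    show "AE z in lborel. integrable lborel (\<lambda>y. h (fst (z, y)) * indicator (cball 0 r) (snd (z, y :: 'a)))"
      using emeasure_lborel_cball_finite[of "0::'a" r] by (intro AE_I2) simp
  qed
  then have "integrable lborel (\<lambda>w::('c \<times> 'b) \<times> 'a. h (fst w) * indicator (cball 0 r) (snd w))"
    by (simp add: lborel_prod)
  then have igP: "integrable lborel (\<lambda>w. ?g (?P w))"
  proof (rule Bochner_Integration.integrable_bound)
    show "AE w in lborel. norm (?g (?P w)) \<le> norm (h (fst w) * indicator (cball 0 r) (snd w))"
    proof (rule AE_I2)
      fix w :: "('c \<times> 'b) \<times> 'a"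
      show "norm (?g (?P w)) \<le> norm (h (fst w) * indicator (cball 0 r) (snd w))"
        using bound[of "snd w" "snd (fst w)" "fst (fst w)"]
        by (cases "norm (snd w) \<le> r") (auto simp: dist_norm)
    qed
  qed (use gP in simp)
  have ig: "integrable lborel ?g"
  proof -
    have "integrable (distr lborel borel ?P) ?g"
      using igP by (subst integrable_distr_eq) auto
    then show ?thesis by (simp only: lborel_distr_swap_outer)
  qed
  have "(LINT z|lborel. LINT y|lborel. G (fst z) (snd z) y) = (LINT w|lborel. ?g w)"
    using lborel_pair.integral_fst'[of ?g] ig by (simp add: lborel_prod)
  also have "\<dots> = (LINT w|distr lborel borel ?P. ?g w)" by (simp only: lborel_distr_swap_outer)
  also have "\<dots> = (LINT w|lborel. ?g (?P w))" by (rule integral_distr) simp_all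
  also have "\<dots> = (LINT z|lborel. LINT x|lborel. G x (snd z) (fst z))"
    using lborel_pair.integral_fst'[of "\<lambda>w. ?g (?P w)"] igP by (simp add: lborel_prod)
  finally show ?thesis .
qed

text \<open>Seen from \<open>y\<close>, the support of \<open>f\<close> lies farther away than
  \<open>R\<close>, beyond the reach of \<open>newton_diff R\<close> and of the regularisation in
  \<open>ball_pot_hess R\<close>, so the plain kernel remains. It is even, and the subtracted
  constant \<open>Kern i j (x0 - y)\<close> integrates to 0 against \<open>f\<close>.\<close>

lemma riesz_far:
  assumes f: "f \<in> test_fun (ball x0 R \<times> I)" and R: "R > 0" and far: "2 * R \<le> norm (x0 - y)"
    and mean: "(LINT x|lborel. f (x, t)) = 0"
  shows "(LINT x|lborel. (Kern i j (x - y) - Kern i j (x0 - y)) * f (x, t)) = riesz i j f (y, t)"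
proof -
  have [measurable]: "f \<in> borel_measurable borel" using f by (rule test_fun_measurable)
  let ?g = "dir_deriv (e_x i) (dir_deriv (e_x j) f)"
  have g: "?g \<in> test_fun (ball x0 R \<times> I)" using f by (intro test_fun_dir_deriv)
  have sep: "norm (y - x) > R" if "norm (x0 - x) < R" for x
    using norm_triangle_ineq[of "x0 - x" "x - y"] that far by (simp add: norm_minus_commute)
  have eq: "ball_pot_hess R i j (y - x) * f (x, t) = Kern i j (x - y) * f (x, t)" for x
  proof (cases "f (x, t) = 0")
    case False
    then have "(x, t) \<in> ball x0 R \<times> I" using test_fun_eq_0[OF f, of "(x, t)"] by auto
    then have "norm (y - x) > R" by (intro sep) (simp add: dist_norm)
    then show ?thesis using Kern_minus[of i j "y - x"] by (simp add: ball_pot_hess_def)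
  qed simp
  have "conv (newton_diff R) ?g (y, t) = 0"
  proof (rule conv_eq_0)
    fix w assume "?g ((y, t) - (w, 0)) \<noteq> 0"
    then have "(y - w, t) \<in> ball x0 R \<times> I"
      using test_fun_eq_0[OF g, of "(y - w, t)"] by auto
    then have "norm (y - (y - w)) > R" by (intro sep) (simp add: dist_norm)
    then show "newton_diff R w = 0" by (simp add: newton_diff_def)
  qed
  then have "riesz i j f (y, t) = conv (ball_pot_hess R i j) f (y, t)"
    using riesz_eq[OF f R] by simp
  also have "\<dots> = (LINT x|lborel. ball_pot_hess R i j (y - x) * f (x, t))"
    by (rule conv_reflect) simp_all
  also have "\<dots> = (LINT x|lborel. Kern i j (x - y) * f (x, t))" by (simp only: eq)
  finally have 1: "riesz i j f (y, t) = (LINT x|lborel. Kern i j (x - y) * f (x, t))" .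
  have fi: "integrable lborel (\<lambda>x. f (x, t))" by (rule integrable_test_fun_slice[OF f])
  then have J: "integrable lborel (\<lambda>x. \<bar>f (x, t)\<bar>)" by simp
  have "integrable lborel (\<lambda>x. ball_pot_hess R i j (y - x) * f (x, t))"
  proof (rule Bochner_Integration.integrable_bound[OF integrable_mult_right[OF J, of "1 / R ^ 3"]])
    show "AE x in lborel. norm (ball_pot_hess R i j (y - x) * f (x, t)) \<le> norm (1 / R ^ 3 * \<bar>f (x, t)\<bar>)"
    proof (rule AE_I2)
      fix x
      have "\<bar>ball_pot_hess R i j (y - x)\<bar> * \<bar>f (x, t)\<bar> \<le> 1 / R ^ 3 * \<bar>f (x, t)\<bar>"
        by (intro mult_right_mono ball_pot_hess_abs_le R) auto
      then show "norm (ball_pot_hess R i j (y - x) * f (x, t)) \<le> norm (1 / R ^ 3 * \<bar>f (x, t)\<bar>)"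
        using R by (simp add: abs_mult)
    qed
  qed measurable
  then have ki: "integrable lborel (\<lambda>x. Kern i j (x - y) * f (x, t))" by (simp only: eq)
  have "(LINT x|lborel. (Kern i j (x - y) - Kern i j (x0 - y)) * f (x, t))
      = (LINT x|lborel. Kern i j (x - y) * f (x, t)) - Kern i j (x0 - y) * (LINT x|lborel. f (x, t))"
    using ki fi by (simp add: left_diff_distrib)
  then show ?thesis using 1 mean by simp
qed

text \<open>\<open>Kern_diff_le\<close> with \<open>a = x0 - y\<close> and
  \<open>b = x0 - x\<close>, whose condition is guaranteed by the factor 2 between the two radii. It
  remains to compare \<open>norm (x0 - y)\<close> with \<open>1 + norm y\<close>.\<close>

lemma far_kernel_le:
  fixes x0 :: space
  assumes R: "R > 0"
  shows "\<exists>C>0. \<forall>x y t i j. norm (x0 - x) < R \<longrightarrow> 2 * R \<le> norm (x0 - y) \<longrightarrow>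
    \<bar>Kern i j (x - y) - Kern i j (x0 - y)\<bar> \<le> C * weight (y, t)"
proof -
  \<comment> \<open>Chosen so that \<open>1 + norm y \<le> D * norm (x0 - y)\<close>: the left side
    is at most \<open>1 + norm x0 + norm (x0 - y)\<close>, and
    \<open>1 \<le> norm (x0 - y) / (2 * R)\<close> in the far region.\<close>
  define D where "D = (1 + norm x0) / (2 * R) + 1"
  have D: "D > 0" using R norm_ge_zero[of x0] by (simp add: D_def add_nonneg_pos)
  have "\<bar>Kern i j (x - y) - Kern i j (x0 - y)\<bar> \<le> 568 * R * D ^ 4 * weight (y, t)"
    if x: "norm (x0 - x) < R" and y: "2 * R \<le> norm (x0 - y)" for x y t i j
  proof -
    let ?a = "norm (x0 - y)"
    have a: "?a > 0" using y R by linarith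
    have "\<bar>Kern i j ((x0 - y) - (x0 - x)) - Kern i j (x0 - y)\<bar> \<le> 568 * norm (x0 - x) / ?a ^ 4"
      using a x y by (intro Kern_diff_le) auto
    then have "\<bar>Kern i j (x - y) - Kern i j (x0 - y)\<bar> \<le> 568 * norm (x0 - x) / ?a ^ 4" by simp
    also have "\<dots> \<le> 568 * R / ?a ^ 4" using x by (intro divide_right_mono) auto
    also have "\<dots> = 568 * R * (1 / ?a ^ 4)" by simp
    also have "\<dots> \<le> 568 * R * (D ^ 4 * weight (y, t))"
    proof (rule mult_left_mono)
      have "1 + norm y \<le> (1 + norm x0) * 1 + ?a"
        using norm_triangle_ineq2[of y x0] by (simp add: norm_minus_commute)
      also have "\<dots> \<le> (1 + norm x0) * (?a / (2 * R)) + ?a"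
        using y R by (intro add_mono mult_left_mono) (auto simp: field_simps)
      also have "\<dots> = D * ?a" using R by (simp add: D_def field_simps)
      finally have "(1 + norm y) ^ 4 \<le> (D * ?a) ^ 4" by (intro power_mono) auto
      moreover have "0 < 1 + norm y" using norm_ge_zero[of y] by linarith
      ultimately have "1 / (D * ?a) ^ 4 \<le> 1 / (1 + norm y) ^ 4"
        using D a by (intro divide_left_mono mult_pos_pos zero_less_power) auto
      then have "D ^ 4 * (1 / (D * ?a) ^ 4) \<le> D ^ 4 * weight (y, t)"
        using D by (intro mult_left_mono) (auto simp: weight_def)
      moreover have "D ^ 4 * (1 / (D * ?a) ^ 4) = 1 / ?a ^ 4" using D by (simp add: power_mult_distrib)
      ultimately show "1 / ?a ^ 4 \<le> D ^ 4 * weight (y, t)" by simp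
    qed (use R in simp)
    finally show ?thesis by (simp add: mult.assoc)
  qed
  then show ?thesis using R D by (intro exI[of _ "568 * R * D ^ 4"]) simp
qed

text \<open>Here \<kappa> stands for one minus the scaled cutoff. Fubini's theorem carries the
  integral over \<open>x\<close> inside, where \<open>riesz_far\<close> identifies it. The extra
  decay of the kernel difference is what guarantees absolute convergence of the double
  integral.\<close>

lemma (in decaying_field) far_field_eq:
  assumes f: "f \<in> test_fun (ball x0 R \<times> I)" and R: "R > 0"
    and mean: "\<And>t. (LINT x|lborel. f (x, t)) = 0"
    and \<kappa> [measurable]: "\<kappa> \<in> borel_measurable borel" and \<kappa>_le: "\<And>y. \<bar>\<kappa> y\<bar> \<le> B"
    and \<kappa>_0: "\<And>y. norm (x0 - y) < 2 * R \<Longrightarrow> \<kappa> y = 0"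
  shows "(LINT z|lborel. (LINT y|lborel. (\<Sum>i\<in>UNIV. \<Sum>j\<in>UNIV.
              (Kern i j (fst z - y) - Kern i j (x0 - y)) * \<kappa> y * (v (y, snd z) $ i * v (y, snd z) $ j))) * f z)
       = (LINT z|lborel. (\<Sum>i\<in>UNIV. \<Sum>j\<in>UNIV. v z $ i * v z $ j * (\<kappa> (fst z) * riesz i j f z)))"
proof -
  have mf [measurable]: "f \<in> borel_measurable borel" using f by (rule test_fun_measurable)
  obtain M where M: "M > 0" "\<forall>z. \<bar>f z\<bar> \<le> M" using test_fun_bounded[OF f] by blast
  obtain r where r: "\<forall>z. f z \<noteq> 0 \<longrightarrow> norm z \<le> r" using test_fun_support_bounded[OF f] by blast
  obtain C where C: "C > 0" "\<And>x y t i j. norm (x0 - x) < R \<Longrightarrow> 2 * R \<le> norm (x0 - y) \<Longrightarrow>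
      \<bar>Kern i j (x - y) - Kern i j (x0 - y)\<bar> \<le> C * weight (y, t)"
    using far_kernel_le[OF R, of x0] by metis
  have "B \<ge> 0" using \<kappa>_le[of 0] by linarith
  define G where "G x t y = (\<Sum>i\<in>UNIV. \<Sum>j\<in>UNIV.
      (Kern i j (x - y) - Kern i j (x0 - y)) * \<kappa> y * (v (y, t) $ i * v (y, t) $ j)) * f (x, t)" for x t y
  \<comment> \<open>The 9 counts the pairs of indices; \<open>C * weight z\<close>, \<open>B\<close>
    and \<open>M\<close> bound the kernel difference, \<kappa> and \<open>f\<close>.\<close>
  define h where "h = (\<lambda>z. 9 * C * B * M * ((norm (v z))\<^sup>2 * weight z))"
  have hi: "integrable lborel h" unfolding h_def by (intro integrable_mult_right integrable_weighted)
  have h0: "0 \<le> h z" for z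
    unfolding h_def using C(1) \<open>B \<ge> 0\<close> M(1) weight_pos[of z] by simp
  have bound: "\<bar>G x t y\<bar> \<le> (if norm x \<le> r then h (y, t) else 0)" for x t y
  proof (cases "f (x, t) = 0 \<or> \<kappa> y = 0")
    case True
    then show ?thesis using h0 by (auto simp: G_def)
  next
    case False
    then have "(x, t) \<in> ball x0 R \<times> I" using test_fun_eq_0[OF f, of "(x, t)"] by auto
    then have x: "norm (x0 - x) < R" by (simp add: dist_norm)
    have xr: "norm x \<le> r" using r[rule_format, of "(x, t)"] False norm_fst_le[of x t] by auto
    have y: "2 * R \<le> norm (x0 - y)" using \<kappa>_0[of y] False by linarith
    have "\<bar>(Kern i j (x - y) - Kern i j (x0 - y)) * \<kappa> y * (v (y, t) $ i * v (y, t) $ j)\<bar>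
        \<le> C * weight (y, t) * B * (norm (v (y, t)))\<^sup>2" for i j
      unfolding abs_mult[of _ "v (y, t) $ i * v (y, t) $ j"] abs_mult[of _ "\<kappa> y"]
      using C(1) weight_pos[of "(y, t)"] \<open>B \<ge> 0\<close>
      by (intro mult_mono C(2) x y \<kappa>_le abs_component_mult_le) auto
    then have "\<bar>\<Sum>i\<in>UNIV. \<Sum>j\<in>UNIV. (Kern i j (x - y) - Kern i j (x0 - y)) * \<kappa> y * (v (y, t) $ i * v (y, t) $ j)\<bar>
        \<le> (\<Sum>i\<in>(UNIV::3 set). \<Sum>j\<in>(UNIV::3 set). C * weight (y, t) * B * (norm (v (y, t)))\<^sup>2)"
      by (intro order_trans[OF sum_abs] sum_mono)
    also have "\<dots> = 9 * (C * weight (y, t) * B * (norm (v (y, t)))\<^sup>2)" by simp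
    finally have "\<bar>G x t y\<bar> \<le> 9 * (C * weight (y, t) * B * (norm (v (y, t)))\<^sup>2) * M"
      unfolding G_def abs_mult[of _ "f (x, t)"]
      using M C(1) weight_pos[of "(y, t)"] \<open>B \<ge> 0\<close> by (intro mult_mono) auto
    then show ?thesis using xr by (simp add: h_def mult_ac)
  qed
  have mG: "(\<lambda>w. G (fst (fst w)) (snd (fst w)) (snd w)) \<in> borel_measurable borel"
  proof -
    have pv: "(\<lambda>w::spacetime \<times> space. v (snd w, snd (fst w)) $ i) \<in> borel_measurable borel" for i
      by (rule measurable_compose[OF _ measurable_component]) measurable
    have pf: "(\<lambda>w::spacetime \<times> space. f (fst (fst w), snd (fst w))) \<in> borel_measurable borel"
      by (rule measurable_compose[OF _ mf]) measurable
    have pK: "(\<lambda>w::spacetime \<times> space. Kern i j (fst (fst w) - snd w)) \<in> borel_measurable borel"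
      "(\<lambda>w::spacetime \<times> space. Kern i j (x0 - snd w)) \<in> borel_measurable borel" for i j
      by (rule measurable_compose[OF _ measurable_Kern], measurable)+
    have p\<kappa>: "(\<lambda>w::spacetime \<times> space. \<kappa> (snd w)) \<in> borel_measurable borel"
      by (rule measurable_compose[OF measurable_snd_borel \<kappa>])
    show ?thesis
      unfolding G_def
      by (intro borel_measurable_times borel_measurable_sum borel_measurable_diff pv pf pK p\<kappa>)
  qed
  have "(LINT z|lborel. (LINT y|lborel. (\<Sum>i\<in>UNIV. \<Sum>j\<in>UNIV.
              (Kern i j (fst z - y) - Kern i j (x0 - y)) * \<kappa> y * (v (y, snd z) $ i * v (y, snd z) $ j))) * f z)
       = (LINT z|lborel. LINT y|lborel. G (fst z) (snd z) y)"
    by (simp add: G_def)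
  also have "\<dots> = (LINT z|lborel. LINT x|lborel. G x (snd z) (fst z))"
    by (rule integral_swap_outer[OF mG hi bound])
  also have "\<dots> = (LINT z|lborel. (\<Sum>i\<in>UNIV. \<Sum>j\<in>UNIV. v z $ i * v z $ j * (\<kappa> (fst z) * riesz i j f z)))"
  proof (rule Bochner_Integration.integral_cong[OF refl])
    fix z :: spacetime
    obtain y t where z: "z = (y, t)" by (cases z)
    show "(LINT x|lborel. G x (snd z) (fst z)) = (\<Sum>i\<in>UNIV. \<Sum>j\<in>UNIV. v z $ i * v z $ j * (\<kappa> (fst z) * riesz i j f z))"
    proof (cases "\<kappa> y = 0")
      case True
      then show ?thesis by (simp add: G_def z)
    next
      case False
      then have y: "2 * R \<le> norm (x0 - y)" using \<kappa>_0[of y] by linarith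
      have J: "integrable lborel (\<lambda>x. \<bar>f (x, t)\<bar>)"
        using integrable_test_fun_slice[OF f] by simp
      have int: "integrable lborel (\<lambda>x. (Kern i j (x - y) - Kern i j (x0 - y)) * f (x, t))" for i j
      proof (rule Bochner_Integration.integrable_bound[OF integrable_mult_right[OF J, of "C * weight (y, t)"]])
        show "AE x in lborel. norm ((Kern i j (x - y) - Kern i j (x0 - y)) * f (x, t)) \<le> norm (C * weight (y, t) * \<bar>f (x, t)\<bar>)"
        proof (rule AE_I2)
          fix x
          show "norm ((Kern i j (x - y) - Kern i j (x0 - y)) * f (x, t)) \<le> norm (C * weight (y, t) * \<bar>f (x, t)\<bar>)"
          proof (cases "f (x, t) = 0")
            case False
            then have "(x, t) \<in> ball x0 R \<times> I" using test_fun_eq_0[OF f, of "(x, t)"] by auto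
            then have "norm (x0 - x) < R" by (simp add: dist_norm)
            from C(2)[OF this y, of i j t]
            have "\<bar>Kern i j (x - y) - Kern i j (x0 - y)\<bar> * \<bar>f (x, t)\<bar> \<le> C * weight (y, t) * \<bar>f (x, t)\<bar>"
              by (rule mult_right_mono) simp
            then show ?thesis using C(1) weight_pos[of "(y, t)"] by (simp add: abs_mult)
          qed simp
        qed
      qed measurable
      have "(LINT x|lborel. G x t y) = (LINT x|lborel. (\<Sum>i\<in>UNIV. \<Sum>j\<in>UNIV.
          (\<kappa> y * (v (y, t) $ i * v (y, t) $ j)) * ((Kern i j (x - y) - Kern i j (x0 - y)) * f (x, t))))"
        by (rule Bochner_Integration.integral_cong[OF refl]) (simp add: G_def sum_distrib_right sum_distrib_left mult_ac)
      also have "\<dots> = (\<Sum>i\<in>UNIV. \<Sum>j\<in>UNIV. (\<kappa> y * (v (y, t) $ i * v (y, t) $ j)) *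
          (LINT x|lborel. (Kern i j (x - y) - Kern i j (x0 - y)) * f (x, t)))"
        by (subst Bochner_Integration.integral_sum, intro Bochner_Integration.integrable_sum integrable_mult_right int)
          (intro sum.cong refl, subst Bochner_Integration.integral_sum, intro integrable_mult_right int,
            simp only: integral_mult_right_zero)
      also have "\<dots> = (\<Sum>i\<in>UNIV. \<Sum>j\<in>UNIV. v z $ i * v z $ j * (\<kappa> (fst z) * riesz i j f z))"
        unfolding riesz_far[OF f R y mean] z fst_conv by (simp only: mult_ac)
      finally show ?thesis by (simp add: z)
    qed
  qed
  finally show ?thesis .
qed

section \<open>The pressure expansion\<close>

text \<open>The hypothesis is a limit of extended nonnegative reals. It makes the energy finite for
  large radii, and by monotonicity for all; after that it can be rewritten with real
  integrals.\<close>

lemma decaying_field_slab: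
  assumes m: "set_borel_measurable lborel (slab T) u"
    and dec: "((\<lambda>R. (\<integral>\<^sup>+z\<in>ball 0 R \<times> einterval 0 T. ennreal ((norm (u z))\<^sup>2) \<partial>lborel) / ennreal (R ^ 3))
            \<longlongrightarrow> 0) at_top"
  shows "decaying_field (\<lambda>z. indicator (slab T) z *\<^sub>R u z)"
proof -
  let ?v = "\<lambda>z. indicator (slab T) z *\<^sub>R u z"
  have mv [measurable]: "?v \<in> borel_measurable borel"
    using m by (simp add: set_borel_measurable_def)
  define E where "E R = (\<integral>\<^sup>+z. ennreal (if norm (fst z) < R then (norm (?v z))\<^sup>2 else 0) \<partial>lborel)" for R
  have E_eq: "(\<integral>\<^sup>+z\<in>ball 0 R \<times> einterval 0 T. ennreal ((norm (u z))\<^sup>2) \<partial>lborel) = E R" for R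
    unfolding E_def
  proof (rule nn_integral_cong)
    fix z :: spacetime
    show "ennreal ((norm (u z))\<^sup>2) * indicator (ball 0 R \<times> einterval 0 T) z
        = ennreal (if norm (fst z) < R then (norm (?v z))\<^sup>2 else 0)"
      by (cases z) (auto simp: slab_def indicator_def)
  qed
  have E_mono: "E R \<le> E S" if "R \<le> S" for R S
    unfolding E_def using that by (intro nn_integral_mono ennreal_leI) auto
  have "\<forall>\<^sub>F R in at_top. E R / ennreal (R ^ 3) < 1"
    using order_tendstoD(2)[OF dec, of 1] by (simp add: E_eq)
  then obtain R0 where R0: "\<And>R. R \<ge> R0 \<Longrightarrow> E R / ennreal (R ^ 3) < 1"
    by (auto simp: eventually_at_top_linorder)
  have E_fin: "E R < \<infinity>" for R
  proof -
    have "E (max R (max R0 1)) \<noteq> \<infinity>"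
    proof
      assume "E (max R (max R0 1)) = \<infinity>"
      then have "E (max R (max R0 1)) / ennreal ((max R (max R0 1)) ^ 3) = \<infinity>"
        by (simp add: ennreal_top_divide)
      moreover have "E (max R (max R0 1)) / ennreal ((max R (max R0 1)) ^ 3) < 1"
        by (rule R0) simp
      ultimately show False by simp
    qed
    moreover have "E R \<le> E (max R (max R0 1))" by (rule E_mono) simp
    ultimately show ?thesis by (metis infinity_ennreal_def le_less_trans less_top)
  qed
  have int: "integrable lborel (\<lambda>z. if norm (fst z) < R then (norm (?v z))\<^sup>2 else 0)" for R
  proof (rule integrableI_bounded)
    have "(\<integral>\<^sup>+z. ennreal (norm (if norm (fst z) < R then (norm (?v z))\<^sup>2 else 0)) \<partial>lborel) = E R"
      unfolding E_def by (rule nn_integral_cong) auto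
    then show "(\<integral>\<^sup>+z. ennreal (norm (if norm (fst z) < R then (norm (?v z))\<^sup>2 else 0)) \<partial>lborel) < \<infinity>"
      using E_fin by simp
  qed measurable
  let ?e = "\<lambda>R. LINT z|lborel. (if norm (fst z) < R then (norm (?v z))\<^sup>2 else 0)"
  have e0: "0 \<le> ?e R" for R by (intro integral_nonneg_AE AE_I2) auto
  have Ee: "E R = ennreal (?e R)" for R
    unfolding E_def by (rule nn_integral_eq_integral[OF int]) auto
  have "((\<lambda>R. ennreal (?e R / R ^ 3)) \<longlongrightarrow> ennreal 0) at_top"
    unfolding ennreal_0
  proof (rule Lim_transform_eventually[OF dec])
    show "\<forall>\<^sub>F R in at_top. (\<integral>\<^sup>+z\<in>ball 0 R \<times> einterval 0 T. ennreal ((norm (u z))\<^sup>2) \<partial>lborel) / ennreal (R ^ 3)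
        = ennreal (?e R / R ^ 3)"
      using eventually_gt_at_top[of 0]
      by eventually_elim (simp only: E_eq Ee divide_ennreal[OF e0] zero_less_power)
  qed
  moreover have "\<forall>\<^sub>F R in at_top. 0 \<le> ?e R / R ^ 3"
    using eventually_gt_at_top[of 0] by eventually_elim (use e0 in simp)
  ultimately have "((\<lambda>R. ?e R / R ^ 3) \<longlongrightarrow> 0) at_top"
    by (subst (asm) tendsto_ennreal_iff) auto
  then show ?thesis
    using int mv by (intro decaying_field.intro) auto
qed

theorem theorem1p5:
  fixes T :: ereal and \<Theta> :: "real^3 \<Rightarrow> real"
    and u0 :: "real^3 \<Rightarrow> real^3" and u :: "(real^3) \<times> real \<Rightarrow> real^3"
    and p :: "((real^3) \<times> real \<Rightarrow> real) \<Rightarrow> real"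
  assumes "0 < T"
    and "cutoff_profile \<Theta>"
    and "L1_loc u0" and "distr_div_free u0"
    and "L2_loc_closed T u"
    and "((\<lambda>R. (LINT x:ball 0 R|lborel. norm (u0 x)) / R ^ 3) \<longlongrightarrow> 0) at_top"
    and "((\<lambda>R. (\<integral>\<^sup>+z\<in>ball 0 R \<times> einterval 0 T. ennreal ((norm (u z))\<^sup>2) \<partial>lborel) / ennreal (R ^ 3))
            \<longlongrightarrow> 0) at_top"
    and "weak_solution T u0 u p"
  shows "local_pressure_expansion \<Theta> T u p"
proof -
  \<comment> \<open>Extension by 0 turns integrals over the slab into integrals over
    space-time.\<close>
  define v where "v = (\<lambda>z. indicator (slab T) z *\<^sub>R u z)"
  define I where "I = einterval 0 T"
  have slab: "slab T = UNIV \<times> I" by (simp add: slab_def I_def)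
  have v_eq: "v z = u z" if "z \<in> slab T" for z using that by (simp add: v_def)
  have v_0: "v z = 0" if "z \<notin> slab T" for z using that by (simp add: v_def)
  have dist: "distribution_on (slab T) p" and nse: "solves_NSE T u p"
    using assms(8) by (simp_all add: weak_solution_def)
  have d: "decaying_field v"
    unfolding v_def using assms(5,7) by (intro decaying_field_slab) (auto simp: L2_loc_closed_def)
  have fd1: "fun_distr (slab T) (\<lambda>z. u z $ k) \<phi> = (LINT z|lborel. v z $ k * \<phi> z)" for k \<phi>
    unfolding fun_distr_def set_lebesgue_integral_def v_def
    by (rule Bochner_Integration.integral_cong) auto
  have fd2: "fun_distr (slab T) (\<lambda>z. u z $ j * u z $ k) \<phi> = (LINT z|lborel. v z $ j * v z $ k * \<phi> z)" for j k \<phi>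
    unfolding fun_distr_def set_lebesgue_integral_def v_def
    by (rule Bochner_Integration.integral_cong) (auto simp: indicator_def)
  have "weak_NSE v p I"
  proof (intro weak_NSE.intro d weak_NSE_axioms.intro)
    show "p (\<lambda>z. a * \<phi> z + b * \<psi> z) = a * p \<phi> + b * p \<psi>"
      if "\<phi> \<in> test_fun (UNIV \<times> I)" "\<psi> \<in> test_fun (UNIV \<times> I)" for \<phi> \<psi> a b
      using dist that by (simp add: distribution_on_def slab)
    fix \<phi> :: "spacetime \<Rightarrow> real" assume \<phi>: "\<phi> \<in> test_fun (UNIV \<times> I)"
    then have N: "distr_deriv e_t (fun_distr (slab T) (\<lambda>z. u z $ k)) \<phi>
             - (\<Sum>j\<in>UNIV. distr_deriv (e_x j) (distr_deriv (e_x j) (fun_distr (slab T) (\<lambda>z. u z $ k))) \<phi>)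
             + (\<Sum>j\<in>UNIV. distr_deriv (e_x j) (fun_distr (slab T) (\<lambda>z. u z $ j * u z $ k)) \<phi>)
             + distr_deriv (e_x k) p \<phi> = 0"
        "(\<Sum>j\<in>UNIV. distr_deriv (e_x j) (fun_distr (slab T) (\<lambda>z. u z $ j)) \<phi>) = 0" for k
      using nse by (simp_all add: solves_NSE_def slab)
    show "p (dir_deriv (e_x k) \<phi>) = - (LINT z|lborel. v z $ k * dir_deriv e_t \<phi> z)
        - (\<Sum>j\<in>UNIV. LINT z|lborel. v z $ k * dir_deriv (e_x j) (dir_deriv (e_x j) \<phi>) z)
        - (\<Sum>j\<in>UNIV. LINT z|lborel. v z $ j * v z $ k * dir_deriv (e_x j) \<phi> z)" for k
      using N(1)[of k] by (simp add: distr_deriv_def fd1 fd2 sum_negf)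
    show "(\<Sum>j\<in>UNIV. LINT z|lborel. v z $ j * dir_deriv (e_x j) \<phi> z) = 0"
      using N(2) by (simp add: distr_deriv_def fd1 sum_negf)
  qed
  then interpret weak_NSE v p I .
  show ?thesis
    unfolding local_pressure_expansion_def
  proof (intro allI impI exI conjI)
    fix R :: real and x0 :: space
    assume R: "R > 0"
    show "set_integrable lborel (einterval 0 T) (\<lambda>_::real. 0 :: real)"
      by (simp add: set_integrable_def)
    fix \<psi> :: "spacetime \<Rightarrow> real^3"
    assume "\<forall>i. (\<lambda>z. \<psi> z $ i) \<in> test_fun (ball x0 R \<times> einterval 0 T)"
    then have \<psi>: "(\<lambda>z. \<psi> z $ i) \<in> test_fun (ball x0 R \<times> I)" for i by (simp add: I_def)
    then have \<psi>': "(\<lambda>z. \<psi> z $ i) \<in> test_fun (UNIV \<times> I)" for i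
      by (rule test_fun_mono) auto
    define f where "f = spatial_div \<psi>"
    have f_eq: "f = (\<lambda>z. \<Sum>k\<in>UNIV. dir_deriv (e_x k) (\<lambda>w. \<psi> w $ k) z)"
      by (simp add: f_def spatial_div_def)
    have f: "f \<in> test_fun (ball x0 R \<times> I)"
      unfolding f_eq by (intro test_fun_sum test_fun_dir_deriv \<psi>) auto
    have f': "f \<in> test_fun (UNIV \<times> I)" using f by (rule test_fun_mono) auto
    have mean: "(LINT y|lborel. f (y, t)) = 0" for t
      by (rule integral_divergence_0[of "\<lambda>k z. \<psi> z $ k", OF \<psi>' f_eq])
    have pf: "p f = (\<Sum>l\<in>UNIV. \<Sum>j\<in>UNIV. LINT z|lborel. v z $ j * v z $ l * riesz j l f z)"
      by (rule pressure_formula[of "\<lambda>k z. \<psi> z $ k", OF \<psi>' f_eq])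
    define \<theta> where "\<theta> y = \<Theta> ((x0 - y) /\<^sub>R R)" for y
    have \<Theta>: "\<Theta> \<in> test_fun (ball 0 4)" "\<And>x. x \<in> ball 0 2 \<Longrightarrow> \<Theta> x = 1"
      using assms(2) by (auto simp: cutoff_profile_def)
    obtain B where B: "B > 0" "\<forall>x. \<bar>\<Theta> x\<bar> \<le> B" using test_fun_bounded[OF \<Theta>(1)] by blast
    have [measurable]: "\<Theta> \<in> borel_measurable borel" using \<Theta>(1) by (rule test_fun_measurable)
    have m\<theta> [measurable]: "\<theta> \<in> borel_measurable borel" unfolding \<theta>_def[abs_def] by measurable
    \<comment> \<open>A common bound for the cutoff and its complement, so that one integrability
      statement covers both parts.\<close>
    have \<theta>_le: "\<bar>\<theta> y\<bar> \<le> 1 + B" "\<bar>1 - \<theta> y\<bar> \<le> 1 + B" for y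
      using B(2)[rule_format, of "(x0 - y) /\<^sub>R R"] unfolding \<theta>_def by linarith+
    have \<theta>_near: "1 - \<theta> y = 0" if "norm (x0 - y) < 2 * R" for y
    proof -
      have "norm ((x0 - y) /\<^sub>R R) = norm (x0 - y) / R" using R by (simp add: divide_inverse mult.commute)
      then have "norm ((x0 - y) /\<^sub>R R) < 2" using that R by (simp only: pos_divide_less_eq)
      then show ?thesis using \<Theta>(2)[of "(x0 - y) /\<^sub>R R"] by (simp add: \<theta>_def)
    qed
    have mr [measurable]: "riesz i j f \<in> borel_measurable borel" for i j by (rule measurable_riesz[OF f])
    have int: "integrable lborel (\<lambda>z. v z $ i * v z $ j * (\<kappa> (fst z) * riesz i j f z))"
      if \<kappa>: "\<kappa> \<in> borel_measurable borel" "\<And>y. \<bar>\<kappa> y\<bar> \<le> 1 + B" for \<kappa> i j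
    proof -
      note \<kappa>(1)[measurable]
      obtain A where A: "\<forall>z. \<bar>riesz i j f z\<bar> \<le> A * weight z" using riesz_le_weight[OF f' mean] by blast
      have "(\<lambda>z. \<kappa> (fst z)) \<in> borel_measurable (borel :: spacetime measure)"
        by (rule measurable_compose[OF measurable_fst_borel \<kappa>(1)])
      then have "(\<lambda>z. \<kappa> (fst z) * riesz i j f z) \<in> borel_measurable borel" by measurable
      moreover have "\<bar>\<kappa> (fst z) * riesz i j f z\<bar> \<le> (1 + B) * A * weight z" for z
      proof -
        have "\<bar>\<kappa> (fst z)\<bar> * \<bar>riesz i j f z\<bar> \<le> (1 + B) * (A * weight z)"
          using B(1) by (intro mult_mono \<kappa>(2) A[rule_format]) auto
        then show ?thesis by (simp only: abs_mult mult.assoc)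
      qed
      ultimately show ?thesis by (rule integrable_vv)
    qed
    have T1: "(LINT (x, t):slab T|lborel. (\<Sum>i\<in>UNIV. \<Sum>j\<in>UNIV.
               u (x, t) $ i * u (x, t) $ j * \<Theta> ((x0 - x) /\<^sub>R R) * RR i j (\<lambda>y. f (y, t)) x))
        = (LINT z|lborel. (\<Sum>i\<in>UNIV. \<Sum>j\<in>UNIV. v z $ i * v z $ j * (\<theta> (fst z) * riesz i j f z)))"
      unfolding set_lebesgue_integral_def
    proof (rule Bochner_Integration.integral_cong[OF refl])
      fix z :: spacetime
      obtain x t where z: "z = (x, t)" by (cases z)
      show "indicator (slab T) z *\<^sub>R (case z of (x, t) \<Rightarrow> \<Sum>i\<in>UNIV. \<Sum>j\<in>UNIV.
               u (x, t) $ i * u (x, t) $ j * \<Theta> ((x0 - x) /\<^sub>R R) * RR i j (\<lambda>y. f (y, t)) x)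
          = (\<Sum>i\<in>UNIV. \<Sum>j\<in>UNIV. v z $ i * v z $ j * (\<theta> (fst z) * riesz i j f z))"
        using v_eq[of z] v_0[of z]
        by (cases "z \<in> slab T") (simp_all add: z \<theta>_def riesz_def mult.assoc)
    qed
    have T2: "(LINT (x, t):slab T|lborel.
               (LINT y|lborel. (\<Sum>i\<in>UNIV. \<Sum>j\<in>UNIV.
                  (Kern i j (x - y) - Kern i j (x0 - y)) * (1 - \<Theta> ((x0 - y) /\<^sub>R R))
                  * (u (y, t) $ i * u (y, t) $ j))) * f (x, t))
        = (LINT z|lborel. (LINT y|lborel. (\<Sum>i\<in>UNIV. \<Sum>j\<in>UNIV.
              (Kern i j (fst z - y) - Kern i j (x0 - y)) * (1 - \<theta> y) * (v (y, snd z) $ i * v (y, snd z) $ j))) * f z)"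
      unfolding set_lebesgue_integral_def
    proof (rule Bochner_Integration.integral_cong[OF refl])
      fix z :: spacetime
      obtain x t where z: "z = (x, t)" by (cases z)
      show "indicator (slab T) z *\<^sub>R (case z of (x, t) \<Rightarrow>
               (LINT y|lborel. (\<Sum>i\<in>UNIV. \<Sum>j\<in>UNIV.
                  (Kern i j (x - y) - Kern i j (x0 - y)) * (1 - \<Theta> ((x0 - y) /\<^sub>R R))
                  * (u (y, t) $ i * u (y, t) $ j))) * f (x, t))
          = (LINT y|lborel. (\<Sum>i\<in>UNIV. \<Sum>j\<in>UNIV.
              (Kern i j (fst z - y) - Kern i j (x0 - y)) * (1 - \<theta> y) * (v (y, snd z) $ i * v (y, snd z) $ j))) * f z"
      proof (cases "z \<in> slab T")
        case True
        \<comment> \<open>The inner integral is taken at the same time \<open>t\<close>, and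
          membership in the slab is decided by \<open>t\<close> alone, so \<open>u\<close> agrees
          with its extension for every \<open>y\<close>.\<close>
        then have "v (y, t) = u (y, t)" for y by (intro v_eq) (auto simp: slab z)
        then show ?thesis using True by (simp add: z \<theta>_def)
      next
        case False
        then have "f z = 0" by (intro test_fun_eq_0[OF f']) (simp add: slab)
        then show ?thesis using False by simp
      qed
    qed
    also have "\<dots> = (LINT z|lborel. (\<Sum>i\<in>UNIV. \<Sum>j\<in>UNIV. v z $ i * v z $ j * ((1 - \<theta> (fst z)) * riesz i j f z)))"
      by (rule far_field_eq[OF f R mean, where \<kappa> = "\<lambda>y. 1 - \<theta> y" and B = "1 + B"]) (use \<theta>_le \<theta>_near in auto)
    finally have T2': "(LINT (x, t):slab T|lborel.
               (LINT y|lborel. (\<Sum>i\<in>UNIV. \<Sum>j\<in>UNIV.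
                  (Kern i j (x - y) - Kern i j (x0 - y)) * (1 - \<Theta> ((x0 - y) /\<^sub>R R))
                  * (u (y, t) $ i * u (y, t) $ j))) * f (x, t))
        = (LINT z|lborel. (\<Sum>i\<in>UNIV. \<Sum>j\<in>UNIV. v z $ i * v z $ j * ((1 - \<theta> (fst z)) * riesz i j f z)))" .
    note int1 = int[OF m\<theta> \<theta>_le(1)]
    have m1\<theta>: "(\<lambda>y. 1 - \<theta> y) \<in> borel_measurable borel" by measurable
    note int2 = int[OF m1\<theta> \<theta>_le(2)]
    have "p f = (LINT z|lborel. (\<Sum>i\<in>UNIV. \<Sum>j\<in>UNIV. v z $ i * v z $ j * (\<theta> (fst z) * riesz i j f z)))
        + (LINT z|lborel. (\<Sum>i\<in>UNIV. \<Sum>j\<in>UNIV. v z $ i * v z $ j * ((1 - \<theta> (fst z)) * riesz i j f z)))"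
    proof -
      have s: "(LINT z|lborel. (\<Sum>i\<in>UNIV. \<Sum>j\<in>UNIV. v z $ i * v z $ j * (\<kappa> (fst z) * riesz i j f z)))
          = (\<Sum>i\<in>UNIV. \<Sum>j\<in>UNIV. LINT z|lborel. v z $ i * v z $ j * (\<kappa> (fst z) * riesz i j f z))"
        if "\<kappa> \<in> borel_measurable borel" "\<And>y. \<bar>\<kappa> y\<bar> \<le> 1 + B" for \<kappa>
        by (simp add: int[OF that])
      have "(LINT z|lborel. v z $ i * v z $ j * (\<theta> (fst z) * riesz i j f z))
          + (LINT z|lborel. v z $ i * v z $ j * ((1 - \<theta> (fst z)) * riesz i j f z))
          = (LINT z|lborel. v z $ i * v z $ j * riesz i j f z)" for i j
        by (subst Bochner_Integration.integral_add[OF int1 int2, symmetric])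
          (simp add: algebra_simps)
      then show ?thesis
        unfolding s[OF m\<theta> \<theta>_le(1)] s[OF m1\<theta> \<theta>_le(2)] pf
        \<comment> \<open>In \<open>pf\<close> the second index of the Riesz transform is summed
          outside, in the expansion the first one.\<close>
        by (subst sum.swap) (simp add: sum.distrib[symmetric])
    qed
    then show "p (spatial_div \<psi>) - fun_distr (slab T) (\<lambda>(x, t). 0) (spatial_div \<psi>) =
            (LINT (x, t):slab T|lborel. (\<Sum>i\<in>UNIV. \<Sum>j\<in>UNIV.
               u (x, t) $ i * u (x, t) $ j * \<Theta> ((x0 - x) /\<^sub>R R)
               * RR i j (\<lambda>y. spatial_div \<psi> (y, t)) x))
          + (LINT (x, t):slab T|lborel.
               (LINT y|lborel. (\<Sum>i\<in>UNIV. \<Sum>j\<in>UNIV.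
                  (Kern i j (x - y) - Kern i j (x0 - y)) * (1 - \<Theta> ((x0 - y) /\<^sub>R R))
                  * (u (y, t) $ i * u (y, t) $ j)))
               * spatial_div \<psi> (x, t))"
      using T1 T2' by (simp add: f_def[symmetric] fun_distr_def set_lebesgue_integral_def case_prod_beta)
  qed
qed

end
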